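(* Let $\mathcal{T}$ be a weighted Galton--Watson tree with weight law $\nu$ satisfying $m>1$, $\mathbb{E}^\nu\big[\sum_{i\in\mathbb{N}}\lambda_i\big]<\infty$ and $\pi((\lambda_i)_{i\in\mathbb{N}})\ge1$ $\nu$-a.s. Then the map $\mathcal{T}\mapsto h_*(\mathcal{T})$ is constant $\mathbb{P}^{\mathrm{GW}}$-almost surely.
   Context: Notation: $\mathbb{N}=\{1,2,\dots\}$. Trees. Let $\mathcal{X}=\bigcup_{i\ge 0}\mathbb{N}^i$ with $\mathbb{N}^0=\{\emptyset\}$ (Ulam--Harris labels); the parent of $x=(x_1,\dots,x_i)$, $i\geq 1$, is $x^-=(x_1,\dots,x_{i-1})$. A tree is a subset of $\mathcal{X}$ containing the root $\emptyset$, closed under taking parents, in which each vertex has finitely many children; $x\sim y$ means $x=y^-$ or $y=x^-$. A weighted tree carries symmetric conductances $\lambda_{x,y}=\lambda_{y,x}\in(0,\infty)$ on its edges. Galton--Watson tree. Let $\nu$ be a probability measure on $[0,\infty)^{\mathbb{N}}$ such that $\nu$-a.s. the sequence $(\lambda_i)_{i\in\mathbb{N}}$ has only finitely many positive entries, which occupy an initial segment of the indices. No independence between the $\lambda_i$ is assumed. Let $\pi((\lambda_i)_i)=|\{i:\lambda_i>0\}|$, $\mu=\nu\circ\pi^{-1}$ and $m=\sum_{i\ge0} i\mu(i)$ (possibly infinite). The weighted Galton--Watson tree $\mathcal{T}$, with law $\mathbb{P}^{\mathrm{GW}}$, starts from $\emptyset$; each vertex $x$ independently receives a vector $(\lambda_{x,xi})_{i\in\mathbb{N}}$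 of law $\nu$, has the children $xi$, $1\le i\le\pi((\lambda_{x,xi})_i)$, and the edge $\{x,xi\}$ has conductance $\lambda_{x,xi}$. As $\pi\ge1$ a.s., the tree survives almost surely. Random walk and Gaussian free field. On a weighted tree $T$, let $\lambda_x=\sum_{y\sim x}\lambda_{x,y}$, and let $P_x^T$ be the law of the random walk $(X_n)_{n\ge0}$ started at $x$ with transition probabilities $\lambda_{x,y}/\lambda_x$ for $x\sim y$. If $T$ is transient, $g^T(x,y)=\lambda_y^{-1}E_x^T[\sum_{k\ge0}\mathbf{1}_{\{X_k=y\}}]$ is the Green function, and under $\mathbb{P}^{\mathrm{G}}_T$, $(\varphi_x)_{x\in T}$ is the centered Gaussian field with covariance $g^T$. The tree $\mathcal{T}$ is $\mathbb{P}^{\mathrm{GW}}$-a.s. transient. Critical parameter: with $E^{\ge h}=\{x\in\mathcal{T}:\varphi_x\ge h\}$, $h_*(\mathcal{T})=\inf\{h\in\mathbb{R}: \mathbb{P}^{\mathrm{G}}_{\mathcal{T}}\text{-a.s. all connected components of }E^{\ge h}\text{ are bounded}\}$ (an element of $[-\infty,\infty]$). *)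

theory Defs
  imports "HOL-Probability.Probability"
begin

text \<open>
  Ulam--Harris labels are lists of natural numbers. Indices start at \<open>0\<close> instead of \<open>1\<close>, both for
  the children of a vertex and for the entries of a weight sequence. The root is the empty
  list, \<open>x @ [i]\<close> is the \<open>i\<close>-th child of \<open>x\<close>, and the parent of \<open>x \<noteq> []\<close> is \<open>butlast x\<close>.
\<close>

type_synonym label = "nat list"

record weighted_tree =
  verts :: "label set"
  conductance :: "label \<Rightarrow> label \<Rightarrow> real"

definition edges :: "weighted_tree \<Rightarrow> (label \<times> label) set" where
  "edges T = {(x, y). x \<in> verts T \<and> y \<in> verts T \<and>
     (y \<noteq> [] \<and> x = butlast y \<or> x \<noteq> [] \<and> y = butlast x)}"

definition is_weighted_tree :: "weighted_tree \<Rightarrow> bool" where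
  "is_weighted_tree T \<longleftrightarrow>
     [] \<in> verts T \<and>
     (\<forall>x\<in>verts T. x \<noteq> [] \<longrightarrow> butlast x \<in> verts T) \<and>
     (\<forall>x\<in>verts T. finite {i. x @ [i] \<in> verts T}) \<and>
     (\<forall>(x, y)\<in>edges T. conductance T x y = conductance T y x \<and> conductance T x y > 0)"

definition total_conductance :: "weighted_tree \<Rightarrow> label \<Rightarrow> real" where
  "total_conductance T x = (\<Sum>y | (x, y) \<in> edges T. conductance T x y)"

definition walk_step :: "weighted_tree \<Rightarrow> label \<Rightarrow> label pmf" where
  "walk_step T x = embed_pmf (\<lambda>y. if (x, y) \<in> edges T
     then conductance T x y / total_conductance T x else 0)"

text \<open>
  The law of the walk on the space of trajectories is the Ionescu-Tulcea measure of the kernels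
  below: the position at time \<open>0\<close> is \<open>x\<close>, and the position at time \<open>Suc n\<close> is drawn from the
  transition probabilities at the position at time \<open>n\<close>.
\<close>

fun walk_kernel :: "weighted_tree \<Rightarrow> label \<Rightarrow> nat \<Rightarrow> (nat \<Rightarrow> label) \<Rightarrow> label measure" where
  "walk_kernel T x 0 X = return (count_space UNIV) x"
| "walk_kernel T x (Suc n) X = measure_pmf (walk_step T (X n))"

definition walk_law :: "weighted_tree \<Rightarrow> label \<Rightarrow> (nat \<Rightarrow> label) measure" where
  "walk_law T x = projective_family.lim UNIV
     (Ionescu_Tulcea.CI (walk_kernel T x) (\<lambda>_. count_space UNIV)) (\<lambda>_. count_space UNIV)"

lemma Ionescu_Tulcea_walk_kernel:
  "Ionescu_Tulcea (walk_kernel T x) (\<lambda>_. count_space UNIV)"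
proof (rule Ionescu_Tulcea.intro)
  fix i :: nat
  show "walk_kernel T x i \<in>
    measurable (PiM {0..<i} (\<lambda>_. count_space UNIV)) (subprob_algebra (count_space UNIV))"
  proof (cases i)
    case 0
    have "walk_kernel T x 0 = (\<lambda>_. return (count_space UNIV) x)" by auto
    then show ?thesis unfolding 0 by (auto simp: space_subprob_algebra
          intro!: measurable_const prob_space_imp_subprob_space prob_space_return)
  next
    case (Suc n)
    have eq: "walk_kernel T x (Suc n) = (\<lambda>X. measure_pmf (walk_step T (X n)))" by auto
    have 1: "(\<lambda>X. X n) \<in> measurable (PiM {0..<Suc n} (\<lambda>_. count_space UNIV)) (count_space UNIV)"
      by (rule measurable_component_singleton) auto
    have 2: "(\<lambda>y. measure_pmf (walk_step T y)) \<in>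
        measurable (count_space UNIV) (subprob_algebra (count_space UNIV))"
      by (auto simp: space_subprob_algebra measure_pmf.subprob_space_axioms)
    show ?thesis unfolding Suc eq using measurable_compose[OF 1 2] .
  qed
next
  fix i :: nat and X :: "nat \<Rightarrow> label"
  show "prob_space (walk_kernel T x i X)"
    by (cases i) (auto intro: prob_space_return measure_pmf.prob_space_axioms)
qed

text \<open>
  The Green function is only meaningful on transient trees. If the expected number of visits is
  infinite, \<^const>\<open>enn2real\<close> yields the dummy value \<open>0\<close>.
\<close>

definition green :: "weighted_tree \<Rightarrow> label \<Rightarrow> label \<Rightarrow> real" where
  "green T x y =
     enn2real (\<integral>\<^sup>+X. (\<Sum>k. indicator {y} (X k)) \<partial>walk_law T x) / total_conductance T y"

definition centered_normal :: "real \<Rightarrow> real measure" where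
  "centered_normal \<sigma> =
     (if \<sigma> = 0 then return borel 0 else density lborel (\<lambda>z. ennreal (normal_density 0 \<sigma> z)))"

definition is_centered_gaussian_field ::
    "'i set \<Rightarrow> ('i \<Rightarrow> 'i \<Rightarrow> real) \<Rightarrow> ('i \<Rightarrow> real) measure \<Rightarrow> bool" where
  "is_centered_gaussian_field I g M \<longleftrightarrow>
     prob_space M \<and>
     sets M = sets (PiM I (\<lambda>_. borel)) \<and>
     (\<forall>J a. finite J \<and> J \<subseteq> I \<longrightarrow>
        (\<exists>\<sigma>\<ge>0. distr M borel (\<lambda>\<phi>. \<Sum>x\<in>J. a x * \<phi> x) = centered_normal \<sigma>)) \<and>
     (\<forall>x\<in>I. \<forall>y\<in>I. (\<integral>\<phi>. \<phi> x * \<phi> y \<partial>M) = g x y)"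

text \<open>A Gaussian law is determined by its covariance, so the choice below is unique.\<close>

definition gff_law :: "weighted_tree \<Rightarrow> (label \<Rightarrow> real) measure" where
  "gff_law T = (SOME M. is_centered_gaussian_field (verts T) (green T) M)"

definition level_set :: "weighted_tree \<Rightarrow> (label \<Rightarrow> real) \<Rightarrow> real \<Rightarrow> label set" where
  "level_set T \<phi> h = {x \<in> verts T. \<phi> x \<ge> h}"

definition connected_component_of_vertex :: "weighted_tree \<Rightarrow> label set \<Rightarrow> label \<Rightarrow> label set" where
  "connected_component_of_vertex T E x = {y. (x, y) \<in> (edges T \<inter> E \<times> E)\<^sup>*}"

text \<open>Bounded means of finite diameter in the graph distance of the tree.\<close>

definition graph_bounded :: "weighted_tree \<Rightarrow> label set \<Rightarrow> bool" where
  "graph_bounded T C \<longleftrightarrow> (\<exists>n. \<forall>x\<in>C. \<forall>y\<in>C. \<exists>k\<le>n. (x, y) \<in> edges T ^^ k)"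

definition h_star :: "weighted_tree \<Rightarrow> ereal" where
  "h_star T = Inf (ereal ` {h. AE \<phi> in gff_law T. \<forall>x\<in>level_set T \<phi> h.
     graph_bounded T (connected_component_of_vertex T (level_set T \<phi> h) x)})"

definition num_positive :: "(nat \<Rightarrow> real) \<Rightarrow> nat" where
  "num_positive l = card {i. l i > 0}"

definition is_weight_law :: "(nat \<Rightarrow> real) measure \<Rightarrow> bool" where
  "is_weight_law \<nu> \<longleftrightarrow>
     prob_space \<nu> \<and>
     sets \<nu> = sets (PiM UNIV (\<lambda>_. borel)) \<and>
     (AE l in \<nu>. \<forall>i. l i \<ge> 0) \<and>
     (AE l in \<nu>. finite {i. l i > 0} \<and> (\<forall>j. l j > 0 \<longrightarrow> (\<forall>i\<le>j. l i > 0)))"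

definition offspring_law :: "(nat \<Rightarrow> real) measure \<Rightarrow> nat measure" where
  "offspring_law \<nu> = distr \<nu> (count_space UNIV) num_positive"

definition mean_offspring :: "(nat \<Rightarrow> real) measure \<Rightarrow> ennreal" where
  "mean_offspring \<nu> = (\<Sum>i. of_nat i * emeasure (offspring_law \<nu>) {i})"

text \<open>
  A Galton--Watson tree is a function of a family \<open>\<omega>\<close> of weight sequences, one for each label;
  \<open>\<omega> x\<close> holds the conductances from \<open>x\<close> to its potential children. The sequences of labels outside
  the tree are ignored.
\<close>

inductive_set gw_verts :: "(label \<Rightarrow> nat \<Rightarrow> real) \<Rightarrow> label set" for \<omega> where
  root: "[] \<in> gw_verts \<omega>"
| child: "x \<in> gw_verts \<omega> \<Longrightarrow> i < num_positive (\<omega> x) \<Longrightarrow> x @ [i] \<in> gw_verts \<omega>"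

definition gw_conductance :: "(label \<Rightarrow> nat \<Rightarrow> real) \<Rightarrow> label \<Rightarrow> label \<Rightarrow> real" where
  "gw_conductance \<omega> x y =
     (if y \<noteq> [] \<and> x = butlast y then \<omega> x (last y)
      else if x \<noteq> [] \<and> y = butlast x then \<omega> y (last x)
      else 0)"

definition gw_tree :: "(label \<Rightarrow> nat \<Rightarrow> real) \<Rightarrow> weighted_tree" where
  "gw_tree \<omega> = \<lparr>verts = gw_verts \<omega>, conductance = gw_conductance \<omega>\<rparr>"

definition gw_measure :: "(nat \<Rightarrow> real) measure \<Rightarrow> (label \<Rightarrow> nat \<Rightarrow> real) measure" where
  "gw_measure \<nu> = PiM UNIV (\<lambda>_. \<nu>)"

lemma gw_verts_snoc_iff:
  "x @ [i] \<in> gw_verts \<omega> \<longleftrightarrow> x \<in> gw_verts \<omega> \<and> i < num_positive (\<omega> x)"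
  by (subst gw_verts.simps) auto

lemma num_positive_initial:
  assumes "finite {i. l i > (0::real)}" and "\<And>i j. l j > 0 \<Longrightarrow> i \<le> j \<Longrightarrow> l i > 0"
    and "i < num_positive l"
  shows "l i > 0"
proof (rule ccontr)
  assume "\<not> l i > 0"
  then have "{j. l j > 0} \<subseteq> {..<i}" using assms(2) by (auto simp: not_less[symmetric])
  then have "num_positive l \<le> i"
    unfolding num_positive_def using card_mono[of "{..<i}"] by fastforce
  with assms(3) show False by simp
qed

lemma AE_is_weighted_tree_gw_tree:
  assumes "is_weight_law \<nu>"
  shows "AE \<omega> in gw_measure \<nu>. is_weighted_tree (gw_tree \<omega>)"
proof -
  let ?P = "\<lambda>l. finite {i. l i > (0::real)} \<and> (\<forall>j. l j > 0 \<longrightarrow> (\<forall>i\<le>j. l i > 0))"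
  have ps: "prob_space \<nu>" and P: "AE l in \<nu>. ?P l"
    using assms by (auto simp: is_weight_law_def)
  have "AE \<omega> in gw_measure \<nu>. \<forall>x. ?P (\<omega> x)"
    unfolding AE_all_countable gw_measure_def
  proof
    fix x :: label
    show "AE \<omega> in PiM UNIV (\<lambda>_. \<nu>). ?P (\<omega> x)"
      using AE_PiM_component[of UNIV "\<lambda>_. \<nu>" x ?P] ps P by simp
  qed
  then show ?thesis
  proof (rule AE_mp, intro AE_I2 impI)
    fix \<omega> :: "label \<Rightarrow> nat \<Rightarrow> real"
    assume \<omega>: "\<forall>x. ?P (\<omega> x)"
    have pos: "\<omega> x i > 0" if "i < num_positive (\<omega> x)" for x i
      using num_positive_initial[of "\<omega> x" i] \<omega> that by blast
    have parent: "butlast y \<in> gw_verts \<omega> \<and> last y < num_positive (\<omega> (butlast y))"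
      if "y \<in> gw_verts \<omega>" "y \<noteq> []" for y
      using that gw_verts_snoc_iff[of "butlast y" "last y" \<omega>] by simp
    have ne: "butlast x \<noteq> y \<or> butlast y \<noteq> x" if "x \<noteq> []" for x y :: label
    proof (rule ccontr)
      assume "\<not> ?thesis"
      then have "length x - 1 = length y" "length y - 1 = length x"
        by (metis length_butlast)+
      with that show False by (cases x) auto
    qed
    have 1: "finite {i. x @ [i] \<in> gw_verts \<omega>}" for x
      by (rule finite_subset[of _ "{..<num_positive (\<omega> x)}"]) (auto simp: gw_verts_snoc_iff)
    have 2: "gw_conductance \<omega> x y = gw_conductance \<omega> y x \<and> gw_conductance \<omega> x y > 0"
      if "(x, y) \<in> edges (gw_tree \<omega>)" for x y
      using that ne[of x y] ne[of y x] parent[of x] parent[of y] pos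
      by (auto simp: edges_def gw_tree_def gw_conductance_def)
    show "is_weighted_tree (gw_tree \<omega>)"
      using 1 2 parent by (auto simp: is_weighted_tree_def gw_tree_def intro: gw_verts.root)
  qed
qed

end

theory Submission
  imports Defs
begin

text \<open>
  Call a level \<open>h\<close> subcritical for a tree if almost surely all components of the level set above \<open>h\<close>
  are bounded. The critical parameter is the infimum of the subcritical levels, and by monotonicity
  of the rational ones, so it is enough that for every \<open>h\<close> the event that \<open>h\<close> is subcritical for
  the random tree has probability \<open>0\<close> or \<open>1\<close>.

  This event is \<^emph>\<open>inherited\<close>: if \<open>h\<close> is subcritical for a tree, it is subcritical for the subtree
  of each child of the root (\<open>subcritical_shift\<close>). Let \<open>p\<close> be the probability of an inherited event
  and \<open>q\<close> the probability that the root has at least two children. The root has at least one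
  child, and the subtrees of the first two children are independent copies of the whole tree and
  independent of the number of children, so \<open>p \<le> (1 - q) p + q p\<^sup>2\<close>. As the mean number of children
  exceeds \<open>1\<close>, \<open>q\<close> is positive, and therefore \<open>p \<in> {0, 1}\<close> (\<open>zero_one\<close>).

  Inheritance and measurability both rest on an explicit form of the free field. Let \<open>c x\<close> be the
  effective conductance between \<open>x\<close> and infinity inside the subtree of \<open>x\<close>; it is the limit of the
  conductances to finite depth, which satisfy the series and parallel laws. Let \<open>l y\<close> be the
  conductance of the edge from \<open>y\<close> to its parent and put \<open>v y = 1 / (l y + c y)\<close>, with \<open>l = 0\<close> at the
  root. If the tree is transient, that is \<open>c > 0\<close> at the root, then the free field has the law of
  \<open>\<phi> root = sqrt (v root) * z root\<close> and \<open>\<phi> y = l y * v y * \<phi> (parent y) + sqrt (v y) * z y\<close>, where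
  the \<open>z y\<close> are independent standard normal variables. Away from the root the coefficients at a
  vertex depend only on the edge to its parent and on the subtree below it. Hence the restriction
  of the field to the subtree of a child and the free field of that subtree are driven by the same
  Markov chain, with different nondegenerate Gaussian values at the root of the subtree, and so
  the second law is absolutely continuous with respect to the first.

  That the chain above is the free field is shown by comparing covariances. A Gaussian law is
  determined by its covariance (\<open>gaussian_field_unique\<close>), by the theorem of Cramer and Wold. The
  covariance of the chain solves the equation of the Green function, which bounds the expected
  number of visits from above; the covariance for the tree cut off at depth \<open>n\<close> solves it up to
  depth \<open>n\<close> and vanishes beyond, which bounds the visits from below; and the two bounds meet as
  \<open>n\<close> grows (\<open>green_transient\<close>).

  If the tree is recurrent, the lower bounds diverge, the Green function takes its default value
  \<open>0\<close>, and the field vanishes (\<open>green_recurrent\<close>). Recurrence is itself inherited, so the zero-one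
  law applies to it first: almost surely the tree and the subtrees of the children of the root are
  all recurrent or all transient, and in the recurrent case inheritance is a statement about the
  zero field only.
\<close>

section \<open>The distribution of a random vector is determined by its linear combinations\<close>

text \<open>
  Levy's uniqueness theorem is stated for probability laws; the common total mass is the value of
  both characteristic functions at \<open>0\<close>, so it can be normalized away. The version for finite
  measures is what the induction for \<open>cramer_wold\<close> needs, where measures are reweighted.
\<close>

lemma finite_measure_char_unique:
  fixes X :: "'a \<Rightarrow> real" and Y :: "'b \<Rightarrow> real"
  assumes "finite_measure M" "finite_measure N"
    and X[measurable]: "X \<in> borel_measurable M" and Y[measurable]: "Y \<in> borel_measurable N"
    and eq: "\<And>t. (\<integral>x. iexp (t * X x) \<partial>M) = (\<integral>y. iexp (t * Y y) \<partial>N)"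
    and B[measurable]: "B \<in> sets borel"
  shows "measure M {x \<in> space M. X x \<in> B} = measure N {y \<in> space N. Y y \<in> B}"
proof -
  interpret M: finite_measure M by fact
  interpret N: finite_measure N by fact
  define m where "m = measure M (space M)"
  have m': "m = measure N (space N)"
    using eq[of 0] by (simp add: m_def)
  show ?thesis
  proof (cases "m = 0")
    case True
    have "measure M {x \<in> space M. X x \<in> B} \<le> m"
      unfolding m_def by (auto intro!: M.finite_measure_mono)
    moreover have "measure N {y \<in> space N. Y y \<in> B} \<le> m"
      unfolding m' by (auto intro!: N.finite_measure_mono)
    ultimately    show ?thesis using True measure_nonneg[of M] measure_nonneg[of N] by (metis order_antisym)
  next
    case False
    then have m: "m > 0" by (simp add: m_def zero_less_measure_iff)
    have dist: "real_distribution (distr (density K (\<lambda>_. ennreal (1 / m))) borel Z)"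
      and char: "char (distr (density K (\<lambda>_. ennreal (1 / m))) borel Z) t =
        (1 / m) *\<^sub>R (\<integral>x. iexp (t * Z x) \<partial>K)"
      and meas: "measure (distr (density K (\<lambda>_. ennreal (1 / m))) borel Z) B =
        (1 / m) * measure K {x \<in> space K. Z x \<in> B}"
      if K: "finite_measure K" and mK: "m = measure K (space K)" and Z[measurable]: "Z \<in> borel_measurable K"
      for K :: "'c measure" and Z and t
    proof -
      interpret K: finite_measure K by fact
      have "emeasure (density K (\<lambda>_. ennreal (1 / m))) (space K) = ennreal (1 / m) * ennreal m"
        by (simp add: emeasure_density_const K.emeasure_eq_measure mK)
      also have "\<dots> = 1" using m by (simp flip: ennreal_mult')
      finally have "prob_space (density K (\<lambda>_. ennreal (1 / m)))"
        by (intro prob_spaceI) simp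
      then show "real_distribution (distr (density K (\<lambda>_. ennreal (1 / m))) borel Z)"
        by (intro prob_space.real_distribution_distr) simp_all
      show "char (distr (density K (\<lambda>_. ennreal (1 / m))) borel Z) t =
        (1 / m) *\<^sub>R (\<integral>x. iexp (t * Z x) \<partial>K)"
        unfolding char_def using m by (simp add: integral_distr integral_density)
      have "measure (distr (density K (\<lambda>_. ennreal (1 / m))) borel Z) B =
        measure (density K (\<lambda>_. ennreal (1 / m))) {x \<in> space K. Z x \<in> B}"
        by (subst measure_distr) (auto intro!: arg_cong[where f="measure _"])
      also have "\<dots> = (1 / m) * measure K {x \<in> space K. Z x \<in> B}"
        unfolding measure_def using m
        by (subst emeasure_density_const) (auto simp: enn2real_mult)
      finally show "measure (distr (density K (\<lambda>_. ennreal (1 / m))) borel Z) B =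
        (1 / m) * measure K {x \<in> space K. Z x \<in> B}" .
    qed
    have "distr (density M (\<lambda>_. ennreal (1 / m))) borel X = distr (density N (\<lambda>_. ennreal (1 / m))) borel Y"
      by (intro Levy_uniqueness ext dist[OF assms(1) m_def X] dist[OF assms(2) m' Y])
         (simp only: char[OF assms(1) m_def X] char[OF assms(2) m' Y] eq)
    then have "(1 / m) * measure M {x \<in> space M. X x \<in> B} = (1 / m) * measure N {x \<in> space N. Y x \<in> B}"
      unfolding meas[OF assms(1) m_def X, symmetric] meas[OF assms(2) m' Y, symmetric] by simp
    then show ?thesis using m by auto
  qed
qed

text \<open>
  Reweighting by \<open>1 + cos (U + \<theta>)\<close> keeps a measure nonnegative and expresses the transform of \<open>X\<close>
  under the new measure by joint transforms of \<open>X\<close> and \<open>U\<close> under the old one.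
\<close>

lemma integral_iexp_cos_weight:
  fixes X U :: "'a \<Rightarrow> real"
  assumes "finite_measure M" and [measurable]: "X \<in> borel_measurable M" "U \<in> borel_measurable M"
  shows "(\<integral>x. iexp (s * X x) \<partial>density M (\<lambda>x. ennreal (1 + cos (U x + \<theta>)))) =
    (\<integral>x. iexp (s * X x) \<partial>M) + (iexp \<theta> / 2) * (\<integral>x. iexp (s * X x + U x) \<partial>M) +
    (iexp (- \<theta>) / 2) * (\<integral>x. iexp (s * X x - U x) \<partial>M)"
proof -
  interpret finite_measure M by fact
  have int: "integrable M (\<lambda>x. iexp (f x))" if "f \<in> borel_measurable M" for f :: "'a \<Rightarrow> real"
    using that by (intro integrable_const_bound[of _ 1]) auto
  have nn: "0 \<le> 1 + cos r" for r :: real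
    using cos_ge_minus_one[of r] by linarith
  have pointwise: "(1 + cos (u + \<theta>)) *\<^sub>R iexp a =
    (iexp a + (iexp \<theta> / 2) * iexp (a + u)) + (iexp (- \<theta>) / 2) * iexp (a - u)" for a u
  proof -
    have "complex_of_real (cos (u + \<theta>)) = (iexp (u + \<theta>) + iexp (- (u + \<theta>))) / 2"
      by (simp only: cos_of_real[symmetric] cos_exp_eq of_real_minus mult_minus_right)
    moreover have "iexp (u + \<theta>) * iexp a = iexp \<theta> * iexp (a + u)"
      unfolding exp_add[symmetric] by (simp add: algebra_simps)
    moreover have "iexp (- (u + \<theta>)) * iexp a = iexp (- \<theta>) * iexp (a - u)"
      unfolding exp_add[symmetric] by (simp add: algebra_simps)
    ultimately show ?thesis
      by (simp only: scaleR_conv_of_real of_real_add of_real_1 distrib_right mult_1 times_divide_eq_left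
          add_divide_distrib add.assoc)
  qed
  have "(\<integral>x. iexp (s * X x) \<partial>density M (\<lambda>x. ennreal (1 + cos (U x + \<theta>)))) =
    (\<integral>x. (1 + cos (U x + \<theta>)) *\<^sub>R iexp (s * X x) \<partial>M)"
    by (rule integral_density) (auto simp: nn)
  also have "\<dots> = (\<integral>x. (iexp (s * X x) + (iexp \<theta> / 2) * iexp (s * X x + U x)) +
      (iexp (- \<theta>) / 2) * iexp (s * X x - U x) \<partial>M)"
    by (rule Bochner_Integration.integral_cong[OF refl]) (rule pointwise)
  also have "\<dots> = (\<integral>x. iexp (s * X x) + (iexp \<theta> / 2) * iexp (s * X x + U x) \<partial>M) +
      (\<integral>x. (iexp (- \<theta>) / 2) * iexp (s * X x - U x) \<partial>M)"
    by (intro Bochner_Integration.integral_add Bochner_Integration.integrable_add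
        Bochner_Integration.integrable_mult_right int) measurable
  also have "(\<integral>x. iexp (s * X x) + (iexp \<theta> / 2) * iexp (s * X x + U x) \<partial>M) =
      (\<integral>x. iexp (s * X x) \<partial>M) + (\<integral>x. (iexp \<theta> / 2) * iexp (s * X x + U x) \<partial>M)"
    by (intro Bochner_Integration.integral_add Bochner_Integration.integrable_mult_right int) measurable
  also have "(\<integral>x. (iexp \<theta> / 2) * iexp (s * X x + U x) \<partial>M) = (iexp \<theta> / 2) * (\<integral>x. iexp (s * X x + U x) \<partial>M)"
    by (intro Bochner_Integration.integral_mult_right int) measurable
  also have "(\<integral>x. (iexp (- \<theta>) / 2) * iexp (s * X x - U x) \<partial>M) = (iexp (- \<theta>) / 2) * (\<integral>x. iexp (s * X x - U x) \<partial>M)"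
    by (intro Bochner_Integration.integral_mult_right int) measurable
  finally show ?thesis .
qed

text \<open>
  Induction on the number of coordinates, using the theorem in one dimension only. Fix a linear
  combination \<open>U\<close> of the coordinates in \<open>J\<close> and reweight both measures by \<open>1 + cos (U + \<theta>)\<close>. The
  last coordinate then has the same transform under both, so the event \<open>E\<close> that it lies in its set
  has the same reweighted mass. Taking \<open>\<theta> = 0\<close> and \<open>\<theta> = - \<pi> / 2\<close> shows that the
  restrictions of the measures to \<open>E\<close> give the same integral to \<open>exp (\<i> U)\<close>, for every such \<open>U\<close>,
  and the induction hypothesis applies to these restrictions.
\<close>

lemma cramer_wold:
  fixes X :: "'i \<Rightarrow> 'a \<Rightarrow> real" and Y :: "'i \<Rightarrow> 'b \<Rightarrow> real"
  assumes "finite J" "finite_measure M" "finite_measure N"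
    and "\<And>j. j \<in> J \<Longrightarrow> X j \<in> borel_measurable M" "\<And>j. j \<in> J \<Longrightarrow> Y j \<in> borel_measurable N"
    and "\<And>t. (\<integral>x. iexp (\<Sum>j\<in>J. t j * X j x) \<partial>M) = (\<integral>y. iexp (\<Sum>j\<in>J. t j * Y j y) \<partial>N)"
    and "\<And>j. j \<in> J \<Longrightarrow> B j \<in> sets borel"
  shows "measure M {x \<in> space M. \<forall>j\<in>J. X j x \<in> B j} = measure N {y \<in> space N. \<forall>j\<in>J. Y j y \<in> B j}"
  using assms
proof (induction J arbitrary: M N rule: finite_induct)
  case empty
  then show ?case using empty(5)[of "\<lambda>_. 0"]
    by (simp add: finite_measure.emeasure_eq_measure)
next
  case (insert k J)
  interpret M: finite_measure M by fact
  interpret N: finite_measure N by fact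
  have [measurable]: "X k \<in> borel_measurable M" "Y k \<in> borel_measurable N" "B k \<in> sets borel"
    "\<And>j. j \<in> J \<Longrightarrow> X j \<in> borel_measurable M" "\<And>j. j \<in> J \<Longrightarrow> Y j \<in> borel_measurable N"
    using insert.prems by auto
  have mX: "\<And>j. j \<in> J \<Longrightarrow> X j \<in> borel_measurable M" "X k \<in> borel_measurable M"
    and mY: "\<And>j. j \<in> J \<Longrightarrow> Y j \<in> borel_measurable N" "Y k \<in> borel_measurable N"
    by measurable
  have nn: "0 \<le> 1 + cos r" for r :: real
    using cos_ge_minus_one[of r] by linarith
  have char: "(\<integral>x. iexp (s * X k x + (\<Sum>j\<in>J. t j * X j x)) \<partial>M) =
    (\<integral>y. iexp (s * Y k y + (\<Sum>j\<in>J. t j * Y j y)) \<partial>N)" for s t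
  proof -
    have "(\<Sum>j\<in>J. (t(k := s)) j * Z j) = (\<Sum>j\<in>J. t j * Z j)" for Z
      using insert.hyps by (intro sum.cong) auto
    then show ?thesis using insert.prems(5)[of "t(k := s)"] insert.hyps by simp
  qed
  have char0: "(\<integral>x. iexp (s * X k x) \<partial>M) = (\<integral>y. iexp (s * Y k y) \<partial>N)" for s
    using char[of s "\<lambda>_. 0"] by simp
  have charm: "(\<integral>x. iexp (s * X k x - (\<Sum>j\<in>J. t j * X j x)) \<partial>M) =
    (\<integral>y. iexp (s * Y k y - (\<Sum>j\<in>J. t j * Y j y)) \<partial>N)" for s t
    using char[of s "\<lambda>j. - t j"] by (simp add: sum_negf)
  have weight_finite: "finite_measure (density K (\<lambda>x. ennreal (1 + cos (f x))))"
    if "finite_measure K" and [measurable]: "f \<in> borel_measurable K" for K :: "'c measure" and f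
  proof (rule finite_measureI)
    interpret K: finite_measure K by fact
    have "emeasure (density K (\<lambda>x. ennreal (1 + cos (f x)))) (space K) \<le> (\<integral>\<^sup>+x. 2 \<partial>K)"
    proof (subst emeasure_density)
      have "ennreal (1 + cos (f x)) * indicator (space K) x \<le> 2" for x
      proof -
        have "ennreal (1 + cos (f x)) \<le> ennreal 2" by (rule ennreal_leI) simp
        then show ?thesis by (auto simp: indicator_def)
      qed
      then show "(\<integral>\<^sup>+x. ennreal (1 + cos (f x)) * indicator (space K) x \<partial>K) \<le> (\<integral>\<^sup>+x. 2 \<partial>K)"
        by (intro nn_integral_mono)
    qed auto
    also have "\<dots> < \<infinity>" by (simp add: ennreal_mult_less_top K.emeasure_eq_measure)
    finally show "emeasure (density K (\<lambda>x. ennreal (1 + cos (f x)))) (space (density K (\<lambda>x. ennreal (1 + cos (f x))))) \<noteq> \<infinity>"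
      by simp
  qed
  have weight_measure: "measure (density K (\<lambda>x. ennreal (1 + cos (f x)))) {x \<in> space K. Z x \<in> B k} =
      measure K {x \<in> space K. Z x \<in> B k} + (\<integral>x. cos (f x) * indicator {x \<in> space K. Z x \<in> B k} x \<partial>K)"
    if "finite_measure K" and [measurable]: "f \<in> borel_measurable K" "Z \<in> borel_measurable K" for K :: "'c measure" and f Z
  proof -
    interpret K: finite_measure K by fact
    let ?E = "{x \<in> space K. Z x \<in> B k}"
    interpret D: finite_measure "density K (\<lambda>x. ennreal (1 + cos (f x)))"
      by (rule weight_finite) (fact, measurable)
    have "measure (density K (\<lambda>x. ennreal (1 + cos (f x)))) ?E =
      (\<integral>x. indicator ?E x \<partial>density K (\<lambda>x. ennreal (1 + cos (f x))))"
      by (subst Bochner_Integration.integral_indicator) (auto intro!: arg_cong[where f="measure _"])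
    also have "\<dots> = (\<integral>x. (1 + cos (f x)) *\<^sub>R indicator ?E x \<partial>K)"
      by (rule integral_density) (auto simp: nn)
    also have "\<dots> = (\<integral>x. indicator ?E x + cos (f x) * indicator ?E x \<partial>K)"
      by (simp add: algebra_simps)
    also have "\<dots> = (\<integral>x. indicator ?E x \<partial>K) + (\<integral>x. cos (f x) * indicator ?E x \<partial>K)"
      by (intro Bochner_Integration.integral_add K.integrable_const_bound[of _ 1])
         (auto simp: indicator_def abs_cos_le_one)
    also have "(\<integral>x. indicator ?E x \<partial>K) = measure K ?E"
      by (subst Bochner_Integration.integral_indicator) (auto intro!: arg_cong[where f="measure _"])
    finally show ?thesis .
  qed
  let ?EM = "{x \<in> space M. X k x \<in> B k}" and ?EN = "{y \<in> space N. Y k y \<in> B k}"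
  have E: "measure M ?EM = measure N ?EN"
    by (rule finite_measure_char_unique[OF insert.prems(1,2) _ _ char0]) auto
  have cos_eq: "(\<integral>x. cos ((\<Sum>j\<in>J. t j * X j x) + \<theta>) * indicator ?EM x \<partial>M) =
    (\<integral>y. cos ((\<Sum>j\<in>J. t j * Y j y) + \<theta>) * indicator ?EN y \<partial>N)" for t \<theta>
  proof -
    let ?M = "density M (\<lambda>x. ennreal (1 + cos ((\<Sum>j\<in>J. t j * X j x) + \<theta>)))"
    let ?N = "density N (\<lambda>x. ennreal (1 + cos ((\<Sum>j\<in>J. t j * Y j x) + \<theta>)))"
    have "measure ?M {x \<in> space ?M. X k x \<in> B k} = measure ?N {x \<in> space ?N. Y k x \<in> B k}"
    proof (rule finite_measure_char_unique)
      show "finite_measure ?M" by (rule weight_finite) (fact, measurable)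
      show "finite_measure ?N" by (rule weight_finite) (fact, measurable)
      fix s
      have wM: "(\<integral>x. iexp (s * X k x) \<partial>?M) =
        (\<integral>x. iexp (s * X k x) \<partial>M) + (iexp \<theta> / 2) * (\<integral>x. iexp (s * X k x + (\<Sum>j\<in>J. t j * X j x)) \<partial>M) +
        (iexp (- \<theta>) / 2) * (\<integral>x. iexp (s * X k x - (\<Sum>j\<in>J. t j * X j x)) \<partial>M)"
        by (rule integral_iexp_cos_weight) (fact, measurable)
      have wN: "(\<integral>x. iexp (s * Y k x) \<partial>?N) =
        (\<integral>x. iexp (s * Y k x) \<partial>N) + (iexp \<theta> / 2) * (\<integral>x. iexp (s * Y k x + (\<Sum>j\<in>J. t j * Y j x)) \<partial>N) +
        (iexp (- \<theta>) / 2) * (\<integral>x. iexp (s * Y k x - (\<Sum>j\<in>J. t j * Y j x)) \<partial>N)"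
        by (rule integral_iexp_cos_weight) (fact, measurable)
      show "(\<integral>x. iexp (s * X k x) \<partial>?M) = (\<integral>x. iexp (s * Y k x) \<partial>?N)"
        unfolding wM wN by (simp only: char char0 charm)
    qed auto
    then have "measure M ?EM + (\<integral>x. cos ((\<Sum>j\<in>J. t j * X j x) + \<theta>) * indicator ?EM x \<partial>M) =
      measure N ?EN + (\<integral>y. cos ((\<Sum>j\<in>J. t j * Y j y) + \<theta>) * indicator ?EN y \<partial>N)"
      by (simp add: weight_measure insert.prems(1,2))
    then show ?thesis using E by simp
  qed
  have iexp_eq: "(\<integral>x. iexp (\<Sum>j\<in>J. t j * Z j x) \<partial>density K (indicator {x \<in> space K. Z k x \<in> B k})) =
    Complex (\<integral>x. cos ((\<Sum>j\<in>J. t j * Z j x) + 0) * indicator {x \<in> space K. Z k x \<in> B k} x \<partial>K)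
      (\<integral>x. cos ((\<Sum>j\<in>J. t j * Z j x) + - (pi / 2)) * indicator {x \<in> space K. Z k x \<in> B k} x \<partial>K)"
    if "finite_measure K" and [measurable]: "\<And>j. j \<in> J \<Longrightarrow> Z j \<in> borel_measurable K" "Z k \<in> borel_measurable K"
    for K :: "'c measure" and Z t
  proof -
    interpret K: finite_measure K by fact
    let ?E = "{x \<in> space K. Z k x \<in> B k}" and ?u = "\<lambda>x. \<Sum>j\<in>J. t j * Z j x"
    have int: "integrable K (\<lambda>x. indicator ?E x *\<^sub>R iexp (?u x))"
      by (intro K.integrable_const_bound[of _ 1]) (auto simp: indicator_def)
    have "(\<integral>x. iexp (?u x) \<partial>density K (indicator ?E)) =
      (\<integral>x. iexp (?u x) \<partial>density K (\<lambda>x. ennreal (indicator ?E x)))"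
      by (simp add: ennreal_indicator)
    also have "\<dots> = (\<integral>x. indicator ?E x *\<^sub>R iexp (?u x) \<partial>K)"
      by (rule integral_density) auto
    also have "\<dots> = Complex (\<integral>x. Re (indicator ?E x *\<^sub>R iexp (?u x)) \<partial>K) (\<integral>x. Im (indicator ?E x *\<^sub>R iexp (?u x)) \<partial>K)"
      by (simp only: integral_Re[OF int] integral_Im[OF int] complex_surj)
    also have "\<dots> = Complex (\<integral>x. cos (?u x + 0) * indicator ?E x \<partial>K)
      (\<integral>x. cos (?u x + - (pi / 2)) * indicator ?E x \<partial>K)"
      by (simp add: Re_exp Im_exp mult.commute cos_diff)
    finally show ?thesis .
  qed
  have dens: "measure (density K (indicator {x \<in> space K. Z k x \<in> B k})) {x \<in> space K. \<forall>j\<in>J. Z j x \<in> B j} =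
    measure K {x \<in> space K. \<forall>j\<in>insert k J. Z j x \<in> B j}"
    if [measurable]: "\<And>j. j \<in> J \<Longrightarrow> Z j \<in> borel_measurable K" "Z k \<in> borel_measurable K" for K :: "'c measure" and Z
  proof -
    have [measurable]: "{x \<in> space K. \<forall>j\<in>J. Z j x \<in> B j} \<in> sets K"
      using insert.hyps insert.prems(6) by (intro sets.sets_Collect_finite_All measurable_sets_Collect[OF that(1)]) auto
    show ?thesis unfolding measure_def
      by (subst emeasure_density) (auto simp: nn_integral_indicator[symmetric] indicator_def
          simp del: nn_integral_indicator intro!: arg_cong[where f=enn2real] nn_integral_cong)
  qed
  have fin: "finite_measure (density K (indicator {x \<in> space K. Z x \<in> B k}))"
    if "finite_measure K" and [measurable]: "Z \<in> borel_measurable K" for K :: "'c measure" and Z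
  proof (rule finite_measureI)
    interpret K: finite_measure K by fact
    show "emeasure (density K (indicator {x \<in> space K. Z x \<in> B k}))
      (space (density K (indicator {x \<in> space K. Z x \<in> B k}))) \<noteq> \<infinity>"
      by (simp add: emeasure_restricted)
  qed
  have "measure (density M (indicator ?EM)) {x \<in> space (density M (indicator ?EM)). \<forall>j\<in>J. X j x \<in> B j} =
    measure (density N (indicator ?EN)) {x \<in> space (density N (indicator ?EN)). \<forall>j\<in>J. Y j x \<in> B j}"
  proof (rule insert.IH)
    show "finite_measure (density M (indicator ?EM))" by (rule fin) (fact, measurable)
    show "finite_measure (density N (indicator ?EN))" by (rule fin) (fact, measurable)
    show "(\<integral>x. iexp (\<Sum>j\<in>J. t j * X j x) \<partial>density M (indicator ?EM)) =
      (\<integral>x. iexp (\<Sum>j\<in>J. t j * Y j x) \<partial>density N (indicator ?EN))" for t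
      by (rule trans[OF iexp_eq[of M X t, OF insert.prems(1) mX] trans[OF _ iexp_eq[of N Y t, OF insert.prems(2) mY, symmetric]]])
         (simp_all only: cos_eq)
  qed (use insert.prems in auto)
  then show ?case using insert.prems(3,4) by (simp add: dens)
qed

section \<open>Gaussian fields and white noise\<close>

lemma prob_space_std_normal: "prob_space std_normal_distribution"
  using real_dist_normal_dist by (simp add: real_distribution_def)

lemma centered_normal_eq_distr:
  assumes "\<sigma> \<ge> 0"
  shows "centered_normal \<sigma> = distr std_normal_distribution borel (\<lambda>x. \<sigma> * x)"
proof (cases "\<sigma> = 0")
  case True
  have "distr std_normal_distribution borel (\<lambda>x. 0 * x) = return borel (0::real)"
    using prob_space.distr_const[OF prob_space_std_normal, of 0 borel] by simp
  then show ?thesis using True by (simp add: centered_normal_def)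
next
  case False
  with assms have \<sigma>: "\<sigma> > 0" by simp
  interpret prob_space std_normal_distribution by (rule prob_space_std_normal)
  have "distributed std_normal_distribution lborel (\<lambda>x. x) std_normal_density"
    by (simp add: distributed_def distr_id2)
  then have "distributed std_normal_distribution lborel (\<lambda>x. (\<sigma> * x - 0) / \<sigma>) std_normal_density"
    using \<sigma> by simp
  then have "distributed std_normal_distribution lborel (\<lambda>x. \<sigma> * x) (normal_density 0 \<sigma>)"
    using normal_standard_normal_convert[OF \<sigma>, of "\<lambda>x. \<sigma> * x" 0] by simp
  then have "distr std_normal_distribution lborel (\<lambda>x. \<sigma> * x) = density lborel (normal_density 0 \<sigma>)"
    by (rule distributed_distr_eq_density)
  moreover have "distr std_normal_distribution lborel (\<lambda>x. \<sigma> * x) = distr std_normal_distribution borel (\<lambda>x. \<sigma> * x)"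
    by (rule distr_cong) auto
  ultimately show ?thesis using False by (simp add: centered_normal_def)
qed

lemma sets_centered_normal [measurable_cong]: "sets (centered_normal \<sigma>) = sets borel"
  by (simp add: centered_normal_def)

lemma char_centered_normal:
  assumes "\<sigma> \<ge> 0"
  shows "char (centered_normal \<sigma>) t = exp (- ((\<sigma> * t)\<^sup>2) / 2)"
proof -
  have "char (centered_normal \<sigma>) t = char std_normal_distribution (\<sigma> * t)"
    unfolding centered_normal_eq_distr[OF assms] char_def
    by (subst integral_distr) (auto simp: mult_ac)
  then show ?thesis by (simp add: char_std_normal_distribution)
qed

lemma second_moment_centered_normal:
  assumes "\<sigma> \<ge> 0"
  shows "integrable (centered_normal \<sigma>) (\<lambda>x. x\<^sup>2)" "(\<integral>x. x\<^sup>2 \<partial>centered_normal \<sigma>) = \<sigma>\<^sup>2"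
proof -
  show "integrable (centered_normal \<sigma>) (\<lambda>x. x\<^sup>2)"
    unfolding centered_normal_eq_distr[OF assms]
    by (subst integrable_distr_eq)
       (auto simp: power_mult_distrib intro!: Bochner_Integration.integrable_mult_right integrable_std_normal_distribution_moment)
  have "(\<integral>x. x\<^sup>2 \<partial>centered_normal \<sigma>) = \<sigma>\<^sup>2 * (\<integral>x. x\<^sup>2 \<partial>std_normal_distribution)"
    unfolding centered_normal_eq_distr[OF assms]
    by (subst integral_distr) (auto simp: power_mult_distrib)
  then show "(\<integral>x. x\<^sup>2 \<partial>centered_normal \<sigma>) = \<sigma>\<^sup>2"
    using std_normal_distribution_even_moments(1)[of 1] by simp
qed

text \<open>
  The linear combination is centered normal by assumption, so its transform at \<open>1\<close> only depends on
  its variance, which is bilinear in the coefficients. Expanding the variance needs that the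
  products \<open>\<phi> x * \<phi> y\<close> are integrable, which holds because each coordinate has a second moment.
\<close>

lemma gaussian_field_char:
  assumes M: "is_centered_gaussian_field I g M" and J: "finite J" "J \<subseteq> I"
  shows "(\<integral>\<phi>. iexp (\<Sum>x\<in>J. t x * \<phi> x) \<partial>M) = exp (- (\<Sum>x\<in>J. \<Sum>y\<in>J. t x * t y * g x y) / 2)"
proof -
  interpret prob_space M using M by (simp add: is_centered_gaussian_field_def)
  have sets[measurable_cong]: "sets M = sets (PiM I (\<lambda>_. borel))"
    and gauss: "\<And>J a. finite J \<Longrightarrow> J \<subseteq> I \<Longrightarrow> \<exists>\<sigma>\<ge>0. distr M borel (\<lambda>\<phi>. \<Sum>x\<in>J. a x * \<phi> x) = centered_normal \<sigma>"
    and cov: "\<And>x y. x \<in> I \<Longrightarrow> y \<in> I \<Longrightarrow> (\<integral>\<phi>. \<phi> x * \<phi> y \<partial>M) = g x y"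
    using M by (auto simp: is_centered_gaussian_field_def)
  have meas[measurable]: "(\<lambda>\<phi>. \<phi> x) \<in> borel_measurable M" if "x \<in> I" for x
    unfolding measurable_cong_sets[OF sets refl] using that by measurable
  have sq: "integrable M (\<lambda>\<phi>. (\<phi> x)\<^sup>2)" if x: "x \<in> I" for x
  proof -
    obtain \<sigma> where \<sigma>: "\<sigma> \<ge> 0" "distr M borel (\<lambda>\<phi>. \<phi> x) = centered_normal \<sigma>"
      using gauss[of "{x}" "\<lambda>_. 1"] x by auto
    have "integrable (distr M borel (\<lambda>\<phi>. \<phi> x)) (\<lambda>x. x\<^sup>2)"
      unfolding \<sigma>(2) by (rule second_moment_centered_normal[OF \<sigma>(1)])
    then show ?thesis using meas[OF x] by (subst (asm) integrable_distr_eq) auto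
  qed
  have int: "integrable M (\<lambda>\<phi>. \<phi> x * \<phi> y)" if "x \<in> I" "y \<in> I" for x y
  proof (rule Bochner_Integration.integrable_bound[OF Bochner_Integration.integrable_add[OF sq[OF that(1)] sq[OF that(2)]]])
    have "\<bar>a * b\<bar> \<le> a\<^sup>2 + b\<^sup>2" for a b :: real
      using sum_squares_bound[of a b] sum_squares_bound[of a "- b"] zero_le_power2[of a] zero_le_power2[of b]
      by (auto simp: abs_if)
    then show "AE \<phi> in M. norm (\<phi> x * \<phi> y) \<le> norm ((\<phi> x)\<^sup>2 + (\<phi> y)\<^sup>2)" by (auto simp del: abs_mult)
  qed (use that in measurable)
  obtain \<sigma> where \<sigma>: "\<sigma> \<ge> 0" "distr M borel (\<lambda>\<phi>. \<Sum>x\<in>J. t x * \<phi> x) = centered_normal \<sigma>"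
    using gauss[OF J] by auto
  have S[measurable]: "(\<lambda>\<phi>. \<Sum>x\<in>J. t x * \<phi> x) \<in> borel_measurable M"
    using J by (intro borel_measurable_sum borel_measurable_times meas) auto
  have "\<sigma>\<^sup>2 = (\<integral>\<phi>. (\<Sum>x\<in>J. t x * \<phi> x)\<^sup>2 \<partial>M)"
    using second_moment_centered_normal(2)[OF \<sigma>(1)] unfolding \<sigma>(2)[symmetric] by (subst (asm) integral_distr) auto
  also have "\<dots> = (\<integral>\<phi>. (\<Sum>x\<in>J. \<Sum>y\<in>J. t x * t y * (\<phi> x * \<phi> y)) \<partial>M)"
    by (simp add: power2_eq_square sum_product mult_ac)
  also have "\<dots> = (\<Sum>x\<in>J. \<Sum>y\<in>J. (\<integral>\<phi>. t x * t y * (\<phi> x * \<phi> y) \<partial>M))"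
  proof -
    have *: "integrable M (\<lambda>\<phi>. t x * t y * (\<phi> x * \<phi> y))" if "x \<in> J" "y \<in> J" for x y
      using that J by (intro Bochner_Integration.integrable_mult_right int) auto
    show ?thesis
      by (subst Bochner_Integration.integral_sum, intro Bochner_Integration.integrable_sum *, assumption+)
         (intro sum.cong refl Bochner_Integration.integral_sum *)
  qed
  also have "\<dots> = (\<Sum>x\<in>J. \<Sum>y\<in>J. t x * t y * g x y)"
    using J by (intro sum.cong refl) (auto simp: cov subset_eq)
  finally have \<sigma>2: "\<sigma>\<^sup>2 = (\<Sum>x\<in>J. \<Sum>y\<in>J. t x * t y * g x y)" .
  have "(\<integral>\<phi>. iexp (\<Sum>x\<in>J. t x * \<phi> x) \<partial>M) = char (distr M borel (\<lambda>\<phi>. \<Sum>x\<in>J. t x * \<phi> x)) 1"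
    unfolding char_def by (subst integral_distr) auto
  then show ?thesis using \<sigma>2 by (simp add: \<sigma> char_centered_normal)
qed

lemma gaussian_field_unique:
  assumes M: "is_centered_gaussian_field I g M" and N: "is_centered_gaussian_field I g N"
  shows "M = N"
proof (rule measure_eqI_PiM_infinite)
  show sM: "sets M = sets (PiM I (\<lambda>_. borel))" and sN: "sets N = sets (PiM I (\<lambda>_. borel))"
    using M N by (auto simp: is_centered_gaussian_field_def)
  interpret M: prob_space M using M by (simp add: is_centered_gaussian_field_def)
  interpret N: prob_space N using N by (simp add: is_centered_gaussian_field_def)
  show "finite_measure M" by unfold_locales
  fix A :: "'a \<Rightarrow> real set" and J assume J: "finite J" "J \<subseteq> I" and A: "\<And>i. i \<in> J \<Longrightarrow> A i \<in> sets borel"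
  have "measure M {\<phi> \<in> space M. \<forall>x\<in>J. \<phi> x \<in> A x} = measure N {\<phi> \<in> space N. \<forall>x\<in>J. \<phi> x \<in> A x}"
  proof (rule cramer_wold[OF J(1)])
    show "finite_measure M" "finite_measure N" by unfold_locales
    show "(\<lambda>\<phi>. \<phi> x) \<in> borel_measurable M" "(\<lambda>\<phi>. \<phi> x) \<in> borel_measurable N" if "x \<in> J" for x
      unfolding measurable_cong_sets[OF sM refl] measurable_cong_sets[OF sN refl] by (rule measurable_component_singleton, use that J(2) in auto)+
    show "(\<integral>\<phi>. iexp (\<Sum>x\<in>J. t x * \<phi> x) \<partial>M) = (\<integral>\<phi>. iexp (\<Sum>x\<in>J. t x * \<phi> x) \<partial>N)" for t
      unfolding gaussian_field_char[OF M J] gaussian_field_char[OF N J] ..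
  qed (rule A)
  moreover have "{\<phi> \<in> space K. \<forall>x\<in>J. \<phi> x \<in> A x} = prod_emb I (\<lambda>_. borel) J (Pi\<^sub>E J A)"
    if "sets K = sets (PiM I (\<lambda>_. borel))" for K :: "('a \<Rightarrow> real) measure"
    using sets_eq_imp_space_eq[OF that] J(2) by (auto simp: prod_emb_def space_PiM)
  ultimately show "emeasure M (prod_emb I (\<lambda>_. borel) J (Pi\<^sub>E J A)) = emeasure N (prod_emb I (\<lambda>_. borel) J (Pi\<^sub>E J A))"
    using sM sN by (simp add: M.emeasure_eq_measure N.emeasure_eq_measure)
qed

abbreviation white_noise :: "('i \<Rightarrow> real) measure" where
  "white_noise \<equiv> PiM UNIV (\<lambda>_. std_normal_distribution)"

lemma prob_space_white_noise: "prob_space (white_noise :: ('i \<Rightarrow> real) measure)"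
  by (intro prob_space_PiM prob_space_std_normal)

lemma indep_vars_PiM_coords:
  assumes M: "prob_space M"
  shows "prob_space.indep_vars (PiM UNIV (\<lambda>_. M)) (\<lambda>_. M) (\<lambda>i z. z i) (UNIV :: 'i set)"
proof -
  interpret prob_space "PiM (UNIV :: 'i set) (\<lambda>_. M)" by (intro prob_space_PiM M)
  have "distr (PiM UNIV (\<lambda>_. M)) M (\<lambda>z. z i) = M" for i :: 'i
    by (rule distr_PiM_component) (auto intro: M)
  moreover have "(\<lambda>z. \<lambda>i\<in>UNIV. z i) = (\<lambda>z :: 'i \<Rightarrow> 'a. z)" by (simp add: restrict_def)
  ultimately show ?thesis
    by (subst indep_vars_iff_distr_eq_PiM) (auto simp: distr_id2)
qed

lemma white_noise_linear_combination:
  fixes \<beta> :: "'i \<Rightarrow> real"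
  assumes F: "finite F"
  shows "distr white_noise borel (\<lambda>z. \<Sum>w\<in>F. \<beta> w * z w) = centered_normal (sqrt (\<Sum>w\<in>F. (\<beta> w)\<^sup>2))"
proof (rule Levy_uniqueness)
  interpret prob_space "white_noise :: ('i \<Rightarrow> real) measure" by (rule prob_space_white_noise)
  have [measurable]: "(\<lambda>z :: 'i \<Rightarrow> real. z w) \<in> borel_measurable white_noise" for w
    using measurable_component_singleton[of w UNIV "\<lambda>_. std_normal_distribution"] by simp
  show "real_distribution (distr white_noise borel (\<lambda>z. \<Sum>w\<in>F. \<beta> w * z w))"
    by simp
  interpret S: prob_space std_normal_distribution by (rule prob_space_std_normal)
  show "real_distribution (centered_normal (sqrt (\<Sum>w\<in>F. (\<beta> w)\<^sup>2)))"
    by (subst centered_normal_eq_distr) (auto intro!: sum_nonneg)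
  have ind: "indep_vars (\<lambda>_. borel) (\<lambda>w z. \<beta> w * z w) F"
    by (rule indep_vars_compose2[OF indep_vars_subset[OF indep_vars_PiM_coords[OF prob_space_std_normal]]]) auto
  have marg: "distr white_noise std_normal_distribution (\<lambda>z. z w) = std_normal_distribution" for w :: 'i
    by (rule distr_PiM_component) (auto intro: prob_space_std_normal)
  have single: "char (distr white_noise borel (\<lambda>z. \<beta> w * z w)) t = exp (- ((\<beta> w * t)\<^sup>2 / 2))" for w t
  proof -
    have "char (distr white_noise borel (\<lambda>z. \<beta> w * z w)) t =
      (\<integral>z. iexp (t * (\<beta> w * z w)) \<partial>white_noise)"
      unfolding char_def by (subst integral_distr) auto
    also have "\<dots> = (\<integral>x. iexp (t * (\<beta> w * x)) \<partial>distr white_noise std_normal_distribution (\<lambda>z. z w))"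
      by (subst integral_distr) auto
    also have "\<dots> = char std_normal_distribution (\<beta> w * t)"
      unfolding marg char_def by (simp add: mult_ac)
    finally show ?thesis by (simp add: char_std_normal_distribution)
  qed
  show "char (distr white_noise borel (\<lambda>z. \<Sum>w\<in>F. \<beta> w * z w)) = char (centered_normal (sqrt (\<Sum>w\<in>F. (\<beta> w)\<^sup>2)))"
  proof
    fix t
    have "char (distr white_noise borel (\<lambda>z. \<Sum>w\<in>F. \<beta> w * z w)) t = (\<Prod>w\<in>F. complex_of_real (exp (- ((\<beta> w * t)\<^sup>2 / 2))))"
      unfolding char_distr_sum[OF ind] single ..
    also have "\<dots> = complex_of_real (exp (\<Sum>w\<in>F. - ((\<beta> w * t)\<^sup>2 / 2)))"
      by (simp only: of_real_prod exp_sum[OF F])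
    also have "(\<Sum>w\<in>F. - ((\<beta> w * t)\<^sup>2 / 2)) = - ((sqrt (\<Sum>w\<in>F. (\<beta> w)\<^sup>2) * t)\<^sup>2) / 2"
      by (simp add: sum_nonneg power_mult_distrib sum_distrib_right sum_negf sum_divide_distrib)
    finally show "char (distr white_noise borel (\<lambda>z. \<Sum>w\<in>F. \<beta> w * z w)) t = char (centered_normal (sqrt (\<Sum>w\<in>F. (\<beta> w)\<^sup>2))) t"
      by (simp add: char_centered_normal sum_nonneg)
  qed
qed

text \<open>
  Polarization reduces the covariance of two linear combinations to variances, which
  \<open>white_noise_linear_combination\<close> provides.
\<close>

lemma white_noise_covariance:
  fixes \<beta> \<gamma> :: "'i \<Rightarrow> real"
  assumes F: "finite F"
  shows "(\<integral>z. (\<Sum>w\<in>F. \<beta> w * z w) * (\<Sum>w\<in>F. \<gamma> w * z w) \<partial>white_noise) = (\<Sum>w\<in>F. \<beta> w * \<gamma> w)"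
proof -
  let ?S = "\<lambda>\<beta> z. \<Sum>w\<in>F. \<beta> w * (z w :: real)"
  have [measurable]: "(\<lambda>z :: 'i \<Rightarrow> real. z w) \<in> borel_measurable white_noise" for w
    using measurable_component_singleton[of w UNIV "\<lambda>_. std_normal_distribution"] by simp
  have sq: "integrable white_noise (\<lambda>z. (?S \<beta> z)\<^sup>2)" "(\<integral>z. (?S \<beta> z)\<^sup>2 \<partial>white_noise) = (\<Sum>w\<in>F. (\<beta> w)\<^sup>2)" for \<beta>
  proof -
    have s: "0 \<le> sqrt (\<Sum>w\<in>F. (\<beta> w)\<^sup>2)" by (simp add: sum_nonneg)
    have "integrable (distr white_noise borel (?S \<beta>)) (\<lambda>x. x\<^sup>2)"
      unfolding white_noise_linear_combination[OF F] by (rule second_moment_centered_normal[OF s])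
    then show "integrable white_noise (\<lambda>z. (?S \<beta> z)\<^sup>2)"
      by (subst (asm) integrable_distr_eq) auto
    have "(\<integral>z. (?S \<beta> z)\<^sup>2 \<partial>white_noise) = (\<integral>x. x\<^sup>2 \<partial>distr white_noise borel (?S \<beta>))"
      by (subst integral_distr) auto
    then show "(\<integral>z. (?S \<beta> z)\<^sup>2 \<partial>white_noise) = (\<Sum>w\<in>F. (\<beta> w)\<^sup>2)"
      unfolding white_noise_linear_combination[OF F] second_moment_centered_normal(2)[OF s] by (simp add: sum_nonneg)
  qed
  have add: "?S \<beta> z + ?S \<gamma> z = ?S (\<lambda>w. \<beta> w + \<gamma> w) z" "?S \<beta> z - ?S \<gamma> z = ?S (\<lambda>w. \<beta> w - \<gamma> w) z" for z
    by (simp_all add: distrib_right left_diff_distrib sum.distrib sum_subtractf)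
  have "(\<integral>z. ?S \<beta> z * ?S \<gamma> z \<partial>white_noise) =
    (\<integral>z. ((?S (\<lambda>w. \<beta> w + \<gamma> w) z)\<^sup>2 - (?S (\<lambda>w. \<beta> w - \<gamma> w) z)\<^sup>2) / 4 \<partial>white_noise)"
    unfolding add[symmetric] by (simp add: power2_eq_square algebra_simps)
  also have "\<dots> = ((\<Sum>w\<in>F. (\<beta> w + \<gamma> w)\<^sup>2) - (\<Sum>w\<in>F. (\<beta> w - \<gamma> w)\<^sup>2)) / 4"
    by (simp only: integral_divide_zero Bochner_Integration.integral_diff[OF sq(1) sq(1)] sq(2))
  also have "\<dots> = (\<Sum>w\<in>F. \<beta> w * \<gamma> w)"
    by (simp add: sum_subtractf[symmetric] power2_eq_square algebra_simps sum_distrib_left)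
  finally show ?thesis .
qed

section \<open>Expected visits of the random walk\<close>

abbreviation walk_dist :: "weighted_tree \<Rightarrow> label \<Rightarrow> nat \<Rightarrow> (nat \<Rightarrow> label) measure" where
  "walk_dist T x n \<equiv> Ionescu_Tulcea.C (walk_kernel T x) (\<lambda>_. count_space UNIV) 0 n (\<lambda>_. undefined)"

definition step_op :: "weighted_tree \<Rightarrow> (label \<Rightarrow> ennreal) \<Rightarrow> label \<Rightarrow> ennreal" where
  "step_op T f x = (\<integral>\<^sup>+y. f y \<partial>walk_step T x)"

lemma sets_walk_law: "sets (walk_law T x) = sets (PiM UNIV (\<lambda>_. count_space UNIV))"
proof -
  interpret W: Ionescu_Tulcea "walk_kernel T x" "\<lambda>_. count_space UNIV"
    by (rule Ionescu_Tulcea_walk_kernel)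
  show ?thesis by (simp add: walk_law_def)
qed

lemma measurable_walk_law_coord [measurable]:
  "(\<lambda>X. X k) \<in> measurable (walk_law T x) (count_space UNIV)"
  unfolding measurable_cong_sets[OF sets_walk_law refl] by (rule measurable_component_singleton) simp

text \<open>
  The Ionescu-Tulcea measure is only accessible through its finite-dimensional marginals.
\<close>

lemma nn_integral_walk_law_coord:
  "(\<integral>\<^sup>+X. f (X k) \<partial>walk_law T x) = (\<integral>\<^sup>+X. f (X k) \<partial>walk_dist T x (Suc k))"
proof -
  interpret W: Ionescu_Tulcea "walk_kernel T x" "\<lambda>_. count_space UNIV"
    by (rule Ionescu_Tulcea_walk_kernel)
  have s: "sets (walk_dist T x (Suc k)) = sets (PiM {0..<Suc k} (\<lambda>_. count_space UNIV))"
    using W.sets_C[of "\<lambda>_. undefined" 0 "Suc k"] by simp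
  have m: "(\<lambda>X. X k) \<in> measurable (PiM {0..<Suc k} (\<lambda>_. count_space UNIV)) (count_space UNIV)"
    by (rule measurable_component_singleton) simp
  have m': "(\<lambda>X. X k) \<in> measurable (walk_dist T x (Suc k)) (count_space UNIV)"
    unfolding measurable_cong_sets[OF s refl] by (rule m)
  have "distr (walk_law T x) (count_space UNIV) (\<lambda>X. X k) =
    distr (walk_dist T x (Suc k)) (count_space UNIV) (\<lambda>X. X k)"
  proof (rule measure_eqI)
    fix A :: "label set"
    let ?J = "{0..<Suc k}"
    let ?X = "(\<lambda>X. X k) -` A \<inter> space (PiM ?J (\<lambda>_. count_space (UNIV :: label set)))"
    have X: "?X \<in> sets (PiM ?J (\<lambda>_. count_space UNIV))"
      by (rule measurable_sets[OF m]) simp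
    have "emeasure (distr (walk_law T x) (count_space UNIV) (\<lambda>X. X k)) A =
      emeasure (walk_law T x) (W.PF.emb UNIV ?J ?X)"
      using sets_eq_imp_space_eq[OF sets_walk_law, of T x]
      by (subst emeasure_distr)
         (auto intro!: arg_cong[where f="emeasure _"] simp: prod_emb_def space_PiM)
    also have "\<dots> = emeasure (W.CI ?J) ?X"
      unfolding walk_law_def by (rule W.lim[OF _ X]) simp
    also have "\<dots> = emeasure (walk_dist T x (Suc k)) (W.PF.emb ?J ?J ?X)"
      by (rule W.emeasure_CI[OF _ X]) simp
    also have "W.PF.emb ?J ?J ?X = ?X"
      by (rule prod_emb_id) (use sets.sets_into_space[OF X] in \<open>simp add: space_PiM\<close>)
    also have "emeasure (walk_dist T x (Suc k)) ?X =
      emeasure (distr (walk_dist T x (Suc k)) (count_space UNIV) (\<lambda>X. X k)) A"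
      using sets_eq_imp_space_eq[OF s] by (subst emeasure_distr[OF m']) simp_all
    finally show "emeasure (distr (walk_law T x) (count_space UNIV) (\<lambda>X. X k)) A =
      emeasure (distr (walk_dist T x (Suc k)) (count_space UNIV) (\<lambda>X. X k)) A" .
  qed simp
  then have "(\<integral>\<^sup>+X. f X \<partial>distr (walk_law T x) (count_space UNIV) (\<lambda>X. X k)) =
    (\<integral>\<^sup>+X. f X \<partial>distr (walk_dist T x (Suc k)) (count_space UNIV) (\<lambda>X. X k))" by simp
  then show ?thesis by (simp add: nn_integral_distr m' del: Ionescu_Tulcea.C.simps W.C.simps)
qed

text \<open>
  The expectation of \<open>f\<close> at time \<open>Suc k\<close> is that of \<open>step_op T f\<close> at time \<open>k\<close>; hence the induction
  runs over \<open>k\<close> for all \<open>f\<close> at once.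
\<close>

lemma nn_integral_walk_law:
  "(\<integral>\<^sup>+X. f (X k) \<partial>walk_law T x) = (step_op T ^^ k) f x"
proof (induction k arbitrary: f)
  case 0
  interpret W: Ionescu_Tulcea "walk_kernel T x" "\<lambda>_. count_space UNIV"
    by (rule Ionescu_Tulcea_walk_kernel)
  have u: "(\<lambda>_. undefined) \<in> space (PiM {0..<0} (\<lambda>_. count_space (UNIV::label set)))"
    unfolding space_PiM by auto
  have m: "(\<lambda>X. f (X 0)) \<in> borel_measurable (PiM {0..<Suc 0} (\<lambda>_. count_space UNIV))"
    by (rule measurable_compose[OF measurable_component_singleton]) auto
  have "(\<integral>\<^sup>+X. f (X 0) \<partial>walk_law T x) =
    (\<integral>\<^sup>+X. f (X 0) \<partial>(return (PiM {0..<0} (\<lambda>_. count_space UNIV)) (\<lambda>_. undefined) \<bind> W.eP 0))"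
    unfolding nn_integral_walk_law_coord by simp
  also have "\<dots> = (\<integral>\<^sup>+X. f (X 0) \<partial>W.eP 0 (\<lambda>_. undefined))"
    using bind_return[OF W.measurable_eP u] by simp
  also have "\<dots> = f x"
    by (subst W.nn_integral_eP[OF u m]) (simp add: nn_integral_return)
  finally show ?case by simp
next
  case (Suc k)
  interpret W: Ionescu_Tulcea "walk_kernel T x" "\<lambda>_. count_space UNIV"
    by (rule Ionescu_Tulcea_walk_kernel)
  have m: "(\<lambda>X. f (X (Suc k))) \<in> borel_measurable (PiM {0..<Suc (Suc k)} (\<lambda>_. count_space UNIV))"
    by (rule measurable_compose[OF measurable_component_singleton]) auto
  have u: "(\<lambda>_. undefined) \<in> space (PiM {0..<0} (\<lambda>_. count_space (UNIV::label set)))"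
    unfolding space_PiM by auto
  have sp: "space (walk_dist T x (Suc k)) = space (PiM {0..<Suc k} (\<lambda>_. count_space UNIV))"
    using W.space_C[OF u, of "Suc k"] by simp
  have st: "sets (walk_dist T x (Suc k)) = sets (PiM {0..<Suc k} (\<lambda>_. count_space UNIV))"
    using W.sets_C[OF u, of "Suc k"] by simp
  have "(\<integral>\<^sup>+X. f (X (Suc k)) \<partial>walk_law T x) =
    (\<integral>\<^sup>+X. f (X (Suc k)) \<partial>(walk_dist T x (Suc k) \<bind> W.eP (Suc k)))"
    unfolding nn_integral_walk_law_coord by (subst W.C.simps(2)) simp
  also have "\<dots> = (\<integral>\<^sup>+X. (\<integral>\<^sup>+Y. f (Y (Suc k)) \<partial>W.eP (Suc k) X) \<partial>walk_dist T x (Suc k))"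
    by (rule nn_integral_bind[OF m])
       (use W.measurable_eP[of "Suc k"] in \<open>simp only: measurable_cong_sets[OF st refl]\<close>)
  also have "\<dots> = (\<integral>\<^sup>+X. step_op T f (X k) \<partial>walk_dist T x (Suc k))"
    by (rule nn_integral_cong)
       (simp add: sp W.nn_integral_eP[OF _ m] step_op_def del: W.C.simps)
  also have "\<dots> = (step_op T ^^ k) (step_op T f) x"
    by (simp only: nn_integral_walk_law_coord[symmetric] Suc.IH)
  finally show ?case by (simp only: funpow_Suc_right comp_apply)
qed

definition visits :: "weighted_tree \<Rightarrow> label \<Rightarrow> label \<Rightarrow> ennreal" where
  "visits T y x = (\<Sum>k. (step_op T ^^ k) (indicator {y}) x)"

lemma green_eq: "green T x y = enn2real (visits T y x) / total_conductance T y"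
proof -
  have "(\<integral>\<^sup>+X. (\<Sum>k. indicator {y} (X k)) \<partial>walk_law T x) =
    (\<Sum>k. \<integral>\<^sup>+X. indicator {y} (X k) \<partial>walk_law T x)"
    by (rule nn_integral_suminf) measurable
  then show ?thesis
    by (simp add: green_def visits_def nn_integral_walk_law)
qed

lemma step_op_add: "step_op T (\<lambda>y. f y + g y) x = step_op T f x + step_op T g x"
  by (simp add: step_op_def nn_integral_add)

lemma step_op_sum: "finite F \<Longrightarrow> step_op T (\<lambda>y. \<Sum>v\<in>F. c v * f v y) x = (\<Sum>v\<in>F. c v * step_op T (f v) x)"
  by (simp add: step_op_def nn_integral_sum nn_integral_cmult)

lemma step_op_funpow_sum:
  "finite F \<Longrightarrow> (step_op T ^^ k) (\<lambda>y. \<Sum>v\<in>F. c v * f v y) x = (\<Sum>v\<in>F. c v * (step_op T ^^ k) (f v) x)"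
proof (induction k arbitrary: x)
  case (Suc k)
  then have "(step_op T ^^ k) (\<lambda>y. \<Sum>v\<in>F. c v * f v y) = (\<lambda>x. \<Sum>v\<in>F. c v * (step_op T ^^ k) (f v) x)"
    by auto
  then show ?case using Suc.prems by (simp add: step_op_sum)
qed simp

definition nbrs :: "weighted_tree \<Rightarrow> label \<Rightarrow> label set" where
  "nbrs T x = {y. (x, y) \<in> edges T}"

locale walkable_tree =
  fixes T :: weighted_tree
  assumes tree: "is_weighted_tree T"
    and nbrs_nonempty: "x \<in> verts T \<Longrightarrow> nbrs T x \<noteq> {}"
begin

lemma nbrs_finite: "x \<in> verts T \<Longrightarrow> finite (nbrs T x)"
proof (rule finite_subset)
  assume x: "x \<in> verts T"
  show "nbrs T x \<subseteq> insert (butlast x) ((\<lambda>i. x @ [i]) ` {i. x @ [i] \<in> verts T})"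
  proof
    fix y assume "y \<in> nbrs T x"
    then have "y \<in> verts T" "y = butlast x \<or> y \<noteq> [] \<and> x = butlast y"
      by (auto simp: nbrs_def edges_def)
    then show "y \<in> insert (butlast x) ((\<lambda>i. x @ [i]) ` {i. x @ [i] \<in> verts T})"
      by (auto intro: image_eqI[where x="last y"])
  qed
  show "finite (insert (butlast x) ((\<lambda>i. x @ [i]) ` {i. x @ [i] \<in> verts T}))"
    using tree x by (auto simp: is_weighted_tree_def)
qed

lemma nbrs_verts: "y \<in> nbrs T x \<Longrightarrow> y \<in> verts T"
  by (auto simp: nbrs_def edges_def)

lemma nbrs_sym: "y \<in> nbrs T x \<longleftrightarrow> x \<in> nbrs T y"
  by (auto simp: nbrs_def edges_def)

lemma cond_pos: "y \<in> nbrs T x \<Longrightarrow> conductance T x y > 0"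
  using tree by (auto simp: is_weighted_tree_def nbrs_def)

lemma total_pos: "x \<in> verts T \<Longrightarrow> total_conductance T x > 0"
  unfolding total_conductance_def nbrs_def[symmetric]
  by (intro sum_pos nbrs_finite nbrs_nonempty cond_pos) auto

lemma pmf_walk_step:
  assumes x: "x \<in> verts T"
  shows "pmf (walk_step T x) y = (if y \<in> nbrs T x then conductance T x y / total_conductance T x else 0)"
proof -
  let ?f = "\<lambda>y. if (x, y) \<in> edges T then conductance T x y / total_conductance T x else 0"
  have nn: "0 \<le> ?f y" for y
    using cond_pos[of y x] total_pos[OF x] by (auto simp: nbrs_def)
  have "(\<integral>\<^sup>+y. ennreal (?f y) \<partial>count_space UNIV) = (\<Sum>y\<in>nbrs T x. ennreal (?f y))"
    by (rule nn_integral_count_space'[OF nbrs_finite[OF x]]) (auto simp: nbrs_def)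
  also have "\<dots> = ennreal (\<Sum>y\<in>nbrs T x. ?f y)"
    using nn by (simp add: sum_ennreal)
  also have "(\<Sum>y\<in>nbrs T x. ?f y) = (\<Sum>y\<in>nbrs T x. conductance T x y / total_conductance T x)"
    by (rule sum.cong) (auto simp: nbrs_def)
  also have "\<dots> = 1"
    unfolding sum_divide_distrib[symmetric]
    using total_pos[OF x] by (simp add: total_conductance_def nbrs_def)
  finally have "(\<integral>\<^sup>+y. ennreal (?f y) \<partial>count_space UNIV) = 1" by simp
  then show ?thesis
    unfolding walk_step_def by (subst pmf_embed_pmf) (use nn in \<open>auto simp: nbrs_def\<close>)
qed

lemma step_op_eq:
  assumes x: "x \<in> verts T"
  shows "step_op T f x = (\<Sum>y\<in>nbrs T x. ennreal (conductance T x y / total_conductance T x) * f y)"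
proof -
  have "step_op T f x = (\<integral>\<^sup>+y. ennreal (pmf (walk_step T x) y) * f y \<partial>count_space UNIV)"
    by (simp add: step_op_def nn_integral_measure_pmf)
  also have "\<dots> = (\<Sum>y\<in>nbrs T x. ennreal (pmf (walk_step T x) y) * f y)"
    by (rule nn_integral_count_space'[OF nbrs_finite[OF x]]) (auto simp: pmf_walk_step[OF x])
  also have "\<dots> = (\<Sum>y\<in>nbrs T x. ennreal (conductance T x y / total_conductance T x) * f y)"
    by (rule sum.cong) (auto simp: pmf_walk_step[OF x])
  finally show ?thesis .
qed

lemma step_op_mono_verts:
  assumes "\<And>y. y \<in> verts T \<Longrightarrow> f y \<le> g y" "x \<in> verts T"
  shows "step_op T f x \<le> step_op T g x"
  unfolding step_op_eq[OF assms(2)] using assms(1) nbrs_verts by (auto intro!: sum_mono mult_left_mono)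

lemma step_op_funpow_mono_verts:
  assumes "\<And>y. y \<in> verts T \<Longrightarrow> f y \<le> g y" "x \<in> verts T"
  shows "(step_op T ^^ k) f x \<le> (step_op T ^^ k) g x"
  using assms(2) by (induction k arbitrary: x) (auto intro!: step_op_mono_verts assms(1))

text \<open>
  The expected number of visits is the least nonnegative solution of \<open>h = indicator {y} + step_op T h\<close>:
  each partial sum of the series arises from the previous one by the operation on the right-hand
  side, and that operation preserves being below a supersolution.
\<close>

lemma visits_upper:
  assumes h: "\<And>x. x \<in> verts T \<Longrightarrow> indicator {y} x + step_op T h x \<le> h x" and x: "x \<in> verts T"
  shows "visits T y x \<le> h x"
proof -
  have "(\<Sum>k<n. (step_op T ^^ k) (indicator {y}) x) \<le> h x" if "x \<in> verts T" for n x
    using that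
  proof (induction n arbitrary: x)
    case (Suc n)
    have "(\<Sum>k<Suc n. (step_op T ^^ k) (indicator {y}) x) =
      indicator {y} x + (\<Sum>k<n. step_op T ((step_op T ^^ k) (indicator {y})) x)"
      by (subst sum.lessThan_Suc_shift) simp
    also have "\<dots> = indicator {y} x + step_op T (\<lambda>x. \<Sum>k<n. (step_op T ^^ k) (indicator {y}) x) x"
      using step_op_sum[of "{..<n}" T "\<lambda>_. 1"] by simp
    also have "\<dots> \<le> indicator {y} x + step_op T h x"
      by (intro add_left_mono step_op_mono_verts Suc)
    also have "\<dots> \<le> h x" by (rule h[OF Suc.prems])
    finally show ?case .
  qed simp
  then show ?thesis
    unfolding visits_def suminf_eq_SUP using x by (auto intro!: SUP_least)
qed

text \<open>
  The walk at \<open>v\<close> moves to \<open>y\<close> with a fixed positive probability, so a visit to \<open>v\<close> is followed by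
  a visit to \<open>y\<close> with at least that probability.
\<close>

lemma visits_finite_nbr:
  assumes fin: "visits T y x < \<infinity>" and x: "x \<in> verts T" and v: "v \<in> nbrs T y"
  shows "visits T v x < \<infinity>"
proof -
  let ?r = "conductance T v y / total_conductance T v"
  have y: "y \<in> nbrs T v" and vv: "v \<in> verts T" using v nbrs_sym nbrs_verts by auto
  have r: "?r > 0" using cond_pos[OF y] total_pos[OF vv] by simp
  \<comment> \<open>In expectation, \<open>1 / ?r\<close> visits to \<open>v\<close> correspond to one step from \<open>v\<close> to \<open>y\<close>.\<close>
  have le: "indicator {v} u \<le> ennreal (1 / ?r) * step_op T (indicator {y}) u" if u: "u \<in> verts T" for u
  proof (cases "u = v")
    case True
    have "1 = ennreal (1 / ?r * ?r)" using less_imp_neq[OF r] by simp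
    also have "\<dots> = ennreal (1 / ?r) * ennreal ?r" by (rule ennreal_mult) (use cond_pos[OF y] total_pos[OF vv] in auto)
    also have "ennreal ?r = ennreal ?r * indicator {y} y" by simp
    also have "\<dots> \<le> step_op T (indicator {y}) v"
      unfolding step_op_eq[OF vv] using y by (intro member_le_sum nbrs_finite vv) auto
    finally show ?thesis using True by (simp add: mult_left_mono)
  qed auto
  have "(step_op T ^^ k) (indicator {v}) x \<le> ennreal (1 / ?r) * (step_op T ^^ Suc k) (indicator {y}) x" for k
  proof -
    have "(step_op T ^^ k) (indicator {v}) x \<le>
      (step_op T ^^ k) (\<lambda>u. ennreal (1 / ?r) * step_op T (indicator {y}) u) x"
      by (rule step_op_funpow_mono_verts[OF le x])
    also have "\<dots> = ennreal (1 / ?r) * (step_op T ^^ k) (step_op T (indicator {y})) x"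
      using step_op_funpow_sum[of "{()}" k T "\<lambda>_. ennreal (1 / ?r)" "\<lambda>_. step_op T (indicator {y})" x] by simp
    finally show ?thesis by (simp only: funpow_Suc_right comp_apply)
  qed
  then have "visits T v x \<le> (\<Sum>k. ennreal (1 / ?r) * (step_op T ^^ Suc k) (indicator {y}) x)"
    unfolding visits_def by (intro suminf_le) auto
  also have "\<dots> = ennreal (1 / ?r) * (\<Sum>k. (step_op T ^^ Suc k) (indicator {y}) x)"
    by (rule ennreal_suminf_cmult)
  also have "(\<Sum>k. (step_op T ^^ Suc k) (indicator {y}) x) \<le> visits T y x"
    unfolding visits_def using suminf_offset[of "\<lambda>k. (step_op T ^^ k) (indicator {y}) x" 1] by simp
  then have "ennreal (1 / ?r) * (\<Sum>k. (step_op T ^^ Suc k) (indicator {y}) x) \<le> ennreal (1 / ?r) * visits T y x"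
    by (rule mult_left_mono) simp
  also have "\<dots> < \<infinity>" using fin by (simp add: ennreal_mult_less_top)
  finally show ?thesis by simp
qed

lemma visits_finite_all:
  assumes fin: "visits T y x < \<infinity>" and x: "x \<in> verts T" and y: "y \<in> verts T" and v: "v \<in> verts T"
  shows "visits T v x < \<infinity>"
proof -
  have root: "visits T [] x < \<infinity>" using fin y
  proof (induction y rule: rev_induct)
    case (snoc i y)
    have "butlast (y @ [i]) \<in> verts T" using tree snoc.prems by (auto simp: is_weighted_tree_def simp del: butlast_snoc)
    then have "y \<in> verts T" by simp
    moreover from this have "y \<in> nbrs T (y @ [i])" using snoc.prems by (auto simp: nbrs_def edges_def)
    ultimately show ?case using visits_finite_nbr[OF snoc.prems(1) x] snoc.IH by blast
  qed simp
  show ?thesis using v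
  proof (induction v rule: rev_induct)
    case (snoc i y)
    have "butlast (y @ [i]) \<in> verts T" using tree snoc.prems by (auto simp: is_weighted_tree_def simp del: butlast_snoc)
    then have y: "y \<in> verts T" by simp
    then have "y @ [i] \<in> nbrs T y" using snoc.prems by (auto simp: nbrs_def edges_def)
    then show ?case using visits_finite_nbr[OF snoc.IH[OF y] x] by blast
  qed (rule root)
qed

text \<open>
  Iterating the hypothesis \<open>n\<close> times bounds \<open>u\<close> by the expected number of visits before time \<open>n\<close> plus
  the expectation of \<open>u\<close> at time \<open>n\<close>. The latter tends to \<open>0\<close> because \<open>u\<close> has finite support and,
  by connectedness, all vertices have a finite expected number of visits as soon as \<open>y\<close> does.
\<close>

lemma visits_lower:
  fixes u :: "label \<Rightarrow> ennreal"
  assumes u: "\<And>x. x \<in> verts T \<Longrightarrow> u x \<le> indicator {y} x + step_op T u x"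
    and F: "finite F" "F \<subseteq> verts T" "\<And>v. v \<in> verts T - F \<Longrightarrow> u v = 0" and fin: "\<And>v. u v < \<infinity>"
    and y: "y \<in> verts T" and x: "x \<in> verts T"
  shows "u x \<le> visits T y x"
proof (cases "visits T y x < \<infinity>")
  case True
  let ?S = "\<lambda>n x. \<Sum>k<n. (step_op T ^^ k) (indicator {y}) x"
  have S: "u x \<le> ?S n x + (step_op T ^^ n) u x" if "x \<in> verts T" for n x
    using that
  proof (induction n arbitrary: x)
    case (Suc n)
    have "u x \<le> indicator {y} x + step_op T u x" by (rule u[OF Suc.prems])
    also have "\<dots> \<le> indicator {y} x + step_op T (\<lambda>x. ?S n x + (step_op T ^^ n) u x) x"
      by (intro add_left_mono step_op_mono_verts Suc)
    also have "\<dots> = indicator {y} x + (\<Sum>k<n. (step_op T ^^ Suc k) (indicator {y}) x) + (step_op T ^^ Suc n) u x"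
      using step_op_sum[of "{..<n}" T "\<lambda>_. 1"] by (simp add: step_op_add add.assoc)
    also have "indicator {y} x + (\<Sum>k<n. (step_op T ^^ Suc k) (indicator {y}) x) = ?S (Suc n) x"
      by (subst sum.lessThan_Suc_shift) simp
    finally show ?case .
  qed simp
  have "(step_op T ^^ n) u x \<le> (step_op T ^^ n) (\<lambda>x. \<Sum>v\<in>F. u v * indicator {v} x) x" for n
  proof (rule step_op_funpow_mono_verts[OF _ x])
    fix z assume "z \<in> verts T"
    show "u z \<le> (\<Sum>v\<in>F. u v * indicator {v} z)"
    proof (cases "z \<in> F")
      case True
      then have "u z * indicator {z} z \<le> (\<Sum>v\<in>F. u v * indicator {v} z)"
        by (intro member_le_sum F) auto
      then show ?thesis by simp
    qed (use \<open>z \<in> verts T\<close> F(3) in auto)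
  qed
  then have P: "(step_op T ^^ n) u x \<le> (\<Sum>v\<in>F. u v * (step_op T ^^ n) (indicator {v}) x)" for n
    by (simp only: step_op_funpow_sum[OF F(1)])
  have bound: "u x \<le> visits T y x + (\<Sum>v\<in>F. u v * (step_op T ^^ n) (indicator {v}) x)" for n
  proof -
    have "?S n x \<le> visits T y x" unfolding visits_def by (intro sum_le_suminf) auto
    then show ?thesis using S[OF x, of n] P[of n] by (meson add_mono order_trans)
  qed
  have lim: "(\<lambda>n. (step_op T ^^ n) (indicator {v}) x) \<longlonglongrightarrow> 0" if "v \<in> F" for v
  proof -
    let ?a = "\<lambda>n. (step_op T ^^ n) (indicator {v}) x"
    have "v \<in> verts T" using that F(2) by auto
    then have s: "(\<Sum>n. ?a n) < top" using visits_finite_all[OF True x y] by (simp add: visits_def)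
    have "?a n < top" for n
      using s sum_le_suminf[of ?a "{n}"] by (auto simp: less_le_trans intro: le_less_trans)
    then have e: "?a n = ennreal (enn2real (?a n))" for n by simp
    have "(\<Sum>n. ennreal (enn2real (?a n))) \<noteq> top" using s e by simp
    then have "summable (\<lambda>n. enn2real (?a n))"
      by (intro summable_suminf_not_top) auto
    then have "(\<lambda>n. enn2real (?a n)) \<longlonglongrightarrow> 0" by (rule summable_LIMSEQ_zero)
    then have "(\<lambda>n. ennreal (enn2real (?a n))) \<longlonglongrightarrow> ennreal 0" by (rule tendsto_ennrealI)
    then show ?thesis using e by simp
  qed
  have "(\<lambda>n. \<Sum>v\<in>F. u v * (step_op T ^^ n) (indicator {v}) x) \<longlonglongrightarrow> (\<Sum>v\<in>F. u v * 0)"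
    by (intro tendsto_sum ennreal_tendsto_cmult lim) (use fin in auto)
  then have "(\<lambda>n. visits T y x + (\<Sum>v\<in>F. u v * (step_op T ^^ n) (indicator {v}) x)) \<longlonglongrightarrow> visits T y x + 0"
    by (intro tendsto_add tendsto_const) simp
  then show ?thesis using bound by (auto intro: LIMSEQ_le_const)
qed (simp add: not_less top_unique)

lemma step_op_real:
  assumes K: "\<And>z. z \<in> verts T \<Longrightarrow> 0 \<le> K z" and x: "x \<in> verts T" and c: "0 \<le> c"
  shows "step_op T (\<lambda>z. ennreal (c * K z)) x =
    ennreal (c * (\<Sum>z\<in>nbrs T x. conductance T x z * K z) / total_conductance T x)"
proof -
  have *: "0 \<le> conductance T x z / total_conductance T x" "0 \<le> c * K z" if "z \<in> nbrs T x" for z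
    using cond_pos[OF that] total_pos[OF x] K nbrs_verts[OF that] c by auto
  have "step_op T (\<lambda>z. ennreal (c * K z)) x =
    (\<Sum>z\<in>nbrs T x. ennreal (conductance T x z / total_conductance T x * (c * K z)))"
    unfolding step_op_eq[OF x] using * by (intro sum.cong refl) (simp only: ennreal_mult)
  also have "\<dots> = ennreal (\<Sum>z\<in>nbrs T x. conductance T x z / total_conductance T x * (c * K z))"
    by (rule sum_ennreal) (rule mult_nonneg_nonneg[OF *])
  also have "(\<Sum>z\<in>nbrs T x. conductance T x z / total_conductance T x * (c * K z)) =
    c * (\<Sum>z\<in>nbrs T x. conductance T x z * K z) / total_conductance T x"
    by (simp add: sum_distrib_left sum_divide_distrib mult_ac)
  finally show ?thesis .
qed

lemma visits_le_supersolution: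
  assumes K: "\<And>z. z \<in> verts T \<Longrightarrow> 0 \<le> K z"
    and super: "\<And>x. x \<in> verts T \<Longrightarrow>
      of_bool (x = y) + (\<Sum>z\<in>nbrs T x. conductance T x z * K z) \<le> total_conductance T x * K x"
    and y: "y \<in> verts T" and x: "x \<in> verts T"
  shows "visits T y x \<le> ennreal (total_conductance T y * K x)"
proof (rule visits_upper[OF _ x])
  fix x assume x: "x \<in> verts T"
  let ?l = "total_conductance T"
  let ?s = "\<Sum>z\<in>nbrs T x. conductance T x z * K z"
  have s: "0 \<le> ?s" using K nbrs_verts by (auto intro!: sum_nonneg mult_nonneg_nonneg less_imp_le[OF cond_pos])
  have l: "?l x > 0" "?l y > 0" using total_pos x y by auto
  have "of_bool (x = y) + ?l y * ?s / ?l x \<le> ?l y * K x"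
  proof -
    have "?s \<le> ?l x * K x - of_bool (x = y)" using super[OF x] by simp
    then have "?l y / ?l x * ?s \<le> ?l y / ?l x * (?l x * K x - of_bool (x = y))"
      using l by (intro mult_left_mono) auto
    also have "\<dots> = ?l y * K x - of_bool (x = y)" using l by (auto simp: field_simps)
    finally show ?thesis by simp
  qed
  then have "ennreal (of_bool (x = y) + ?l y * ?s / ?l x) \<le> ennreal (?l y * K x)"
    by (rule ennreal_leI)
  moreover have "ennreal (of_bool (x = y) + ?l y * ?s / ?l x) = indicator {y} x + ennreal (?l y * ?s / ?l x)"
    using l s by (subst ennreal_plus) (auto simp: indicator_def)
  ultimately show "indicator {y} x + step_op T (\<lambda>x. ennreal (?l y * K x)) x \<le> ennreal (?l y * K x)"
    using l by (subst step_op_real[OF K x]) auto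
qed

lemma subsolution_le_visits:
  assumes K: "\<And>z. z \<in> verts T \<Longrightarrow> 0 \<le> K z"
    and sub: "\<And>x. x \<in> verts T \<Longrightarrow>
      total_conductance T x * K x \<le> of_bool (x = y) + (\<Sum>z\<in>nbrs T x. conductance T x z * K z)"
    and F: "finite F" "F \<subseteq> verts T" "\<And>v. v \<in> verts T - F \<Longrightarrow> K v = 0"
    and y: "y \<in> verts T" and x: "x \<in> verts T"
  shows "ennreal (total_conductance T y * K x) \<le> visits T y x"
proof (rule visits_lower[OF _ F(1,2) _ _ y x])
  fix x assume x: "x \<in> verts T"
  let ?l = "total_conductance T"
  let ?s = "\<Sum>z\<in>nbrs T x. conductance T x z * K z"
  have s: "0 \<le> ?s" using K nbrs_verts by (auto intro!: sum_nonneg mult_nonneg_nonneg less_imp_le[OF cond_pos])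
  have l: "?l x > 0" "?l y > 0" using total_pos x y by auto
  have "?l y * K x \<le> of_bool (x = y) + ?l y * ?s / ?l x"
  proof -
    have "?l x * K x - of_bool (x = y) \<le> ?s" using sub[OF x] by simp
    then have "?l y / ?l x * (?l x * K x - of_bool (x = y)) \<le> ?l y / ?l x * ?s"
      using l by (intro mult_left_mono) auto
    moreover have "?l y / ?l x * (?l x * K x - of_bool (x = y)) = ?l y * K x - of_bool (x = y)"
      using l by (auto simp: field_simps)
    ultimately show ?thesis by simp
  qed
  then have "ennreal (?l y * K x) \<le> ennreal (of_bool (x = y) + ?l y * ?s / ?l x)"
    by (rule ennreal_leI)
  moreover have "ennreal (of_bool (x = y) + ?l y * ?s / ?l x) = indicator {y} x + ennreal (?l y * ?s / ?l x)"
    using l s by (subst ennreal_plus) (auto simp: indicator_def)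
  ultimately show "ennreal (?l y * K x) \<le> indicator {y} x + step_op T (\<lambda>x. ennreal (?l y * K x)) x"
    using l by (subst step_op_real[OF K x]) auto
qed (use F(3) in auto)

end

section \<open>Effective conductances and the Green function of a tree\<close>

definition parent_weight :: "(label \<Rightarrow> nat \<Rightarrow> real) \<Rightarrow> label \<Rightarrow> real" where
  "parent_weight \<omega> x = (if x = [] then 0 else \<omega> (butlast x) (last x))"

lemma verts_gw_tree [simp]: "verts (gw_tree \<omega>) = gw_verts \<omega>"
  by (simp add: gw_tree_def)

text \<open>
  The sequences of all labels are constrained, also of those outside the tree; this holds almost
  surely and makes the conductances below positive without reference to the tree.
\<close>

definition regular_weights :: "(label \<Rightarrow> nat \<Rightarrow> real) \<Rightarrow> bool" where
  "regular_weights \<omega> \<longleftrightarrow> is_weighted_tree (gw_tree \<omega>) \<and>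
     (\<forall>x. num_positive (\<omega> x) \<ge> 1 \<and> (\<forall>i<num_positive (\<omega> x). \<omega> x i > 0))"

text \<open>
  With \<open>a x\<close> the probability that the walk from \<open>x\<close> ever reaches the parent of \<open>x\<close>, this is the
  probability that the walk from \<open>y\<close> ever reaches \<open>w\<close>, for \<open>w\<close> on the path from the root to \<open>y\<close>,
  and \<open>0\<close> for other \<open>w\<close>.
\<close>

fun hit :: "(label \<Rightarrow> real) \<Rightarrow> label \<Rightarrow> label \<Rightarrow> real" where
  "hit a w y = (if w = y then 1 else if y = [] then 0 else a y * hit a w (butlast y))"

text \<open>
  The covariance of \<open>tree_field\<close> below, in a form that determines it from its recursion in \<open>x\<close>.
\<close>

fun tree_cov :: "(label \<Rightarrow> real) \<Rightarrow> (label \<Rightarrow> real) \<Rightarrow> label \<Rightarrow> label \<Rightarrow> real" where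
  "tree_cov a v x y = (if x = [] then v [] * hit a [] y
     else a x * tree_cov a v (butlast x) y + v x * hit a x y)"

declare hit.simps [simp del] tree_cov.simps [simp del]

lemma hit_self [simp]: "hit a x x = 1"
  by (simp add: hit.simps)

lemma hit_Nil: "hit a w [] = of_bool (w = [])"
  by (simp add: hit.simps)

lemma hit_snoc: "hit a w (y @ [j]) = (if w = y @ [j] then 1 else a (y @ [j]) * hit a w y)"
  by (subst hit.simps) simp

lemma hit_eq_0: "length y < length w \<Longrightarrow> hit a w y = 0"
  by (induction y rule: rev_induct) (auto simp: hit_Nil hit_snoc)

lemma tree_cov_Nil: "tree_cov a v [] y = v [] * hit a [] y"
  by (subst tree_cov.simps) simp

lemma tree_cov_snoc: "tree_cov a v (x @ [i]) y = a (x @ [i]) * tree_cov a v x y + v (x @ [i]) * hit a (x @ [i]) y"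
  by (subst tree_cov.simps) simp

text \<open>
  At most one child of \<open>x\<close> lies on the path from the root to \<open>y\<close>, and there is one unless \<open>y\<close> equals
  \<open>x\<close> or lies outside the subtree of \<open>x\<close>.
\<close>

lemma sum_hit_children:
  assumes "y \<in> gw_verts \<omega>"
  shows "(\<Sum>i<num_positive (\<omega> x). a (x @ [i]) * hit a (x @ [i]) y) = hit a x y - of_bool (x = y)"
  using assms
proof (induction y rule: rev_induct)
  case Nil
  then show ?case by (simp add: hit_Nil)
next
  case (snoc j y)
  then have y: "y \<in> gw_verts \<omega>" and j: "j < num_positive (\<omega> y)"
    by (auto simp: gw_verts_snoc_iff)
  show ?case
  proof (cases "x = y")
    case True
    have "(\<Sum>i<num_positive (\<omega> x). a (x @ [i]) * hit a (x @ [i]) (y @ [j])) =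
      (\<Sum>i<num_positive (\<omega> x). if i = j then a (y @ [j]) else 0)"
      using True by (intro sum.cong) (auto simp: hit_snoc hit_eq_0)
    then show ?thesis using j True by (simp add: hit_snoc)
  next
    case False
    then have "(\<Sum>i<num_positive (\<omega> x). a (x @ [i]) * hit a (x @ [i]) (y @ [j])) =
      a (y @ [j]) * (\<Sum>i<num_positive (\<omega> x). a (x @ [i]) * hit a (x @ [i]) y)"
      unfolding sum_distrib_left by (intro sum.cong) (auto simp: hit_snoc)
    also have "\<dots> = a (y @ [j]) * hit a x y" using snoc.IH[OF y] False by simp
    finally show ?thesis using False by (auto simp: hit_snoc hit_eq_0)
  qed
qed

lemma parent_weight_snoc [simp]: "parent_weight \<omega> (x @ [i]) = \<omega> x i"
  by (simp add: parent_weight_def)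

lemma parent_weight_Nil [simp]: "parent_weight \<omega> [] = 0"
  by (simp add: parent_weight_def)

text \<open>
  The equation of the Green function. The hypothesis on \<open>v x\<close> is the parallel law at \<open>x\<close>:
  \<open>\<omega> x i * (1 - a (x @ [i]))\<close> is the conductance from \<open>x\<close> to infinity through its \<open>i\<close>-th child, and
  \<open>1 / v x\<close> is the total conductance of the subtree of \<open>x\<close> together with the edge to the parent.
  At the root both \<open>parent_weight\<close> and \<open>a\<close> are \<open>0\<close>.
\<close>

lemma tree_cov_laplace:
  assumes y: "y \<in> gw_verts \<omega>" and a: "\<And>x. a x = parent_weight \<omega> x * v x"
    and v: "v x * (parent_weight \<omega> x + (\<Sum>i<num_positive (\<omega> x). \<omega> x i * (1 - a (x @ [i])))) = 1"
  shows "(parent_weight \<omega> x + (\<Sum>i<num_positive (\<omega> x). \<omega> x i)) * tree_cov a v x y =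
    of_bool (x = y) + (\<Sum>i<num_positive (\<omega> x). \<omega> x i * tree_cov a v (x @ [i]) y) +
    parent_weight \<omega> x * tree_cov a v (butlast x) y"
proof -
  let ?S = "\<Sum>i<num_positive (\<omega> x). \<omega> x i" and ?A = "\<Sum>i<num_positive (\<omega> x). \<omega> x i * a (x @ [i])"
  let ?p = "parent_weight \<omega> x" and ?K = "tree_cov a v x y"
  have "\<omega> x i * tree_cov a v (x @ [i]) y = \<omega> x i * a (x @ [i]) * ?K + a (x @ [i]) * hit a (x @ [i]) y" for i
    by (subst tree_cov_snoc) (simp add: a algebra_simps)
  then have children: "(\<Sum>i<num_positive (\<omega> x). \<omega> x i * tree_cov a v (x @ [i]) y) = ?A * ?K + (hit a x y - of_bool (x = y))"
    by (simp add: sum.distrib sum_hit_children[OF y] sum_distrib_right)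
  have K: "?K = v x * (?p * tree_cov a v (butlast x) y + hit a x y)"
    by (subst tree_cov.simps) (simp add: a algebra_simps tree_cov_Nil)
  have k: "v x * (?p + (?S - ?A)) = 1"
    using v by (simp add: right_diff_distrib sum_subtractf)
  have "(?p + (?S - ?A)) * ?K = (v x * (?p + (?S - ?A))) * (?p * tree_cov a v (butlast x) y + hit a x y)"
    by (subst K) (simp only: mult_ac)
  then have "(?p + (?S - ?A)) * ?K = ?p * tree_cov a v (butlast x) y + hit a x y"
    using k by simp
  then have "(?p + ?S) * ?K = ?A * ?K + (?p * tree_cov a v (butlast x) y + hit a x y)"
    by (simp only: algebra_simps)
  then show ?thesis unfolding children by simp
qed

text \<open>
  Effective conductance, inside the subtree of \<open>x\<close>, from \<open>x\<close> to the vertices \<open>Suc n\<close> generations below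
  \<open>x\<close>, by the series and parallel laws.
\<close>

primrec cond_to_depth :: "(label \<Rightarrow> nat \<Rightarrow> real) \<Rightarrow> nat \<Rightarrow> label \<Rightarrow> real" where
  "cond_to_depth \<omega> 0 x = (\<Sum>i<num_positive (\<omega> x). \<omega> x i)"
| "cond_to_depth \<omega> (Suc n) x = (\<Sum>i<num_positive (\<omega> x).
     \<omega> x i * cond_to_depth \<omega> n (x @ [i]) / (\<omega> x i + cond_to_depth \<omega> n (x @ [i])))"

definition cond_to_infinity :: "(label \<Rightarrow> nat \<Rightarrow> real) \<Rightarrow> label \<Rightarrow> real" where
  "cond_to_infinity \<omega> x = lim (\<lambda>n. cond_to_depth \<omega> n x)"

lemma series_conductance_mono:
  fixes l :: real
  assumes "l > 0" "0 < s" "s \<le> t"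
  shows "l * s / (l + s) \<le> l * t / (l + t)"
proof -
  have "l * (s * l) \<le> l * (t * l)" using assms by simp
  then show ?thesis using assms by (simp add: field_simps)
qed

context
  fixes \<omega> :: "label \<Rightarrow> nat \<Rightarrow> real"
  assumes regular: "regular_weights \<omega>"
begin

lemma weight_pos: "i < num_positive (\<omega> x) \<Longrightarrow> \<omega> x i > 0"
  and has_child: "num_positive (\<omega> x) \<ge> 1"
  using regular by (auto simp: regular_weights_def)

lemma cond_to_depth_pos: "cond_to_depth \<omega> n x > 0"
proof (induction n arbitrary: x)
  case 0
  show ?case using weight_pos[of _ x] has_child[of x] by (auto intro!: sum_pos simp: lessThan_empty_iff)
next
  case (Suc n)
  show ?case using weight_pos[of _ x] has_child[of x] Suc
    by (auto intro!: sum_pos divide_pos_pos mult_pos_pos add_pos_pos simp: lessThan_empty_iff)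
qed

lemma cond_to_depth_Suc_le: "cond_to_depth \<omega> (Suc n) x \<le> cond_to_depth \<omega> n x"
proof (induction n arbitrary: x)
  case 0
  have "\<omega> x i * c / (\<omega> x i + c) \<le> \<omega> x i" if "i < num_positive (\<omega> x)" "c > 0" for i c
    using weight_pos[OF that(1)] that(2) by (simp add: field_simps)
  then show ?case using cond_to_depth_pos[of 0] by (auto intro!: sum_mono)
next
  case (Suc n)
  show ?case
    unfolding cond_to_depth.simps(2)[of \<omega> "Suc n" x] cond_to_depth.simps(2)[of \<omega> n x]
    by (intro sum_mono series_conductance_mono weight_pos cond_to_depth_pos Suc) simp
qed

lemma cond_to_depth_tendsto: "(\<lambda>n. cond_to_depth \<omega> n x) \<longlonglongrightarrow> cond_to_infinity \<omega> x"
proof -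
  have "decseq (\<lambda>n. cond_to_depth \<omega> n x)" by (intro decseq_SucI cond_to_depth_Suc_le)
  then have "convergent (\<lambda>n. cond_to_depth \<omega> n x)"
    using cond_to_depth_pos by (intro Bseq_monoseq_convergent decseq_imp_monoseq decseq_bounded[of _ 0]) (auto intro: less_imp_le)
  then show ?thesis unfolding cond_to_infinity_def by (simp add: convergent_LIMSEQ_iff)
qed

lemma cond_to_infinity_nonneg: "cond_to_infinity \<omega> x \<ge> 0"
  by (rule LIMSEQ_le_const[OF cond_to_depth_tendsto]) (meson cond_to_depth_pos less_imp_le)

text \<open>
  The recursion of \<open>cond_to_depth\<close> passes to the limit.
\<close>

lemma cond_to_infinity_eq: "cond_to_infinity \<omega> x = (\<Sum>i<num_positive (\<omega> x).
    \<omega> x i * cond_to_infinity \<omega> (x @ [i]) / (\<omega> x i + cond_to_infinity \<omega> (x @ [i])))"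
proof (rule LIMSEQ_unique)
  show "(\<lambda>n. cond_to_depth \<omega> (Suc n) x) \<longlonglongrightarrow> cond_to_infinity \<omega> x"
    by (rule LIMSEQ_Suc[OF cond_to_depth_tendsto])
  show "(\<lambda>n. cond_to_depth \<omega> (Suc n) x) \<longlonglongrightarrow> (\<Sum>i<num_positive (\<omega> x).
    \<omega> x i * cond_to_infinity \<omega> (x @ [i]) / (\<omega> x i + cond_to_infinity \<omega> (x @ [i])))"
    unfolding cond_to_depth.simps
  proof (intro tendsto_sum tendsto_divide tendsto_mult tendsto_add tendsto_const cond_to_depth_tendsto)
    fix i assume "i \<in> {..<num_positive (\<omega> x)}"
    then show "\<omega> x i + cond_to_infinity \<omega> (x @ [i]) \<noteq> 0"
      using weight_pos[of i x] cond_to_infinity_nonneg[of "x @ [i]"] by simp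
  qed
qed

lemma gw_butlast: "x \<in> gw_verts \<omega> \<Longrightarrow> x \<noteq> [] \<Longrightarrow> butlast x \<in> gw_verts \<omega> \<and> last x < num_positive (\<omega> (butlast x))"
  using gw_verts_snoc_iff[of "butlast x" "last x" \<omega>] by simp

lemma parent_weight_pos: "x \<in> gw_verts \<omega> \<Longrightarrow> x \<noteq> [] \<Longrightarrow> parent_weight \<omega> x > 0"
  using gw_butlast[of x] weight_pos by (auto simp: parent_weight_def)

lemma parent_weight_nonneg: "x \<in> gw_verts \<omega> \<Longrightarrow> parent_weight \<omega> x \<ge> 0"
  using parent_weight_pos[of x] by (cases "x = []") auto

lemma nbrs_gw:
  assumes "x \<in> gw_verts \<omega>"
  shows "nbrs (gw_tree \<omega>) x = (\<lambda>i. x @ [i]) ` {..<num_positive (\<omega> x)} \<union> (if x = [] then {} else {butlast x})"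
proof (intro equalityI subsetI)
  fix y assume "y \<in> nbrs (gw_tree \<omega>) x"
  then have y: "y \<in> gw_verts \<omega>" and "y \<noteq> [] \<and> x = butlast y \<or> x \<noteq> [] \<and> y = butlast x"
    by (auto simp: nbrs_def edges_def)
  then consider "x \<noteq> []" "y = butlast x" | "y = x @ [last y]" "y \<noteq> []" "x = butlast y"
    by (metis append_butlast_last_id)
  then show "y \<in> (\<lambda>i. x @ [i]) ` {..<num_positive (\<omega> x)} \<union> (if x = [] then {} else {butlast x})"
  proof cases
    case 2
    then have "last y < num_positive (\<omega> x)" using gw_butlast[OF y] by simp
    then show ?thesis using 2 by (metis UnI1 image_eqI lessThan_iff)
  qed auto
next
  fix y assume "y \<in> (\<lambda>i. x @ [i]) ` {..<num_positive (\<omega> x)} \<union> (if x = [] then {} else {butlast x})"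
  then show "y \<in> nbrs (gw_tree \<omega>) x"
    using assms gw_butlast[OF assms] by (auto simp: nbrs_def edges_def gw_verts_snoc_iff gw_verts_snoc_iff[of "[]", simplified] split: if_splits)
qed

lemma butlast_ne: "x \<noteq> [] \<Longrightarrow> \<not> (y = butlast x \<and> x = butlast y)"
proof
  assume "x \<noteq> []" "y = butlast x \<and> x = butlast y"
  then have "length y = length x - 1" "length x = length y - 1" by (metis length_butlast)+
  with \<open>x \<noteq> []\<close> show False by (cases x) auto
qed

lemma sum_nbrs_gw:
  assumes x: "x \<in> gw_verts \<omega>"
  shows "(\<Sum>z\<in>nbrs (gw_tree \<omega>) x. conductance (gw_tree \<omega>) x z * f z) =
    (\<Sum>i<num_positive (\<omega> x). \<omega> x i * f (x @ [i])) + parent_weight \<omega> x * f (butlast x)"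
proof -
  let ?g = "\<lambda>z. conductance (gw_tree \<omega>) x z * f z"
  have c: "conductance (gw_tree \<omega>) x (x @ [i]) = \<omega> x i" for i
    by (simp add: gw_tree_def gw_conductance_def)
  have p: "conductance (gw_tree \<omega>) x (butlast x) = parent_weight \<omega> x" if "x \<noteq> []"
    using that butlast_ne[OF that, of "butlast x"] by (auto simp: gw_tree_def gw_conductance_def parent_weight_def)
  have "butlast x \<noteq> x @ [i]" for i
  proof
    assume "butlast x = x @ [i]"
    then have "x @ [i] = butlast x" by simp
    then have "length (x @ [i]) = length (butlast x)" by simp
    then show False by simp
  qed
  then have "(\<Sum>z\<in>nbrs (gw_tree \<omega>) x. ?g z) = (\<Sum>z\<in>(\<lambda>i. x @ [i]) ` {..<num_positive (\<omega> x)}. ?g z) +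
      (\<Sum>z\<in>(if x = [] then {} else {butlast x}). ?g z)"
    unfolding nbrs_gw[OF x] by (intro sum.union_disjoint) auto
  also have "(\<Sum>z\<in>(\<lambda>i. x @ [i]) ` {..<num_positive (\<omega> x)}. ?g z) = (\<Sum>i<num_positive (\<omega> x). \<omega> x i * f (x @ [i]))"
    by (subst sum.reindex) (auto simp: inj_on_def c)
  also have "(\<Sum>z\<in>(if x = [] then {} else {butlast x}). ?g z) = parent_weight \<omega> x * f (butlast x)"
    using p by auto
  finally show ?thesis .
qed

lemma total_conductance_gw:
  assumes "x \<in> gw_verts \<omega>"
  shows "total_conductance (gw_tree \<omega>) x = parent_weight \<omega> x + (\<Sum>i<num_positive (\<omega> x). \<omega> x i)"
  using sum_nbrs_gw[OF assms, of "\<lambda>_. 1"] by (simp add: total_conductance_def nbrs_def)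

lemma walkable_gw: "walkable_tree (gw_tree \<omega>)"
proof
  show "is_weighted_tree (gw_tree \<omega>)" using regular by (simp add: regular_weights_def)
  show "nbrs (gw_tree \<omega>) x \<noteq> {}" if "x \<in> verts (gw_tree \<omega>)" for x
    using that nbrs_gw[of x] has_child[of x] by (auto simp: lessThan_empty_iff)
qed

lemma hit_nonneg:
  assumes "\<And>x. x \<in> gw_verts \<omega> \<Longrightarrow> 0 \<le> a x" "y \<in> gw_verts \<omega>"
  shows "0 \<le> hit a w y"
  using assms(2)
proof (induction y rule: rev_induct)
  case (snoc i y)
  then show ?case using assms(1)[OF snoc.prems] by (auto simp: hit_snoc gw_verts_snoc_iff)
qed (simp add: hit_Nil)

lemma tree_cov_nonneg:
  assumes a: "\<And>x. x \<in> gw_verts \<omega> \<Longrightarrow> 0 \<le> a x" and v: "\<And>x. x \<in> gw_verts \<omega> \<Longrightarrow> 0 \<le> v x"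
    and "x \<in> gw_verts \<omega>" "y \<in> gw_verts \<omega>"
  shows "0 \<le> tree_cov a v x y"
  using assms(3)
proof (induction x rule: rev_induct)
  case Nil
  then show ?case using hit_nonneg[OF a assms(4)] v[OF Nil] by (simp add: tree_cov_Nil)
next
  case (snoc i x)
  then show ?case using hit_nonneg[OF a assms(4)] v[OF snoc.prems] a[OF snoc.prems]
    by (auto simp: tree_cov_snoc gw_verts_snoc_iff)
qed

lemma finite_verts_depth: "finite {x \<in> gw_verts \<omega>. length x \<le> n}"
proof (induction n)
  case 0
  have "{x \<in> gw_verts \<omega>. length x \<le> 0} \<subseteq> {[]}" by auto
  then show ?case by (rule finite_subset) simp
next
  case (Suc n)
  let ?V = "{x \<in> gw_verts \<omega>. length x \<le> n}"
  have "{x \<in> gw_verts \<omega>. length x \<le> Suc n} \<subseteq> insert [] (\<Union>x\<in>?V. (\<lambda>i. x @ [i]) ` {..<num_positive (\<omega> x)})"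
  proof
    fix x assume x: "x \<in> {x \<in> gw_verts \<omega>. length x \<le> Suc n}"
    then show "x \<in> insert [] (\<Union>x\<in>?V. (\<lambda>i. x @ [i]) ` {..<num_positive (\<omega> x)})"
      by (cases x rule: rev_cases) (auto simp: gw_verts_snoc_iff)
  qed
  then show ?case by (rule finite_subset) (use Suc in auto)
qed

end

text \<open>
  At the root of a recurrent tree the denominator is \<open>0\<close>, and so is the value.
\<close>

definition var_inf :: "(label \<Rightarrow> nat \<Rightarrow> real) \<Rightarrow> label \<Rightarrow> real" where
  "var_inf \<omega> x = 1 / (parent_weight \<omega> x + cond_to_infinity \<omega> x)"

text \<open>
  The tree cut off below depth \<open>n\<close>: the value \<open>0\<close> beyond that depth kills the walk there.
\<close>

definition var_depth :: "(label \<Rightarrow> nat \<Rightarrow> real) \<Rightarrow> nat \<Rightarrow> label \<Rightarrow> real" where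
  "var_depth \<omega> n x = (if length x \<le> n
     then 1 / (parent_weight \<omega> x + cond_to_depth \<omega> (n - length x) x) else 0)"

definition cov_inf :: "(label \<Rightarrow> nat \<Rightarrow> real) \<Rightarrow> label \<Rightarrow> label \<Rightarrow> real" where
  "cov_inf \<omega> = tree_cov (\<lambda>x. parent_weight \<omega> x * var_inf \<omega> x) (var_inf \<omega>)"

definition cov_depth :: "(label \<Rightarrow> nat \<Rightarrow> real) \<Rightarrow> nat \<Rightarrow> label \<Rightarrow> label \<Rightarrow> real" where
  "cov_depth \<omega> n = tree_cov (\<lambda>x. parent_weight \<omega> x * var_depth \<omega> n x) (var_depth \<omega> n)"

context
  fixes \<omega> :: "label \<Rightarrow> nat \<Rightarrow> real"
  assumes regular: "regular_weights \<omega>"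
begin

interpretation walkable_tree "gw_tree \<omega>" by (rule walkable_gw[OF regular])

lemma var_depth_nonneg: "x \<in> gw_verts \<omega> \<Longrightarrow> 0 \<le> var_depth \<omega> n x"
  using cond_to_depth_pos[OF regular, of "n - length x" x] parent_weight_nonneg[OF regular, of x]
  by (simp add: var_depth_def)

lemma var_inf_nonneg: "x \<in> gw_verts \<omega> \<Longrightarrow> 0 \<le> var_inf \<omega> x"
  using cond_to_infinity_nonneg[OF regular, of x] parent_weight_nonneg[OF regular, of x]
  by (simp add: var_inf_def)

text \<open>
  At depth \<open>n\<close> the children carry the value \<open>0\<close>, so the full conductances of their edges enter; this
  is the initial case of \<open>cond_to_depth\<close>.
\<close>

lemma var_depth_eq:
  assumes x: "x \<in> gw_verts \<omega>" and n: "length x \<le> n"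
  shows "var_depth \<omega> n x * (parent_weight \<omega> x + (\<Sum>i<num_positive (\<omega> x).
    \<omega> x i * (1 - parent_weight \<omega> (x @ [i]) * var_depth \<omega> n (x @ [i])))) = 1"
proof -
  have "(\<Sum>i<num_positive (\<omega> x). \<omega> x i * (1 - \<omega> x i * var_depth \<omega> n (x @ [i]))) = cond_to_depth \<omega> (n - length x) x"
  proof (cases "length x = n")
    case True
    then show ?thesis by (simp add: var_depth_def)
  next
    case False
    then obtain k where k: "n - length x = Suc k" "n - Suc (length x) = k" "Suc (length x) \<le> n"
      using n by (metis Suc_diff_Suc Suc_leI diff_Suc_Suc le_neq_implies_less)
    show ?thesis unfolding k(1) cond_to_depth.simps
    proof (rule sum.cong[OF refl])
      fix i assume "i \<in> {..<num_positive (\<omega> x)}"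
      then have "\<omega> x i > 0" "cond_to_depth \<omega> k (x @ [i]) > 0"
        using weight_pos[OF regular] cond_to_depth_pos[OF regular] by auto
      then show "\<omega> x i * (1 - \<omega> x i * var_depth \<omega> n (x @ [i])) =
        \<omega> x i * cond_to_depth \<omega> k (x @ [i]) / (\<omega> x i + cond_to_depth \<omega> k (x @ [i]))"
        using k by (simp add: var_depth_def field_simps)
    qed
  qed
  moreover have "parent_weight \<omega> x + cond_to_depth \<omega> (n - length x) x > 0"
    using cond_to_depth_pos[OF regular] parent_weight_nonneg[OF regular x] by (simp add: add_nonneg_pos)
  ultimately show ?thesis using n by (simp add: var_depth_def)
qed

lemma var_inf_eq:
  assumes x: "x \<in> gw_verts \<omega>" and pos: "cond_to_infinity \<omega> [] > 0"
  shows "var_inf \<omega> x * (parent_weight \<omega> x + (\<Sum>i<num_positive (\<omega> x).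
    \<omega> x i * (1 - parent_weight \<omega> (x @ [i]) * var_inf \<omega> (x @ [i])))) = 1"
proof -
  have "(\<Sum>i<num_positive (\<omega> x). \<omega> x i * (1 - \<omega> x i * var_inf \<omega> (x @ [i]))) = cond_to_infinity \<omega> x"
    unfolding cond_to_infinity_eq[OF regular, of x]
  proof (rule sum.cong[OF refl])
    fix i assume "i \<in> {..<num_positive (\<omega> x)}"
    then have "\<omega> x i > 0" "cond_to_infinity \<omega> (x @ [i]) \<ge> 0"
      using weight_pos[OF regular] cond_to_infinity_nonneg[OF regular] by auto
    then have "\<omega> x i + cond_to_infinity \<omega> (x @ [i]) \<noteq> 0" by simp
    then show "\<omega> x i * (1 - \<omega> x i * var_inf \<omega> (x @ [i])) =
      \<omega> x i * cond_to_infinity \<omega> (x @ [i]) / (\<omega> x i + cond_to_infinity \<omega> (x @ [i]))"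
      by (simp add: var_inf_def field_simps)
  qed
  moreover have "parent_weight \<omega> x + cond_to_infinity \<omega> x > 0"
    using cond_to_infinity_nonneg[OF regular, of x] parent_weight_pos[OF regular x] pos
    by (cases "x = []") (auto intro: add_pos_nonneg)
  ultimately show ?thesis by (simp add: var_inf_def)
qed

lemma cov_depth_eq_0:
  assumes "length x > n"
  shows "cov_depth \<omega> n x y = 0"
  using assms by (cases x rule: rev_cases) (auto simp: cov_depth_def tree_cov_snoc var_depth_def)

lemma cov_depth_nonneg: "x \<in> gw_verts \<omega> \<Longrightarrow> y \<in> gw_verts \<omega> \<Longrightarrow> 0 \<le> cov_depth \<omega> n x y"
  unfolding cov_depth_def
  by (rule tree_cov_nonneg[OF regular])
     (auto intro!: var_depth_nonneg mult_nonneg_nonneg parent_weight_nonneg[OF regular])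

lemma cov_inf_nonneg: "x \<in> gw_verts \<omega> \<Longrightarrow> y \<in> gw_verts \<omega> \<Longrightarrow> 0 \<le> cov_inf \<omega> x y"
  unfolding cov_inf_def
  by (rule tree_cov_nonneg[OF regular])
     (auto intro!: var_inf_nonneg mult_nonneg_nonneg parent_weight_nonneg[OF regular])

text \<open>
  Up to depth \<open>n\<close> the function satisfies the equation of the Green function, and where it fails to do
  so it vanishes; this makes it a subsolution of finite support.
\<close>

lemma cov_depth_le_visits:
  assumes x: "x \<in> gw_verts \<omega>" and y: "y \<in> gw_verts \<omega>"
  shows "ennreal (total_conductance (gw_tree \<omega>) y * cov_depth \<omega> n x y) \<le> visits (gw_tree \<omega>) y x"
proof (rule subsolution_le_visits[where F = "{x \<in> gw_verts \<omega>. length x \<le> n}"])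
  fix x assume "x \<in> verts (gw_tree \<omega>)"
  then have x: "x \<in> gw_verts \<omega>" by (simp add: verts_gw_tree)
  show "total_conductance (gw_tree \<omega>) x * cov_depth \<omega> n x y
    \<le> of_bool (x = y) + (\<Sum>z\<in>nbrs (gw_tree \<omega>) x. conductance (gw_tree \<omega>) x z * cov_depth \<omega> n z y)"
  proof (cases "length x \<le> n")
    case True
    show ?thesis
      unfolding sum_nbrs_gw[OF regular x] total_conductance_gw[OF regular x] cov_depth_def
      by (subst tree_cov_laplace[where v = "var_depth \<omega> n" and a = "\<lambda>x. parent_weight \<omega> x * var_depth \<omega> n x",
            OF y refl var_depth_eq[OF x True]]) simp
  next
    case False
    have "0 \<le> (\<Sum>z\<in>nbrs (gw_tree \<omega>) x. conductance (gw_tree \<omega>) x z * cov_depth \<omega> n z y)"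
      using y nbrs_verts by (auto intro!: sum_nonneg mult_nonneg_nonneg cov_depth_nonneg less_imp_le[OF cond_pos]
          simp: verts_gw_tree)
    then show ?thesis using False by (simp add: cov_depth_eq_0)
  qed
qed (use x y finite_verts_depth[OF regular] in \<open>auto simp: verts_gw_tree cov_depth_eq_0 cov_depth_nonneg\<close>)

lemma visits_le_cov_inf:
  assumes x: "x \<in> gw_verts \<omega>" and y: "y \<in> gw_verts \<omega>" and pos: "cond_to_infinity \<omega> [] > 0"
  shows "visits (gw_tree \<omega>) y x \<le> ennreal (total_conductance (gw_tree \<omega>) y * cov_inf \<omega> x y)"
proof (rule visits_le_supersolution)
  fix x assume "x \<in> verts (gw_tree \<omega>)"
  then have x: "x \<in> gw_verts \<omega>" by (simp add: verts_gw_tree)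
  show "of_bool (x = y) + (\<Sum>z\<in>nbrs (gw_tree \<omega>) x. conductance (gw_tree \<omega>) x z * cov_inf \<omega> z y)
    \<le> total_conductance (gw_tree \<omega>) x * cov_inf \<omega> x y"
    unfolding sum_nbrs_gw[OF regular x] total_conductance_gw[OF regular x] cov_inf_def
    by (subst tree_cov_laplace[where v = "var_inf \<omega>" and a = "\<lambda>x. parent_weight \<omega> x * var_inf \<omega> x",
          OF y refl var_inf_eq[OF x pos]]) simp
qed (use x y in \<open>auto simp: verts_gw_tree cov_inf_nonneg\<close>)

lemma var_depth_tendsto:
  assumes "parent_weight \<omega> x + cond_to_infinity \<omega> x \<noteq> 0"
  shows "(\<lambda>n. var_depth \<omega> n x) \<longlonglongrightarrow> var_inf \<omega> x"
proof -
  have "(\<lambda>n. cond_to_depth \<omega> (n - length x) x) \<longlonglongrightarrow> cond_to_infinity \<omega> x"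
    by (rule filterlim_compose[OF cond_to_depth_tendsto[OF regular] filterlim_minus_const_nat_at_top])
  then have "(\<lambda>n. 1 / (parent_weight \<omega> x + cond_to_depth \<omega> (n - length x) x)) \<longlonglongrightarrow> var_inf \<omega> x"
    unfolding var_inf_def using assms by (intro tendsto_intros)
  moreover have "eventually (\<lambda>n. 1 / (parent_weight \<omega> x + cond_to_depth \<omega> (n - length x) x) = var_depth \<omega> n x) sequentially"
    using eventually_ge_at_top[of "length x"] by eventually_elim (simp add: var_depth_def)
  ultimately show ?thesis by (rule Lim_transform_eventually)
qed

lemma coeff_tendsto:
  assumes "x \<in> gw_verts \<omega>"
  shows "(\<lambda>n. parent_weight \<omega> x * var_depth \<omega> n x) \<longlonglongrightarrow> parent_weight \<omega> x * var_inf \<omega> x"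
proof (cases "x = []")
  case False
  then have "parent_weight \<omega> x + cond_to_infinity \<omega> x > 0"
    using parent_weight_pos[OF regular assms] cond_to_infinity_nonneg[OF regular] by (simp add: add_pos_nonneg)
  then show ?thesis by (intro tendsto_mult tendsto_const var_depth_tendsto) simp
qed simp

lemma hit_tendsto:
  assumes "y \<in> gw_verts \<omega>"
  shows "(\<lambda>n. hit (\<lambda>x. parent_weight \<omega> x * var_depth \<omega> n x) w y) \<longlonglongrightarrow>
    hit (\<lambda>x. parent_weight \<omega> x * var_inf \<omega> x) w y"
  using assms
proof (induction y rule: rev_induct)
  case (snoc i y)
  then show ?case using coeff_tendsto[OF snoc.prems]
    by (auto simp: hit_snoc gw_verts_snoc_iff intro!: tendsto_mult)
qed (simp add: hit_Nil)

text \<open>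
  The lower bounds \<open>cov_depth_le_visits\<close> converge to the upper bound \<open>visits_le_cov_inf\<close>.
\<close>

lemma green_transient:
  assumes x: "x \<in> gw_verts \<omega>" and y: "y \<in> gw_verts \<omega>" and pos: "cond_to_infinity \<omega> [] > 0"
  shows "green (gw_tree \<omega>) x y = cov_inf \<omega> x y"
proof -
  let ?l = "total_conductance (gw_tree \<omega>) y"
  have l: "?l > 0" using total_pos y by (simp add: verts_gw_tree)
  have pos': "parent_weight \<omega> z + cond_to_infinity \<omega> z \<noteq> 0" if "z \<in> gw_verts \<omega>" for z
  proof -
    have "parent_weight \<omega> z + cond_to_infinity \<omega> z > 0"
      using cond_to_infinity_nonneg[OF regular, of z] parent_weight_pos[OF regular that] pos
      by (cases "z = []") (auto intro: add_pos_nonneg)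
    then show ?thesis by simp
  qed
  have "(\<lambda>n. cov_depth \<omega> n x y) \<longlonglongrightarrow> cov_inf \<omega> x y"
    using x
  proof (induction x rule: rev_induct)
    case Nil
    then show ?case unfolding cov_depth_def cov_inf_def tree_cov_Nil
      by (intro tendsto_mult var_depth_tendsto pos' hit_tendsto y)
  next
    case (snoc i x)
    then have "x \<in> gw_verts \<omega>" by (simp add: gw_verts_snoc_iff)
    from snoc.IH[OF this] show ?case unfolding cov_depth_def cov_inf_def tree_cov_snoc
      by (intro tendsto_mult tendsto_add var_depth_tendsto pos' hit_tendsto y coeff_tendsto snoc.prems)
  qed
  then have "(\<lambda>n. ennreal (?l * cov_depth \<omega> n x y)) \<longlonglongrightarrow> ennreal (?l * cov_inf \<omega> x y)"
    by (intro tendsto_ennrealI tendsto_mult tendsto_const)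
  then have "ennreal (?l * cov_inf \<omega> x y) \<le> visits (gw_tree \<omega>) y x"
    by (rule LIMSEQ_le_const2) (use cov_depth_le_visits[OF x y] in auto)
  with visits_le_cov_inf[OF x y pos] have "visits (gw_tree \<omega>) y x = ennreal (?l * cov_inf \<omega> x y)" by simp
  then show ?thesis using l cov_inf_nonneg[OF x y] by (simp add: green_eq)
qed

text \<open>
  The variance \<open>1 / cond_to_depth \<omega> n []\<close> at the root diverges and enters all covariances with a
  factor that stays away from \<open>0\<close>. So the expected number of visits is infinite, and \<open>green\<close> takes
  the default value of \<open>enn2real\<close>.
\<close>

lemma green_recurrent:
  assumes x: "x \<in> gw_verts \<omega>" and y: "y \<in> gw_verts \<omega>" and zero: "cond_to_infinity \<omega> [] = 0"
  shows "green (gw_tree \<omega>) x y = 0"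
proof -
  let ?l = "total_conductance (gw_tree \<omega>) y"
  let ?a = "\<lambda>x. parent_weight \<omega> x * var_inf \<omega> x" and ?an = "\<lambda>n x. parent_weight \<omega> x * var_depth \<omega> n x"
  have l: "?l > 0" using total_pos y by (simp add: verts_gw_tree)
  have a: "?a z > 0" if "z \<in> gw_verts \<omega>" "z \<noteq> []" for z
    using parent_weight_pos[OF regular that] cond_to_infinity_nonneg[OF regular, of z]
    by (simp add: var_inf_def add_pos_nonneg)
  have hit_pos: "hit ?a [] y > 0"
    using y
  proof (induction y rule: rev_induct)
    case (snoc i y)
    then have "hit ?a [] y > 0" by (simp add: gw_verts_snoc_iff)
    then show ?case using a[OF snoc.prems] by (simp add: hit_snoc)
  qed (simp add: hit_Nil)
  have "filterlim (\<lambda>n. cov_depth \<omega> n x y) at_top sequentially"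
    using x
  proof (induction x rule: rev_induct)
    case Nil
    have "filterlim (\<lambda>n. inverse (cond_to_depth \<omega> n [])) at_top sequentially"
    proof (rule filterlim_inverse_at_top)
      show "(\<lambda>n. cond_to_depth \<omega> n []) \<longlonglongrightarrow> 0"
        using cond_to_depth_tendsto[OF regular, of "[]"] zero by simp
    qed (simp add: cond_to_depth_pos[OF regular])
    then have v: "filterlim (\<lambda>n. var_depth \<omega> n []) at_top sequentially"
      by (simp add: var_depth_def inverse_eq_divide)
    show ?case unfolding cov_depth_def tree_cov_Nil
      using filterlim_tendsto_pos_mult_at_top[OF hit_tendsto[OF y, of "[]"] hit_pos v]
      by (simp add: mult.commute)
  next
    case (snoc i x)
    then have "x \<in> gw_verts \<omega>" by (simp add: gw_verts_snoc_iff)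
    note IH = snoc.IH[OF this]
    have "filterlim (\<lambda>n. ?an n (x @ [i]) * cov_depth \<omega> n x y) at_top sequentially"
      by (rule filterlim_tendsto_pos_mult_at_top[OF coeff_tendsto[OF snoc.prems] a[OF snoc.prems] IH]) simp
    then show ?case
    proof (rule filterlim_at_top_mono, intro always_eventually allI)
      fix n
      have "0 \<le> var_depth \<omega> n (x @ [i]) * hit (?an n) (x @ [i]) y"
        by (intro mult_nonneg_nonneg var_depth_nonneg snoc.prems hit_nonneg[OF regular _ y] parent_weight_nonneg[OF regular])
      then show "?an n (x @ [i]) * cov_depth \<omega> n x y \<le> cov_depth \<omega> n (x @ [i]) y"
        unfolding cov_depth_def by (simp add: tree_cov_snoc)
    qed
  qed
  then have inf: "filterlim (\<lambda>n. ?l * cov_depth \<omega> n x y) at_top sequentially"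
    by (intro filterlim_tendsto_pos_mult_at_top[OF tendsto_const l])
  have "visits (gw_tree \<omega>) y x = \<infinity>"
  proof (rule ccontr)
    assume "visits (gw_tree \<omega>) y x \<noteq> \<infinity>"
    then obtain r where r: "visits (gw_tree \<omega>) y x = ennreal r" "r \<ge> 0"
      by (cases "visits (gw_tree \<omega>) y x") auto
    have "eventually (\<lambda>n. ?l * cov_depth \<omega> n x y > r) sequentially"
      using inf by (simp add: filterlim_at_top_dense)
    then obtain n where "?l * cov_depth \<omega> n x y > r" by (auto simp: eventually_sequentially)
    moreover have "ennreal (?l * cov_depth \<omega> n x y) \<le> ennreal r"
      using cov_depth_le_visits[OF x y] r by simp
    ultimately show False using r by (simp add: ennreal_le_iff)
  qed
  then show ?thesis by (simp add: green_eq)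
qed

end

section \<open>The Gaussian free field as a Markov chain along the tree\<close>

text \<open>
  The value \<open>r\<close> at the root is a separate argument, so that the same function describes the field on
  the subtree of a vertex, started from the value at that vertex.
\<close>

fun tree_field :: "(label \<Rightarrow> real) \<Rightarrow> (label \<Rightarrow> real) \<Rightarrow> real \<Rightarrow> (label \<Rightarrow> real) \<Rightarrow> label \<Rightarrow> real" where
  "tree_field a s r z x = (if x = [] then r else a x * tree_field a s r z (butlast x) + s x * z x)"

declare tree_field.simps [simp del]

lemma tree_field_Nil: "tree_field a s r z [] = r"
  by (subst tree_field.simps) simp

lemma tree_field_snoc: "tree_field a s r z (x @ [i]) = a (x @ [i]) * tree_field a s r z x + s (x @ [i]) * z (x @ [i])"
  by (subst tree_field.simps) simp

lemma tree_field_expansion: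
  assumes F: "finite F" "\<And>y. y \<in> F \<Longrightarrow> butlast y \<in> F" and x: "x \<in> F"
  shows "tree_field a s (s [] * z []) z x = (\<Sum>w\<in>F. s w * hit a w x * z w)"
  using x
proof (induction x rule: rev_induct)
  case Nil
  have "(\<Sum>w\<in>F. s w * hit a w [] * z w) = (\<Sum>w\<in>F. if w = [] then s [] * z [] else 0)"
    by (intro sum.cong) (auto simp: hit_Nil)
  then show ?case using F(1) Nil by (simp add: tree_field_Nil)
next
  case (snoc i x)
  have x: "x \<in> F" using F(2)[OF snoc.prems] by simp
  have "(\<Sum>w\<in>F. s w * hit a w (x @ [i]) * z w) =
    (\<Sum>w\<in>F. a (x @ [i]) * (s w * hit a w x * z w) + (if w = x @ [i] then s w * z w else 0))"
    by (intro sum.cong) (auto simp: hit_snoc hit_eq_0)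
  also have "\<dots> = a (x @ [i]) * tree_field a s (s [] * z []) z x + s (x @ [i]) * z (x @ [i])"
    using F(1) snoc.prems by (simp add: sum.distrib sum_distrib_left snoc.IH[OF x])
  finally show ?case by (simp add: tree_field_snoc)
qed

lemma tree_cov_expansion:
  assumes F: "finite F" "\<And>y. y \<in> F \<Longrightarrow> butlast y \<in> F" and x: "x \<in> F"
  shows "tree_cov a v x y = (\<Sum>w\<in>F. v w * hit a w x * hit a w y)"
  using x
proof (induction x rule: rev_induct)
  case Nil
  have "(\<Sum>w\<in>F. v w * hit a w [] * hit a w y) = (\<Sum>w\<in>F. if w = [] then v [] * hit a [] y else 0)"
    by (intro sum.cong) (auto simp: hit_Nil)
  then show ?case using F(1) Nil by (simp add: tree_cov_Nil)
next
  case (snoc i x)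
  have x: "x \<in> F" using F(2)[OF snoc.prems] by simp
  have "(\<Sum>w\<in>F. v w * hit a w (x @ [i]) * hit a w y) =
    (\<Sum>w\<in>F. a (x @ [i]) * (v w * hit a w x * hit a w y) + (if w = x @ [i] then v w * hit a w y else 0))"
    by (intro sum.cong) (auto simp: hit_snoc hit_eq_0)
  also have "\<dots> = a (x @ [i]) * tree_cov a v x y + v (x @ [i]) * hit a (x @ [i]) y"
    using F(1) snoc.prems by (simp add: sum.distrib sum_distrib_left snoc.IH[OF x])
  finally show ?case by (simp add: tree_cov_snoc)
qed

definition subtree_field :: "(label \<Rightarrow> nat \<Rightarrow> real) \<Rightarrow> real \<Rightarrow> (label \<Rightarrow> real) \<Rightarrow> label \<Rightarrow> real" where
  "subtree_field \<omega> = tree_field (\<lambda>x. parent_weight \<omega> x * var_inf \<omega> x) (\<lambda>x. sqrt (var_inf \<omega> x))"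

text \<open>
  The case distinction matches the Green function of a recurrent tree, which is \<open>0\<close>.
\<close>

definition free_field :: "(label \<Rightarrow> nat \<Rightarrow> real) \<Rightarrow> (label \<Rightarrow> real) \<Rightarrow> label \<Rightarrow> real" where
  "free_field \<omega> z x = (if cond_to_infinity \<omega> [] = 0 then 0
     else subtree_field \<omega> (sqrt (var_inf \<omega> []) * z []) z x)"

lemma measurable_white_noise_coord [measurable]: "(\<lambda>z. z w) \<in> borel_measurable white_noise"
  using measurable_component_singleton[of w UNIV "\<lambda>_. std_normal_distribution"] by simp

lemma measurable_free_field [measurable]: "(\<lambda>z. free_field \<omega> z x) \<in> borel_measurable white_noise"
proof (cases "cond_to_infinity \<omega> [] = 0")
  case False
  have "(\<lambda>z. subtree_field \<omega> (sqrt (var_inf \<omega> []) * z []) z x) \<in> borel_measurable white_noise"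
    unfolding subtree_field_def
    by (induction x rule: rev_induct) (simp_all add: tree_field_Nil tree_field_snoc)
  then show ?thesis using False by (simp add: free_field_def)
qed (simp add: free_field_def)

definition free_field_law :: "(label \<Rightarrow> nat \<Rightarrow> real) \<Rightarrow> (label \<Rightarrow> real) measure" where
  "free_field_law \<omega> = distr white_noise (PiM (gw_verts \<omega>) (\<lambda>_. borel)) (\<lambda>z. restrict (free_field \<omega> z) (gw_verts \<omega>))"

text \<open>
  On the finitely many vertices up to some depth, the field is a linear image of white noise with
  the coefficients of \<open>tree_field_expansion\<close>, so linear combinations are normal and the
  covariances are those of \<open>tree_cov_expansion\<close>.
\<close>

lemma gaussian_free_field_law:
  assumes regular: "regular_weights \<omega>"
  shows "is_centered_gaussian_field (gw_verts \<omega>) (green (gw_tree \<omega>)) (free_field_law \<omega>)"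
  unfolding is_centered_gaussian_field_def
proof (intro conjI allI impI ballI)
  interpret W: prob_space "white_noise :: (label \<Rightarrow> real) measure" by (rule prob_space_white_noise)
  let ?V = "gw_verts \<omega>"
  let ?M = "free_field_law \<omega>"
  let ?a = "\<lambda>x. parent_weight \<omega> x * var_inf \<omega> x" and ?s = "\<lambda>x. sqrt (var_inf \<omega> x)"
  have R[measurable]: "(\<lambda>z. restrict (free_field \<omega> z) ?V) \<in> measurable white_noise (PiM ?V (\<lambda>_. borel))"
    by measurable
  show "prob_space ?M" unfolding free_field_law_def by (rule W.prob_space_distr[OF R])
  show "sets ?M = sets (PiM ?V (\<lambda>_. borel))" by (simp add: free_field_law_def)
  have coord[measurable]: "(\<lambda>\<phi>. \<phi> x) \<in> borel_measurable (PiM ?V (\<lambda>_. borel))" if "x \<in> ?V" for x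
    using that by (rule measurable_component_singleton)
  define V where "V n = {x \<in> ?V. length x \<le> n}" for n
  have V: "finite (V n)" "\<And>y. y \<in> V n \<Longrightarrow> butlast y \<in> V n" for n
    using finite_verts_depth[OF regular] gw_butlast[OF regular]
    unfolding V_def by (auto, metis butlast.simps(1))
  {
    fix J :: "label set" and t :: "label \<Rightarrow> real" assume J: "finite J \<and> J \<subseteq> ?V"
    have "distr ?M borel (\<lambda>\<phi>. \<Sum>x\<in>J. t x * \<phi> x) = distr white_noise borel (\<lambda>z. \<Sum>x\<in>J. t x * free_field \<omega> z x)"
      unfolding free_field_law_def using J
      by (subst distr_distr) (auto intro!: distr_cong sum.cong simp: subset_eq
          intro: borel_measurable_sum borel_measurable_times coord)
    also have "\<exists>\<sigma>\<ge>0. \<dots> = centered_normal \<sigma>"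
    proof (cases "cond_to_infinity \<omega> [] = 0")
      case True
      then have "distr white_noise borel (\<lambda>z. \<Sum>x\<in>J. t x * free_field \<omega> z x) = return borel 0"
        using W.distr_const[of "0::real" borel] by (simp add: free_field_def)
      then show ?thesis by (intro exI[of _ 0]) (simp add: centered_normal_def)
    next
      case False
      define n where "n = Max (insert 0 (length ` J))"
      have JV: "J \<subseteq> V n" using J by (auto simp: V_def n_def)
      have "(\<Sum>x\<in>J. t x * free_field \<omega> z x) = (\<Sum>w\<in>V n. (\<Sum>x\<in>J. t x * (?s w * hit ?a w x)) * z w)" for z
      proof -
        have "(\<Sum>x\<in>J. t x * free_field \<omega> z x) = (\<Sum>x\<in>J. t x * (\<Sum>w\<in>V n. ?s w * hit ?a w x * z w))"
          using JV False
          by (intro sum.cong refl arg_cong2[where f = "(*)"])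
             (auto simp: free_field_def subtree_field_def intro!: tree_field_expansion V)
        also have "\<dots> = (\<Sum>w\<in>V n. (\<Sum>x\<in>J. t x * (?s w * hit ?a w x)) * z w)"
          unfolding sum_distrib_left sum_distrib_right by (subst sum.swap) (simp add: mult_ac)
        finally show ?thesis .
      qed
      then show ?thesis using white_noise_linear_combination[OF V(1)]
        by (intro exI[of _ "sqrt (\<Sum>w\<in>V n. (\<Sum>x\<in>J. t x * (?s w * hit ?a w x))\<^sup>2)"]) (simp add: sum_nonneg)
    qed
    finally show "\<exists>\<sigma>\<ge>0. distr ?M borel (\<lambda>\<phi>. \<Sum>x\<in>J. t x * \<phi> x) = centered_normal \<sigma>" .
  }
  fix x y assume x: "x \<in> ?V" and y: "y \<in> ?V"
  have "(\<integral>\<phi>. \<phi> x * \<phi> y \<partial>?M) = (\<integral>z. free_field \<omega> z x * free_field \<omega> z y \<partial>white_noise)"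
    unfolding free_field_law_def using x y by (subst integral_distr) auto
  also have "\<dots> = green (gw_tree \<omega>) x y"
  proof (cases "cond_to_infinity \<omega> [] = 0")
    case True
    then show ?thesis using green_recurrent[OF regular x y] by (simp add: free_field_def)
  next
    case False
    then have pos: "cond_to_infinity \<omega> [] > 0" using cond_to_infinity_nonneg[OF regular, of "[]"] by simp
    define n where "n = max (length x) (length y)"
    have n: "x \<in> V n" "y \<in> V n" using x y by (auto simp: V_def n_def)
    have expansion: "free_field \<omega> z u = (\<Sum>w\<in>V n. ?s w * hit ?a w u * z w)" if "u \<in> V n" for z u
      using False that by (auto simp: free_field_def subtree_field_def intro!: tree_field_expansion V)
    have "(\<integral>z. free_field \<omega> z x * free_field \<omega> z y \<partial>white_noise) =
      (\<integral>z. (\<Sum>w\<in>V n. ?s w * hit ?a w x * z w) * (\<Sum>w\<in>V n. ?s w * hit ?a w y * z w) \<partial>white_noise)"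
      by (simp only: expansion n)
    also have "\<dots> = (\<Sum>w\<in>V n. (?s w * hit ?a w x) * (?s w * hit ?a w y))"
      by (rule white_noise_covariance[OF V(1)])
    also have "\<dots> = (\<Sum>w\<in>V n. var_inf \<omega> w * hit ?a w x * hit ?a w y)"
    proof (rule sum.cong[OF refl])
      fix w assume "w \<in> V n"
      then have "?s w * ?s w = var_inf \<omega> w" using var_inf_nonneg[OF regular, of w] by (simp add: V_def)
      then show "(?s w * hit ?a w x) * (?s w * hit ?a w y) = var_inf \<omega> w * hit ?a w x * hit ?a w y"
        by (metis (no_types, lifting) mult.assoc mult.left_commute)
    qed
    also have "\<dots> = cov_inf \<omega> x y"
      unfolding cov_inf_def by (rule tree_cov_expansion[OF V n(1), symmetric])
    finally show ?thesis using green_transient[OF regular x y pos] by simp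
  qed
  finally show "(\<integral>\<phi>. \<phi> x * \<phi> y \<partial>?M) = green (gw_tree \<omega>) x y" .
qed

lemma gff_law_eq:
  assumes regular: "regular_weights \<omega>"
  shows "gff_law (gw_tree \<omega>) = free_field_law \<omega>"
proof -
  have "is_centered_gaussian_field (verts (gw_tree \<omega>)) (green (gw_tree \<omega>)) (gff_law (gw_tree \<omega>))"
    unfolding gff_law_def
    by (rule someI[of _ "free_field_law \<omega>"]) (simp add: verts_gw_tree gaussian_free_field_law[OF regular])
  then show ?thesis
    using gaussian_field_unique gaussian_free_field_law[OF regular] by (simp add: verts_gw_tree)
qed

section \<open>Levels whose components are bounded\<close>

definition bounded_components :: "weighted_tree \<Rightarrow> (label \<Rightarrow> real) \<Rightarrow> real \<Rightarrow> bool" where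
  "bounded_components T \<phi> h \<longleftrightarrow> (\<forall>x\<in>level_set T \<phi> h.
     graph_bounded T (connected_component_of_vertex T (level_set T \<phi> h) x))"

lemma pred_relpow:
  fixes R :: "'a \<Rightarrow> ('b::countable \<times> 'b) set"
  assumes [measurable]: "\<And>x y. Measurable.pred N (\<lambda>\<omega>. (x, y) \<in> R \<omega>)"
  shows "Measurable.pred N (\<lambda>\<omega>. (x, y) \<in> R \<omega> ^^ k)"
proof (induction k arbitrary: y)
  case (Suc k)
  have "(\<lambda>\<omega>. (x, y) \<in> R \<omega> ^^ Suc k) = (\<lambda>\<omega>. \<exists>z. (x, z) \<in> R \<omega> ^^ k \<and> (z, y) \<in> R \<omega>)"
    by (auto simp: relcomp_unfold)
  moreover note [measurable] = Suc
  ultimately show ?case by simp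
qed simp

text \<open>
  Edges, components and distances are expressed by countably many quantifiers over labels and
  path lengths.
\<close>

lemma pred_bounded_components:
  assumes V[measurable]: "\<And>x. Measurable.pred N (\<lambda>\<omega>. x \<in> verts (T \<omega>))"
    and L[measurable]: "\<And>x. Measurable.pred N (\<lambda>\<omega>. x \<in> level_set (T \<omega>) (\<phi> \<omega>) h)"
  shows "Measurable.pred N (\<lambda>\<omega>. bounded_components (T \<omega>) (\<phi> \<omega>) h)"
proof -
  have E[measurable]: "Measurable.pred N (\<lambda>\<omega>. (x, y) \<in> edges (T \<omega>))" for x y
    unfolding edges_def by simp measurable
  have [measurable]: "Measurable.pred N (\<lambda>\<omega>. (x, y) \<in> edges (T \<omega>) ^^ k)" for x y k
    by (rule pred_relpow) (rule E)
  have C[measurable]: "Measurable.pred N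
    (\<lambda>\<omega>. y \<in> connected_component_of_vertex (T \<omega>) (level_set (T \<omega>) (\<phi> \<omega>) h) x)" for x y
  proof -
    have [measurable]: "Measurable.pred N (\<lambda>\<omega>. (x, y) \<in>
      (edges (T \<omega>) \<inter> level_set (T \<omega>) (\<phi> \<omega>) h \<times> level_set (T \<omega>) (\<phi> \<omega>) h) ^^ k)" for x y k
      by (rule pred_relpow) simp
    show ?thesis unfolding connected_component_of_vertex_def rtrancl_power by simp measurable
  qed
  have "(\<lambda>\<omega>. bounded_components (T \<omega>) (\<phi> \<omega>) h) =
    (\<lambda>\<omega>. \<forall>u. u \<in> level_set (T \<omega>) (\<phi> \<omega>) h \<longrightarrow> (\<exists>n. \<forall>x y.
      x \<in> connected_component_of_vertex (T \<omega>) (level_set (T \<omega>) (\<phi> \<omega>) h) u \<longrightarrow>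
      y \<in> connected_component_of_vertex (T \<omega>) (level_set (T \<omega>) (\<phi> \<omega>) h) u \<longrightarrow>
      (\<exists>k\<in>{..n}. (x, y) \<in> edges (T \<omega>) ^^ k)))"
    unfolding bounded_components_def graph_bounded_def by (intro ext) (simp; blast)
  then show ?thesis by simp
qed

lemma bounded_components_restrict:
  "bounded_components T (restrict \<phi> (verts T)) h = bounded_components T \<phi> h"
proof -
  have "level_set T (restrict \<phi> (verts T)) h = level_set T \<phi> h" by (auto simp: level_set_def)
  then show ?thesis by (simp add: bounded_components_def)
qed

lemma bounded_components_mono:
  assumes b: "bounded_components T \<phi> h" and le: "h \<le> h'"
  shows "bounded_components T \<phi> h'"
  unfolding bounded_components_def
proof
  fix x assume x: "x \<in> level_set T \<phi> h'"
  have sub: "level_set T \<phi> h' \<subseteq> level_set T \<phi> h" using le by (auto simp: level_set_def)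
  then have "connected_component_of_vertex T (level_set T \<phi> h') x \<subseteq> connected_component_of_vertex T (level_set T \<phi> h) x"
    unfolding connected_component_of_vertex_def
    using rtrancl_mono[of "edges T \<inter> level_set T \<phi> h' \<times> level_set T \<phi> h'" "edges T \<inter> level_set T \<phi> h \<times> level_set T \<phi> h"]
    by blast
  moreover have "graph_bounded T (connected_component_of_vertex T (level_set T \<phi> h) x)"
    using b x sub by (auto simp: bounded_components_def)
  ultimately show "graph_bounded T (connected_component_of_vertex T (level_set T \<phi> h') x)"
    unfolding graph_bounded_def by blast
qed

definition subcritical :: "real \<Rightarrow> (label \<Rightarrow> nat \<Rightarrow> real) \<Rightarrow> bool" where
  "subcritical h \<omega> \<longleftrightarrow> (AE z in white_noise. bounded_components (gw_tree \<omega>) (free_field \<omega> z) h)"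

lemma subcritical_mono: "subcritical h \<omega> \<Longrightarrow> h \<le> h' \<Longrightarrow> subcritical h' \<omega>"
  unfolding subcritical_def by (rule AE_mp, assumption) (auto intro: bounded_components_mono)

text \<open>
  Replaces the choice in \<open>gff_law\<close> by an explicit function of the weights and of white noise.
\<close>

lemma h_star_eq_Inf_subcritical:
  assumes regular: "regular_weights \<omega>"
  shows "h_star (gw_tree \<omega>) = Inf (ereal ` {h. subcritical h \<omega>})"
proof -
  have "(AE \<phi> in gff_law (gw_tree \<omega>). bounded_components (gw_tree \<omega>) \<phi> h) \<longleftrightarrow> subcritical h \<omega>" for h
  proof -
    let ?V = "gw_verts \<omega>"
    have R: "(\<lambda>z. restrict (free_field \<omega> z) ?V) \<in> measurable white_noise (PiM ?V (\<lambda>_. borel))"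
      by measurable
    have "Measurable.pred (PiM ?V (\<lambda>_. borel)) (\<lambda>\<phi>. bounded_components (gw_tree \<omega>) \<phi> h)"
    proof (rule pred_bounded_components)
      fix x
      show "Measurable.pred (PiM ?V (\<lambda>_. borel)) (\<lambda>\<phi>. x \<in> level_set (gw_tree \<omega>) \<phi> h)"
      proof (cases "x \<in> ?V")
        case True
        then have [measurable]: "(\<lambda>\<phi>. \<phi> x) \<in> borel_measurable (PiM ?V (\<lambda>_. borel))"
          by (rule measurable_component_singleton)
        show ?thesis unfolding level_set_def by simp
      qed (simp add: level_set_def verts_gw_tree)
    qed simp
    then show ?thesis
      unfolding gff_law_eq[OF regular] free_field_law_def subcritical_def
      using bounded_components_restrict[of "gw_tree \<omega>"]
      by (subst AE_distr_iff[OF R]) (auto simp: verts_gw_tree pred_def)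
  qed
  then show ?thesis by (simp add: h_star_def bounded_components_def)
qed

abbreviation weight_space :: "(label \<Rightarrow> nat \<Rightarrow> real) measure" where
  "weight_space \<equiv> PiM UNIV (\<lambda>_. PiM UNIV (\<lambda>_. borel))"

lemma sets_gw_measure: "sets \<nu> = sets (PiM UNIV (\<lambda>_. borel)) \<Longrightarrow> sets (gw_measure \<nu>) = sets weight_space"
  unfolding gw_measure_def by (rule sets_PiM_cong) auto

lemma measurable_weight [measurable]: "(\<lambda>\<omega>. \<omega> x i) \<in> borel_measurable weight_space"
  by (rule measurable_compose[OF measurable_component_singleton[of x] measurable_component_singleton[of i]]) auto

lemma measurable_num_positive [measurable]: "(\<lambda>\<omega>. num_positive (\<omega> x)) \<in> measurable weight_space (count_space UNIV)"
  unfolding num_positive_def by (rule measurable_card) measurable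

lemma measurable_gw_verts [measurable]: "Measurable.pred weight_space (\<lambda>\<omega>. x \<in> gw_verts \<omega>)"
  by (induction x rule: rev_induct) (simp_all add: gw_verts.root gw_verts_snoc_iff)

lemma measurable_parent_weight [measurable]: "(\<lambda>\<omega>. parent_weight \<omega> x) \<in> borel_measurable weight_space"
  unfolding parent_weight_def by simp

lemma measurable_child_sum:
  assumes [measurable]: "\<And>i. (\<lambda>\<omega>. f \<omega> i) \<in> borel_measurable weight_space"
  shows "(\<lambda>\<omega>. \<Sum>i<num_positive (\<omega> x). f \<omega> i :: real) \<in> borel_measurable weight_space"
  by (rule measurable_compose_countable[where f = "\<lambda>k \<omega>. \<Sum>i<k. f \<omega> i"]) measurable

lemma measurable_cond_to_depth [measurable]: "(\<lambda>\<omega>. cond_to_depth \<omega> n x) \<in> borel_measurable weight_space"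
proof (induction n arbitrary: x)
  case 0
  show ?case unfolding cond_to_depth.simps by (rule measurable_child_sum) measurable
next
  case (Suc n)
  note [measurable] = Suc
  show ?case unfolding cond_to_depth.simps by (rule measurable_child_sum) measurable
qed

lemma measurable_cond_to_infinity [measurable]: "(\<lambda>\<omega>. cond_to_infinity \<omega> x) \<in> borel_measurable weight_space"
  unfolding cond_to_infinity_def by (rule borel_measurable_lim_metric) measurable

lemma measurable_var_inf [measurable]: "(\<lambda>\<omega>. var_inf \<omega> x) \<in> borel_measurable weight_space"
  unfolding var_inf_def by measurable

lemma measurable_subtree_field:
  assumes [measurable]: "r \<in> borel_measurable N" "w \<in> measurable N weight_space" "\<And>x. (\<lambda>u. z u x) \<in> borel_measurable N"
  shows "(\<lambda>u. subtree_field (w u) (r u) (z u) x) \<in> borel_measurable N"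
  unfolding subtree_field_def
  by (induction x rule: rev_induct) (simp_all add: tree_field_Nil tree_field_snoc)

text \<open>
  The measure of a section of a measurable set depends measurably on the parameter.
\<close>

lemma (in sigma_finite_measure) pred_AE:
  assumes Q: "Measurable.pred (N \<Otimes>\<^sub>M M) Q"
  shows "Measurable.pred N (\<lambda>u. AE z in M. Q (u, z))"
proof -
  let ?E = "{x \<in> space (N \<Otimes>\<^sub>M M). \<not> Q x}"
  define f where "f u = emeasure M {z \<in> space M. (u, z) \<in> ?E}" for u
  have eq: "(AE z in M. Q (u, z)) \<longleftrightarrow> f u = 0" if u: "u \<in> space N" for u
  proof -
    have "Measurable.pred M (\<lambda>z. Q (u, z))"
      using measurable_compose[OF measurable_Pair1'[OF u] Q] by simp
    then have m: "{z \<in> space M. Q (u, z)} \<in> sets M" unfolding pred_def .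
    have "(AE z in M. Q (u, z)) \<longleftrightarrow> emeasure M {z \<in> space M. \<not> Q (u, z)} = 0"
      by (rule AE_iff_measurable[OF sets.sets_Collect_neg[OF m] refl])
    then show ?thesis using u by (simp add: f_def space_pair_measure)
  qed
  note [measurable] = Q
  have [measurable]: "f \<in> borel_measurable N"
    unfolding f_def by (rule measurable_emeasure) measurable
  have "Measurable.pred N (\<lambda>u. f u = 0)" by measurable
  then show ?thesis by (rule measurable_cong[THEN iffD2, rotated]) (rule eq)
qed

lemma measurable_subcritical [measurable]: "Measurable.pred weight_space (subcritical h)"
proof -
  interpret W: prob_space "white_noise :: (label \<Rightarrow> real) measure" by (rule prob_space_white_noise)
  let ?N = "weight_space \<Otimes>\<^sub>M (white_noise :: (label \<Rightarrow> real) measure)"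
  have [measurable]: "(\<lambda>u. free_field (fst u) (snd u) x) \<in> borel_measurable ?N" for x
  proof -
    have [measurable]: "(\<lambda>u. subtree_field (fst u) (sqrt (var_inf (fst u) []) * snd u []) (snd u) x) \<in> borel_measurable ?N"
      by (rule measurable_subtree_field) measurable
    show ?thesis unfolding free_field_def by measurable
  qed
  have B[measurable]: "Measurable.pred ?N (\<lambda>u. bounded_components (gw_tree (fst u)) (free_field (fst u) (snd u)) h)"
    by (rule pred_bounded_components) (simp_all add: level_set_def verts_gw_tree)
  show ?thesis unfolding subcritical_def using W.pred_AE[OF B] by simp
qed

section \<open>From the tree to the subtree of a child of the root\<close>

definition shift :: "nat \<Rightarrow> (label \<Rightarrow> 'a) \<Rightarrow> label \<Rightarrow> 'a" where
  "shift i f x = f (i # x)"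

lemma measurable_shift [measurable]: "shift i \<in> measurable (PiM UNIV (\<lambda>_. \<nu>)) (PiM UNIV (\<lambda>_. \<nu>))"
  unfolding shift_def[abs_def] by (rule measurable_PiM_single') (auto simp: space_PiM)

lemma measurable_shift_coord: "(\<lambda>z. shift i z x) \<in> borel_measurable white_noise"
  by (simp add: shift_def)

lemma shift_upd_root: "shift i (z([] := u)) = shift i z"
  by (auto simp: shift_def)

lemma distr_shift:
  assumes "prob_space \<nu>"
  shows "distr (PiM UNIV (\<lambda>_. \<nu>)) (PiM UNIV (\<lambda>_. \<nu>)) (shift i) = PiM UNIV (\<lambda>_. \<nu>)"
  using distr_PiM_reindex[of UNIV "\<lambda>_. \<nu>" "(#) i" UNIV] assms
  by (simp add: restrict_def shift_def[abs_def])

lemma verts_shift: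
  assumes "i < num_positive (\<omega> [])"
  shows "x \<in> gw_verts (shift i \<omega>) \<longleftrightarrow> i # x \<in> gw_verts \<omega>"
proof (induction x rule: rev_induct)
  case Nil
  show ?case using gw_verts_snoc_iff[of "[]" i \<omega>] assms by (simp add: gw_verts.root)
next
  case (snoc j x)
  then show ?case using gw_verts_snoc_iff[of "i # x" j \<omega>] by (simp add: gw_verts_snoc_iff shift_def)
qed

lemma parent_weight_shift: "x \<noteq> [] \<Longrightarrow> parent_weight (shift i \<omega>) x = parent_weight \<omega> (i # x)"
  by (simp add: parent_weight_def shift_def)

lemma cond_to_depth_shift: "cond_to_depth (shift i \<omega>) n x = cond_to_depth \<omega> n (i # x)"
  by (induction n arbitrary: x) (simp_all add: shift_def)

lemma cond_to_infinity_shift: "cond_to_infinity (shift i \<omega>) x = cond_to_infinity \<omega> (i # x)"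
  by (simp add: cond_to_infinity_def cond_to_depth_shift)

lemma var_inf_shift: "x \<noteq> [] \<Longrightarrow> var_inf (shift i \<omega>) x = var_inf \<omega> (i # x)"
  by (simp add: var_inf_def parent_weight_shift cond_to_infinity_shift)

text \<open>
  The Markov property of the field: below a child of the root, the coefficients are those of the
  subtree, and the only trace of the rest of the tree is the value at the child.
\<close>

lemma subtree_field_shift:
  "subtree_field \<omega> r z (i # x) = subtree_field (shift i \<omega>) (subtree_field \<omega> r z [i]) (shift i z) x"
proof (induction x rule: rev_induct)
  case Nil
  show ?case by (simp add: subtree_field_def tree_field_Nil)
next
  case (snoc j x)
  have "subtree_field \<omega> r z (i # x @ [j]) = parent_weight \<omega> (i # x @ [j]) * var_inf \<omega> (i # x @ [j]) * subtree_field \<omega> r z (i # x)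
      + sqrt (var_inf \<omega> (i # x @ [j])) * z (i # x @ [j])"
    unfolding subtree_field_def using tree_field_snoc[of _ _ r z "i # x" j] by simp
  then show ?case
    by (simp add: snoc.IH) (simp add: subtree_field_def tree_field_snoc parent_weight_shift[symmetric] var_inf_shift[symmetric]
        shift_def[of i z] del: parent_weight_snoc)
qed

lemma subtree_field_upd_root: "subtree_field \<omega> r (z([] := u)) x = subtree_field \<omega> r z x"
  unfolding subtree_field_def by (induction x rule: rev_induct) (simp_all add: tree_field_Nil tree_field_snoc)

lemma edges_shift:
  assumes "i < num_positive (\<omega> [])"
  shows "(x, y) \<in> edges (gw_tree (shift i \<omega>)) \<longleftrightarrow> (i # x, i # y) \<in> edges (gw_tree \<omega>)"
  by (auto simp: edges_def verts_gw_tree verts_shift[of i \<omega>, OF assms])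

text \<open>
  The map that contracts everything outside the subtree of the \<open>i\<close>-th child of the root to that
  child, in the labels of the subtree. It does not increase distances.
\<close>

definition proj_subtree :: "nat \<Rightarrow> label \<Rightarrow> label" where
  "proj_subtree i u = (if u \<noteq> [] \<and> hd u = i then tl u else [])"

lemma edges_proj_subtree:
  assumes i: "i < num_positive (\<omega> [])" and uv: "(u, v) \<in> edges (gw_tree \<omega>)"
  shows "proj_subtree i u = proj_subtree i v \<or> (proj_subtree i u, proj_subtree i v) \<in> edges (gw_tree (shift i \<omega>))"
proof -
  have *: "proj_subtree i u = proj_subtree i v \<or> u = i # proj_subtree i u \<and> v = i # proj_subtree i v"
    if v: "v \<noteq> []" "u = butlast v" for u v
    using v by (cases v) (auto simp: proj_subtree_def)
  have "proj_subtree i u = proj_subtree i v \<or> u = i # proj_subtree i u \<and> v = i # proj_subtree i v"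
    using uv *[of v u] *[of u v] unfolding edges_def by auto
  then show ?thesis using uv edges_shift[of i \<omega> "proj_subtree i u" "proj_subtree i v", OF i] by auto
qed

lemma relpow_proj_subtree:
  assumes i: "i < num_positive (\<omega> [])"
  shows "(u, v) \<in> edges (gw_tree \<omega>) ^^ k \<Longrightarrow>
    \<exists>j\<le>k. (proj_subtree i u, proj_subtree i v) \<in> edges (gw_tree (shift i \<omega>)) ^^ j"
proof (induction k arbitrary: v)
  case 0
  then show ?case by (intro exI[of _ 0]) simp
next
  case (Suc k)
  then obtain w where w: "(u, w) \<in> edges (gw_tree \<omega>) ^^ k" "(w, v) \<in> edges (gw_tree \<omega>)" by auto
  from Suc.IH[OF w(1)] obtain j where j: "j \<le> k" "(proj_subtree i u, proj_subtree i w) \<in> edges (gw_tree (shift i \<omega>)) ^^ j"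
    by auto
  from edges_proj_subtree[of i \<omega>, OF i w(2)] show ?case
  proof
    assume "proj_subtree i w = proj_subtree i v"
    then show ?thesis using j by (intro exI[of _ j]) auto
  next
    assume "(proj_subtree i w, proj_subtree i v) \<in> edges (gw_tree (shift i \<omega>))"
    then show ?thesis using j by (intro exI[of _ "Suc j"]) auto
  qed
qed

text \<open>
  A component within the subtree is contained in a component of the whole tree, and by
  contraction its diameter in the subtree is no larger than in the whole tree.
\<close>

lemma bounded_components_shift:
  assumes i: "i < num_positive (\<omega> [])" and b: "bounded_components (gw_tree \<omega>) \<phi> h"
  shows "bounded_components (gw_tree (shift i \<omega>)) (shift i \<phi>) h"
  unfolding bounded_components_def
proof
  let ?T = "gw_tree \<omega>" and ?S = "gw_tree (shift i \<omega>)"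
  let ?L = "level_set ?T \<phi> h" and ?M = "level_set ?S (shift i \<phi>) h"
  have L: "x \<in> ?M \<longleftrightarrow> i # x \<in> ?L" for x
    by (simp add: level_set_def verts_gw_tree verts_shift[of i \<omega>, OF i]) (simp add: shift_def)
  fix x assume x: "x \<in> ?M"
  have C: "i # y \<in> connected_component_of_vertex ?T ?L (i # x)" if "y \<in> connected_component_of_vertex ?S ?M x" for y
  proof -
    have "(x, y) \<in> (edges ?S \<inter> ?M \<times> ?M)\<^sup>*" using that by (simp add: connected_component_of_vertex_def)
    then have "(i # x, i # y) \<in> (edges ?T \<inter> ?L \<times> ?L)\<^sup>*"
    proof (induction rule: rtrancl_induct)
      case (step y z)
      then have "(i # y, i # z) \<in> edges ?T \<inter> ?L \<times> ?L" using L edges_shift[of i \<omega>, OF i] by auto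
      with step.IH show ?case by (rule rtrancl_into_rtrancl)
    qed simp
    then show ?thesis by (simp add: connected_component_of_vertex_def)
  qed
  have "graph_bounded ?T (connected_component_of_vertex ?T ?L (i # x))"
    using b x L[of x] unfolding bounded_components_def by simp
  then obtain n where n: "\<forall>u\<in>connected_component_of_vertex ?T ?L (i # x).
      \<forall>v\<in>connected_component_of_vertex ?T ?L (i # x). \<exists>k\<le>n. (u, v) \<in> edges ?T ^^ k"
    unfolding graph_bounded_def by (rule exE)
  show "graph_bounded ?S (connected_component_of_vertex ?S ?M x)"
    unfolding graph_bounded_def
  proof (rule exI[of _ n], intro ballI)
    fix u v assume "u \<in> connected_component_of_vertex ?S ?M x" "v \<in> connected_component_of_vertex ?S ?M x"
    then have "i # u \<in> connected_component_of_vertex ?T ?L (i # x)" "i # v \<in> connected_component_of_vertex ?T ?L (i # x)"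
      by (auto intro: C)
    then obtain k where k: "k \<le> n" "(i # u, i # v) \<in> edges ?T ^^ k" using n by blast
    obtain j where "j \<le> k" "(proj_subtree i (i # u), proj_subtree i (i # v)) \<in> edges ?S ^^ j"
      using relpow_proj_subtree[of i \<omega>, OF i k(2)] by blast
    then have "j \<le> n" "(u, v) \<in> edges ?S ^^ j" using k(1) by (simp_all add: proj_subtree_def)
    then show "\<exists>k\<le>n. (u, v) \<in> edges ?S ^^ k" by blast
  qed
qed

lemma pred_subtree_bounded:
  assumes "r \<in> borel_measurable N" "\<And>x. (\<lambda>u. z u x) \<in> borel_measurable N"
  shows "Measurable.pred N (\<lambda>u. bounded_components (gw_tree \<omega>) (subtree_field \<omega> (r u) (z u)) h)"
proof (rule pred_bounded_components)
  have "(\<lambda>_. \<omega>) \<in> measurable N weight_space" by (rule measurable_const) (simp add: space_PiM)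
  then have [measurable]: "(\<lambda>u. subtree_field \<omega> (r u) (z u) x) \<in> borel_measurable N" for x
    using measurable_subtree_field[OF assms(1) _ assms(2), of "\<lambda>_. \<omega>"] by simp
  show "Measurable.pred N (\<lambda>u. x \<in> level_set (gw_tree \<omega>) (subtree_field \<omega> (r u) (z u)) h)" for x
    unfolding level_set_def by simp
qed simp

lemma AE_std_normal_iff: "(AE x in std_normal_distribution. P x) \<longleftrightarrow> (AE x in lborel. P x)"
  by (subst AE_density) (auto simp: normal_density_pos)

text \<open>
  Serves to compare normal laws with different means and variances: they are affine images of the
  standard one, which has the null sets of Lebesgue measure (\<open>AE_std_normal_iff\<close>).
\<close>

lemma AE_lborel_affine_iff:
  fixes c t :: real
  assumes c: "c \<noteq> 0" and [measurable]: "Measurable.pred borel P"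
  shows "(AE x in lborel. P (t + c * x)) \<longleftrightarrow> (AE x in lborel. P x)"
proof -
  have "(AE x in lborel. P x) \<longleftrightarrow> (AE x in density (distr lborel borel (\<lambda>x. t + c * x)) (\<lambda>_. ennreal \<bar>c\<bar>). P x)"
    by (subst lborel_real_affine[OF c, of t]) rule
  also have "\<dots> \<longleftrightarrow> (AE x in distr lborel borel (\<lambda>x. t + c * x). P x)"
    using c by (subst AE_density) auto
  also have "\<dots> \<longleftrightarrow> (AE x in lborel. P (t + c * x))"
    by (subst AE_distr_iff) auto
  finally show ?thesis by simp
qed

text \<open>
  Separates the variable at the root, which is independent of the others. The predicate may refer
  to it only through its first argument.
\<close>

lemma white_noise_root_iff:
  fixes Q :: "real \<Rightarrow> (label \<Rightarrow> real) \<Rightarrow> bool"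
  assumes Q[measurable]: "Measurable.pred (std_normal_distribution \<Otimes>\<^sub>M white_noise) (\<lambda>(r, z). Q r z)"
    and Q'[measurable]: "Measurable.pred white_noise (\<lambda>z. Q (z []) z)"
    and upd: "\<And>r z u. Q r (z([] := u)) = Q r z"
  shows "(AE z in white_noise. Q (z []) z) \<longleftrightarrow> (AE r in std_normal_distribution. AE z in white_noise. Q r z)"
proof -
  interpret W: prob_space "white_noise :: (label \<Rightarrow> real) measure" by (rule prob_space_white_noise)
  interpret N: prob_space std_normal_distribution by (rule prob_space_std_normal)
  interpret P: pair_sigma_finite std_normal_distribution "white_noise :: (label \<Rightarrow> real) measure" ..
  let ?f = "\<lambda>(r, z). z([] := r)" and ?P = "std_normal_distribution \<Otimes>\<^sub>M (white_noise :: (label \<Rightarrow> real) measure)"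
  have d: "distr ?P white_noise ?f = white_noise"
    using distr_pair_PiM_eq_PiM[of UNIV "\<lambda>_. std_normal_distribution" "[] :: label"] prob_space_std_normal by simp
  have f: "?f \<in> measurable ?P white_noise"
    by (rule measurable_PiM_single') (auto simp: space_PiM split_beta')
  have "(AE z in white_noise. Q (z []) z) \<longleftrightarrow> (AE z in distr ?P white_noise ?f. Q (z []) z)"
    unfolding d ..
  also have "\<dots> \<longleftrightarrow> (AE u in ?P. Q (?f u []) (?f u))"
    by (rule AE_distr_iff[OF f]) (use Q' in \<open>simp only: pred_def\<close>)
  also have "\<dots> \<longleftrightarrow> (AE u in ?P. (\<lambda>(r, z). Q r z) u)"
    by (simp add: split_beta' upd)
  also have "\<dots> \<longleftrightarrow> (AE r in std_normal_distribution. AE z in white_noise. Q r z)"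
    using P.AE_pair_iff[of Q] Q by (simp add: split_beta' pred_def)
  finally show ?thesis .
qed

text \<open>
  In the transient case, let \<open>R \<rho>\<close> say that the components are almost surely bounded for the field
  on the subtree started from the value \<open>\<rho>\<close>. Under the field on the whole tree and conditionally
  on the root, \<open>\<rho>\<close> is normal with some mean and positive variance; if \<open>h\<close> is subcritical for the
  whole tree, then \<open>R\<close> holds almost surely under this law for at least one value at the root. So
  \<open>R\<close> holds Lebesgue almost everywhere, hence almost surely under the law of the free field of the
  subtree at its root. In the recurrent case both fields vanish.
\<close>

lemma subcritical_shift:
  assumes regular: "regular_weights \<omega>" "regular_weights (shift i \<omega>)"
    and i: "i < num_positive (\<omega> [])"
    and same: "cond_to_infinity \<omega> [] = 0 \<longleftrightarrow> cond_to_infinity (shift i \<omega>) [] = 0"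
    and sub: "subcritical h \<omega>"
  shows "subcritical h (shift i \<omega>)"
proof (cases "cond_to_infinity \<omega> [] = 0")
  case True
  then have "free_field (shift i \<omega>) z = shift i (free_field \<omega> z)" for z
    using same by (auto simp: free_field_def shift_def)
  then show ?thesis using sub bounded_components_shift[of i \<omega>, OF i]
    unfolding subcritical_def by auto
next
  case False
  interpret W: prob_space "white_noise :: (label \<Rightarrow> real) measure" by (rule prob_space_white_noise)
  interpret N: prob_space std_normal_distribution by (rule prob_space_std_normal)
  let ?s = "shift i \<omega>"
  define G where "G \<rho> z \<longleftrightarrow> bounded_components (gw_tree ?s) (subtree_field ?s \<rho> z) h" for \<rho> z
  \<comment> \<open>The value at the child is \<open>A\<close> times the root variable plus \<open>s\<close> times its own variable.\<close>
  define A where "A = parent_weight \<omega> [i] * var_inf \<omega> [i] * sqrt (var_inf \<omega> [])"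
  define s where "s = sqrt (var_inf \<omega> [i])"
  define s' where "s' = sqrt (var_inf ?s [])"
  have iV: "[i] \<in> gw_verts \<omega>" using gw_verts_snoc_iff[of "[]" i \<omega>] i by (simp add: gw_verts.root)
  have s: "s > 0" and s': "s' > 0"
  proof -
    show "s > 0" using parent_weight_pos[OF regular(1) iV] cond_to_infinity_nonneg[OF regular(1), of "[i]"]
      by (simp add: s_def var_inf_def add_pos_nonneg)
    show "s' > 0" using cond_to_infinity_nonneg[OF regular(2), of "[]"] False same
      by (simp add: s'_def var_inf_def)
  qed
  have upd: "G \<rho> (z([] := u)) = G \<rho> z" for \<rho> z u
    by (simp add: G_def subtree_field_upd_root[abs_def])
  have pG: "Measurable.pred N (\<lambda>u. G (r u) (z u))"
    if "r \<in> borel_measurable N" "\<And>x. (\<lambda>u. z u x) \<in> borel_measurable N" for N :: "'b measure" and r z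
    unfolding G_def using that by (rule pred_subtree_bounded)
  have "free_field \<omega> z (i # x) = subtree_field ?s (A * z [] + s * shift i z []) (shift i z) x" for z x
  proof -
    have "subtree_field \<omega> r z [i] = parent_weight \<omega> [i] * var_inf \<omega> [i] * r + s * z [i]" for r
      using tree_field_snoc[of _ _ r z "[]" i] by (simp add: subtree_field_def s_def tree_field_Nil)
    then show ?thesis using False
      by (simp add: free_field_def subtree_field_shift[of \<omega> _ z i x] A_def shift_def[of i z "[]"] mult.assoc)
  qed
  then have "shift i (free_field \<omega> z) = subtree_field ?s (A * z [] + s * shift i z []) (shift i z)" for z
    by (auto simp: shift_def[of i "free_field \<omega> z"])
  then have "AE z in white_noise. G (A * z [] + s * shift i z []) (shift i z)"
    using sub bounded_components_shift[of i \<omega>, OF i] unfolding subcritical_def G_def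
    by (auto elim!: eventually_mono) metis
  then have "AE u in std_normal_distribution. AE z in white_noise. G (A * u + s * shift i z []) (shift i z)"
    by (subst (asm) white_noise_root_iff[where Q = "\<lambda>u z. G (A * u + s * shift i z []) (shift i z)"])
       (auto simp: split_beta' shift_upd_root shift_def[of i _ "[]"] intro!: pG measurable_shift_coord)
  note ae = this
  have "\<exists>u. AE z in white_noise. G (A * u + s * shift i z []) (shift i z)"
  proof (rule ccontr)
    assume no: "\<nexists>u. AE z in white_noise. G (A * u + s * shift i z []) (shift i z)"
    have "AE u in std_normal_distribution. False"
      using ae by (rule eventually_mono) (use no in blast)
    then show False by (simp only: N.AE_False)
  qed
  then obtain u where "AE z in white_noise. G (A * u + s * shift i z []) (shift i z)" ..
  then have "AE z in distr white_noise white_noise (shift i). G (A * u + s * z []) z"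
    using AE_distr_iff[OF measurable_shift pG[of "\<lambda>z. A * u + s * z []" white_noise "\<lambda>z. z", unfolded pred_def]]
    by simp
  then have "AE z in white_noise. G (A * u + s * z []) z"
    unfolding distr_shift[OF prob_space_std_normal] .
  then have "AE r in std_normal_distribution. AE z in white_noise. G (A * u + s * r) z"
    by (subst (asm) white_noise_root_iff[where Q = "\<lambda>r z. G (A * u + s * r) z"])
       (auto simp: split_beta' upd intro!: pG)
  moreover
  define R where "R \<rho> \<longleftrightarrow> (AE z in white_noise. G \<rho> z)" for \<rho>
  have R: "Measurable.pred borel R"
  proof -
    have "Measurable.pred (borel \<Otimes>\<^sub>M (white_noise :: (label \<Rightarrow> real) measure)) (\<lambda>u. G (fst u) (snd u))"
      by (rule pG) auto
    from W.pred_AE[OF this] show ?thesis unfolding R_def by simp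
  qed
  ultimately have "AE r in lborel. R (A * u + s * r)" by (simp add: R_def AE_std_normal_iff)
  then have "AE r in lborel. R r" using AE_lborel_affine_iff[OF _ R] s by simp
  then have "AE r in lborel. R (0 + s' * r)" using AE_lborel_affine_iff[of s' R 0, OF _ R] s' by simp
  then have "AE r in std_normal_distribution. AE z in white_noise. G (s' * r) z"
    by (simp add: R_def AE_std_normal_iff)
  then have "AE z in white_noise. G (s' * z []) z"
    by (subst white_noise_root_iff[where Q = "\<lambda>r z. G (s' * r) z"])
       (auto simp: split_beta' upd intro!: pG)
  then show ?thesis using False same
    unfolding subcritical_def G_def s'_def by (simp add: free_field_def[abs_def])
qed

section \<open>The zero-one law for inherited properties\<close>

text \<open>
  The weights of the root and of the subtrees of its first two children are indexed by disjoint
  sets of labels.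
\<close>

lemma prob_root_subtrees:
  fixes \<nu> :: "'a measure"
  assumes \<nu>: "prob_space \<nu>"
    and C: "C \<in> sets \<nu>" and B: "B \<in> sets (PiM UNIV (\<lambda>_. \<nu>))" "B' \<in> sets (PiM UNIV (\<lambda>_. \<nu>))"
  defines "\<mu> \<equiv> PiM (UNIV :: label set) (\<lambda>_. \<nu>)"
  shows "measure \<mu> {\<omega> \<in> space \<mu>. \<omega> [] \<in> C \<and> shift 0 \<omega> \<in> B \<and> shift 1 \<omega> \<in> B'} =
    measure \<nu> C * measure \<mu> B * measure \<mu> B'"
proof -
  interpret prob_space \<mu> unfolding \<mu>_def by (intro prob_space_PiM \<nu>)
  interpret \<nu>: prob_space \<nu> by (rule \<nu>)
  note [measurable] = C B
  \<comment> \<open>Block \<open>0\<close> is the root, and block \<open>Suc i\<close> the subtree of child \<open>i\<close>.\<close>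
  define K :: "nat \<Rightarrow> label set" where "K j = (if j = 0 then {[]} else range ((#) (j - 1)))" for j
  have ind: "indep_vars (\<lambda>j. PiM (K j) (\<lambda>_. \<nu>)) (\<lambda>j \<omega>. restrict (\<lambda>x. \<omega> x) (K j)) UNIV"
    unfolding \<mu>_def
    by (rule prob_space.indep_vars_restrict[OF _ indep_vars_PiM_coords[OF \<nu>]])
       (auto simp: K_def disjoint_family_on_def intro: prob_space_PiM \<nu>)
  define E where "E j = (if j = 0 then {f \<in> space (PiM (K 0) (\<lambda>_. \<nu>)). f [] \<in> C}
    else {f \<in> space (PiM (K j) (\<lambda>_. \<nu>)). shift (j - 1) f \<in> (if j = 1 then B else B')})" for j
  have E: "E j \<in> sets (PiM (K j) (\<lambda>_. \<nu>))" if "j \<in> {0,1,2}" for j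
  proof (cases "j = 0")
    case True
    have "[] \<in> K 0" by (simp add: K_def)
    then have [measurable]: "(\<lambda>f. f []) \<in> measurable (PiM (K 0) (\<lambda>_. \<nu>)) \<nu>"
      by (rule measurable_component_singleton)
    show ?thesis unfolding True E_def by simp
  next
    case False
    have [measurable]: "shift (j - 1) \<in> measurable (PiM (K j) (\<lambda>_. \<nu>)) (PiM UNIV (\<lambda>_. \<nu>))"
      unfolding shift_def[abs_def]
    proof (rule measurable_PiM_single')
      fix x have "(j - 1) # x \<in> K j" using False by (simp add: K_def)
      then show "(\<lambda>f. f ((j - 1) # x)) \<in> measurable (PiM (K j) (\<lambda>_. \<nu>)) \<nu>"
        by (rule measurable_component_singleton)
    qed (use False in \<open>auto simp: space_PiM K_def\<close>)
    have [measurable]: "(if j = 1 then B else B') \<in> sets (PiM UNIV (\<lambda>_. \<nu>))" using B by simp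
    have "E j = {f \<in> space (PiM (K j) (\<lambda>_. \<nu>)). shift (j - 1) f \<in> (if j = 1 then B else B')}"
      using False by (simp only: E_def if_False)
    also have "\<dots> \<in> sets (PiM (K j) (\<lambda>_. \<nu>))" by measurable
    finally show ?thesis .
  qed
  have sub: "(\<lambda>\<omega>. restrict (\<lambda>x. \<omega> x) (K j)) -` E j \<inter> space \<mu> =
    (if j = 0 then {\<omega> \<in> space \<mu>. \<omega> [] \<in> C} else {\<omega> \<in> space \<mu>. shift (j - 1) \<omega> \<in> (if j = 1 then B else B')})" for j
  proof (cases "j = 0")
    case True
    then show ?thesis by (auto simp: E_def \<mu>_def space_PiM K_def)
  next
    case False
    have "shift (j - 1) (restrict (\<lambda>x. \<omega> x) (K j)) = shift (j - 1) \<omega>" for \<omega> :: "label \<Rightarrow> 'a"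
      using False by (auto simp: shift_def K_def)
    moreover have "restrict (\<lambda>x. \<omega> x) (K j) \<in> space (PiM (K j) (\<lambda>_. \<nu>))" if "\<omega> \<in> space \<mu>" for \<omega>
      using that by (auto simp: \<mu>_def space_PiM)
    ultimately show ?thesis using False by (auto simp: E_def)
  qed
  have root: "prob {\<omega> \<in> space \<mu>. \<omega> [] \<in> C} = measure \<nu> C"
  proof -
    have "measure (distr \<mu> \<nu> (\<lambda>\<omega>. \<omega> [])) C = prob {\<omega> \<in> space \<mu>. \<omega> [] \<in> C}"
      unfolding \<mu>_def by (subst measure_distr) (auto intro!: arg_cong[where f = "measure _"])
    moreover have "distr \<mu> \<nu> (\<lambda>\<omega>. \<omega> []) = \<nu>"
      unfolding \<mu>_def by (rule distr_PiM_component) (auto intro: \<nu>)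
    ultimately show ?thesis by simp
  qed
  have subtree: "prob {\<omega> \<in> space \<mu>. shift i \<omega> \<in> D} = measure \<mu> D" if [measurable]: "D \<in> sets (PiM UNIV (\<lambda>_. \<nu>))" for i D
  proof -
    have "measure (distr \<mu> \<mu> (shift i)) D = prob {\<omega> \<in> space \<mu>. shift i \<omega> \<in> D}"
      unfolding \<mu>_def by (subst measure_distr) (auto intro!: arg_cong[where f = "measure _"])
    then show ?thesis unfolding \<mu>_def distr_shift[OF \<nu>] by simp
  qed
  have "prob (\<Inter>j\<in>{0,1,2}. (\<lambda>\<omega>. restrict (\<lambda>x. \<omega> x) (K j)) -` E j \<inter> space \<mu>) =
    (\<Prod>j\<in>{0,1,2}. prob ((\<lambda>\<omega>. restrict (\<lambda>x. \<omega> x) (K j)) -` E j \<inter> space \<mu>))"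
    by (rule indep_varsD[OF ind]) (use E in auto)
  then have "prob (\<Inter>j\<in>{0,1,2}. (if j = 0 then {\<omega> \<in> space \<mu>. \<omega> [] \<in> C} else {\<omega> \<in> space \<mu>. shift (j - 1) \<omega> \<in> (if j = 1 then B else B')})) =
    measure \<nu> C * measure \<mu> B * measure \<mu> B'"
    unfolding sub using B by (simp add: root subtree)
  moreover have "(\<Inter>j\<in>{0,1,2::nat}. (if j = 0 then {\<omega> \<in> space \<mu>. \<omega> [] \<in> C} else {\<omega> \<in> space \<mu>. shift (j - 1) \<omega> \<in> (if j = 1 then B else B')})) =
    {\<omega> \<in> space \<mu>. \<omega> [] \<in> C \<and> shift 0 \<omega> \<in> B \<and> shift 1 \<omega> \<in> B'}"
    by auto
  ultimately show ?thesis by simp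
qed

locale gw_setting =
  fixes \<nu> :: "(nat \<Rightarrow> real) measure"
  assumes weight_law: "is_weight_law \<nu>"
    and mean: "mean_offspring \<nu> > 1"
    and survives: "AE l in \<nu>. num_positive l \<ge> 1"
begin

lemma prob_nu: "prob_space \<nu>" and sets_nu [measurable_cong]: "sets \<nu> = sets (PiM UNIV (\<lambda>_. borel))"
  using weight_law by (auto simp: is_weight_law_def)

sublocale nu: prob_space \<nu> by (rule prob_nu)

sublocale gw: prob_space "gw_measure \<nu>"
  unfolding gw_measure_def by (intro prob_space_PiM prob_nu)

lemma measurable_num_positive_nu [measurable]: "num_positive \<in> measurable \<nu> (count_space UNIV)"
  unfolding num_positive_def[abs_def] by (rule measurable_card) measurable

text \<open>
  If almost surely no vertex had two children, the mean would be at most \<open>1\<close>.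
\<close>

lemma branching: "measure \<nu> {l \<in> space \<nu>. 2 \<le> num_positive l} > 0"
proof (rule ccontr)
  assume "\<not> ?thesis"
  then have zero: "emeasure \<nu> {l \<in> space \<nu>. 2 \<le> num_positive l} = 0"
    by (simp add: nu.emeasure_eq_measure zero_less_measure_iff)
  have e: "of_nat i * emeasure (offspring_law \<nu>) {i} = (if i = 1 then emeasure (offspring_law \<nu>) {1} else 0)" for i
  proof -
    have "emeasure (offspring_law \<nu>) {i} \<le> emeasure \<nu> {l \<in> space \<nu>. 2 \<le> num_positive l}" if "2 \<le> i"
      unfolding offspring_law_def using that by (subst emeasure_distr) (auto intro!: emeasure_mono)
    then have "emeasure (offspring_law \<nu>) {i} = 0" if "2 \<le> i" using that zero by simp
    then show ?thesis by (cases i rule: nat.exhaust) (auto simp: le_less_Suc_eq Suc_le_eq numeral_2_eq_2)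
  qed
  have "mean_offspring \<nu> = (\<Sum>i. if i = 1 then emeasure (offspring_law \<nu>) {1} else 0)"
    unfolding mean_offspring_def e ..
  also have "\<dots> = (\<Sum>i\<in>{1::nat}. if i = 1 then emeasure (offspring_law \<nu>) {1} else 0)"
    by (rule suminf_finite) auto
  also have "\<dots> = emeasure \<nu> (num_positive -` {1} \<inter> space \<nu>)"
    by (simp add: offspring_law_def emeasure_distr)
  also have "\<dots> \<le> 1" by (rule nu.measure_le_1)
  finally show False using mean by simp
qed

lemma distr_shift_gw: "distr (gw_measure \<nu>) (gw_measure \<nu>) (shift i) = gw_measure \<nu>"
  unfolding gw_measure_def by (rule distr_shift[OF prob_nu])

lemma measurable_shift_gw: "shift i \<in> measurable (gw_measure \<nu>) (gw_measure \<nu>)"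
  unfolding gw_measure_def by measurable

lemma AE_shift: "AE \<omega> in gw_measure \<nu>. P \<omega> \<Longrightarrow> AE \<omega> in gw_measure \<nu>. P (shift i \<omega>)"
  by (rule AE_distrD[OF measurable_shift_gw]) (unfold distr_shift_gw)

lemma pred_gw: "Measurable.pred weight_space P \<Longrightarrow> Measurable.pred (gw_measure \<nu>) P"
  unfolding measurable_cong_sets[OF sets_gw_measure[OF sets_nu] refl] .

lemma AE_regular: "AE \<omega> in gw_measure \<nu>. regular_weights \<omega>"
proof -
  let ?P = "\<lambda>l. (finite {i. l i > (0::real)} \<and> (\<forall>j. l j > 0 \<longrightarrow> (\<forall>i\<le>j. l i > 0))) \<and> num_positive l \<ge> 1"
  have "AE l in \<nu>. ?P l"
    using weight_law survives by (auto simp: is_weight_law_def)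
  then have "AE \<omega> in gw_measure \<nu>. ?P (\<omega> x)" for x
    unfolding gw_measure_def using AE_PiM_component[of UNIV "\<lambda>_. \<nu>" x ?P] prob_nu by simp
  then have "AE \<omega> in gw_measure \<nu>. \<forall>x. ?P (\<omega> x)" by (simp only: AE_all_countable) blast
  with AE_is_weighted_tree_gw_tree[OF weight_law] show ?thesis
  proof (rule AE_mp[OF _ AE_mp], intro AE_I2 impI)
    fix \<omega> :: "label \<Rightarrow> nat \<Rightarrow> real"
    assume P: "\<forall>x. ?P (\<omega> x)" and T: "is_weighted_tree (gw_tree \<omega>)"
    show "regular_weights \<omega>"
      unfolding regular_weights_def
    proof (intro conjI allI impI T)
      fix x show "1 \<le> num_positive (\<omega> x)" using P by blast
      fix i assume "i < num_positive (\<omega> x)"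
      then show "0 < \<omega> x i" using num_positive_initial[of "\<omega> x" i] P by blast
    qed
  qed
qed

text \<open>
  If \<open>P\<close> holds, it holds for the subtree of the first child, and for that of the second child too
  if there is one. By independence the probability \<open>p\<close> of \<open>P\<close> satisfies
  \<open>p \<le> (1 - q) p + q p\<^sup>2\<close> with \<open>q > 0\<close>, which leaves only \<open>p = 0\<close> and \<open>p = 1\<close>.
\<close>

lemma zero_one:
  assumes P: "Measurable.pred weight_space P"
    and inherit: "AE \<omega> in gw_measure \<nu>. P \<omega> \<longrightarrow> (\<forall>i<num_positive (\<omega> []). P (shift i \<omega>))"
  shows "(AE \<omega> in gw_measure \<nu>. P \<omega>) \<or> (AE \<omega> in gw_measure \<nu>. \<not> P \<omega>)"
proof -
  let ?\<mu> = "gw_measure \<nu>"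
  define B where "B = {\<omega> \<in> space ?\<mu>. P \<omega>}"
  define C where "C = {l \<in> space \<nu>. 2 \<le> num_positive l}"
  define p where "p = measure ?\<mu> B"
  define q where "q = measure \<nu> C"
  have B[measurable]: "B \<in> sets ?\<mu>" using pred_gw[OF P] by (simp add: B_def pred_def)
  have C[measurable]: "C \<in> sets \<nu>" unfolding C_def by measurable
  have C': "space \<nu> - C \<in> sets \<nu>" by measurable
  have q: "q > 0" "measure \<nu> (space \<nu> - C) = 1 - q"
    using branching nu.prob_compl[OF C] by (simp_all add: q_def C_def)
  let ?E = "\<lambda>C B B'. {\<omega> \<in> space ?\<mu>. \<omega> [] \<in> C \<and> shift 0 \<omega> \<in> B \<and> shift 1 \<omega> \<in> B'}"
  have root_in: "\<omega> [] \<in> space \<nu>" and shift_in: "shift i \<omega> \<in> space ?\<mu>" if "\<omega> \<in> space ?\<mu>" for \<omega> i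
    using that by (auto simp: gw_measure_def space_PiM PiE_iff shift_def)
  have sets_E: "?E C B B' \<in> sets ?\<mu>" if "C \<in> sets \<nu>" "B \<in> sets ?\<mu>" "B' \<in> sets ?\<mu>" for C B B'
    using that unfolding gw_measure_def by measurable
  have E1: "measure ?\<mu> (?E (space \<nu> - C) B (space ?\<mu>)) = (1 - q) * p"
    using prob_root_subtrees[OF prob_nu C', of B "space ?\<mu>"] B gw.prob_space
    by (simp add: gw_measure_def[symmetric] q p_def)
  have E2: "measure ?\<mu> (?E C B B) = q * p * p"
    using prob_root_subtrees[OF prob_nu C, of B B] B
    by (simp add: gw_measure_def[symmetric] q_def p_def)
  \<comment> \<open>The two events on the right distinguish whether the root has at least two children.\<close>
  have "p \<le> measure ?\<mu> (?E (space \<nu> - C) B (space ?\<mu>) \<union> ?E C B B)"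
    unfolding p_def
  proof (rule gw.finite_measure_mono_AE)
    show "AE \<omega> in ?\<mu>. \<omega> \<in> B \<longrightarrow> \<omega> \<in> ?E (space \<nu> - C) B (space ?\<mu>) \<union> ?E C B B"
    proof (rule AE_mp[OF inherit AE_mp[OF AE_regular]], intro AE_I2 impI)
      fix \<omega> assume \<omega>: "\<omega> \<in> space ?\<mu>" and r: "regular_weights \<omega>" "\<omega> \<in> B"
        and i: "P \<omega> \<longrightarrow> (\<forall>i<num_positive (\<omega> []). P (shift i \<omega>))"
      have n: "num_positive (\<omega> []) \<ge> 1" using r by (simp add: regular_weights_def)
      have s: "shift i \<omega> \<in> B" if "i < num_positive (\<omega> [])" for i
        using i r that shift_in[OF \<omega>] by (auto simp: B_def)
      show "\<omega> \<in> ?E (space \<nu> - C) B (space ?\<mu>) \<union> ?E C B B"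
      proof (cases "\<omega> [] \<in> C")
        case True
        then have "num_positive (\<omega> []) \<ge> 2" by (simp add: C_def)
        then show ?thesis using s[of 0] s[of 1] True \<omega> by simp
      next
        case False
        then show ?thesis using s[of 0] n root_in[OF \<omega>] shift_in[OF \<omega>] \<omega> by simp
      qed
    qed
    show "?E (space \<nu> - C) B (space ?\<mu>) \<union> ?E C B B \<in> sets ?\<mu>"
      by (intro sets.Un sets_E C B C' sets.top)
  qed
  also have "\<dots> \<le> (1 - q) * p + q * p * p"
    unfolding E1[symmetric] E2[symmetric]
    by (intro measure_Un_le sets_E C B C' sets.top)
  finally have "q * (p * (1 - p)) \<le> 0" by (simp add: algebra_simps)
  then have "p * (1 - p) \<le> 0" using q by (simp add: mult_le_0_iff)
  moreover have "0 \<le> p" "p \<le> 1" by (auto simp: p_def)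
  ultimately have "p = 0 \<or> p = 1" by (auto simp: mult_le_0_iff)
  then show ?thesis
  proof
    assume "p = 1"
    then have "AE \<omega> in ?\<mu>. \<omega> \<in> B" by (simp add: p_def gw.prob_eq_1)
    then show ?thesis by (auto simp: B_def)
  next
    assume "p = 0"
    then have "AE \<omega> in ?\<mu>. \<omega> \<notin> B" by (simp add: p_def gw.prob_eq_0)
    then have "AE \<omega> in ?\<mu>. \<not> P \<omega>" by (rule AE_mp) (auto simp: B_def)
    then show ?thesis ..
  qed
qed

text \<open>
  The conductance from the root to infinity is a sum over its children, in which a child with
  positive conductance to infinity contributes a positive term.
\<close>

lemma recurrence_zero_one:
  "(AE \<omega> in gw_measure \<nu>. cond_to_infinity \<omega> [] = 0) \<or> (AE \<omega> in gw_measure \<nu>. cond_to_infinity \<omega> [] \<noteq> 0)"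
proof (rule zero_one)
  show "Measurable.pred weight_space (\<lambda>\<omega>. cond_to_infinity \<omega> [] = 0)" by measurable
  show "AE \<omega> in gw_measure \<nu>. cond_to_infinity \<omega> [] = 0 \<longrightarrow>
    (\<forall>i<num_positive (\<omega> []). cond_to_infinity (shift i \<omega>) [] = 0)"
  proof (rule AE_mp[OF AE_regular], intro AE_I2 impI allI)
    fix \<omega> i assume r: "regular_weights \<omega>" and z: "cond_to_infinity \<omega> [] = 0" and i: "i < num_positive (\<omega> [])"
    let ?t = "\<lambda>i. \<omega> [] i * cond_to_infinity \<omega> [i] / (\<omega> [] i + cond_to_infinity \<omega> [i])"
    have nn: "?t j \<ge> 0" if "j < num_positive (\<omega> [])" for j
      using weight_pos[OF r that] cond_to_infinity_nonneg[OF r, of "[j]"] by simp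
    have "(\<Sum>j<num_positive (\<omega> []). ?t j) = 0" using cond_to_infinity_eq[OF r, of "[]"] z by simp
    then have "?t i = 0" using nn i by (subst (asm) sum_nonneg_eq_0_iff) auto
    then have "cond_to_infinity \<omega> [i] = 0"
      using weight_pos[OF r i] cond_to_infinity_nonneg[OF r, of "[i]"] by auto
    then show "cond_to_infinity (shift i \<omega>) [] = 0" by (simp add: cond_to_infinity_shift)
  qed
qed

text \<open>
  By \<open>recurrence_zero_one\<close> the tree and the subtrees of the children of the root are almost surely of
  the same type, as \<open>subcritical_shift\<close> requires.
\<close>

lemma subcritical_zero_one:
  "(AE \<omega> in gw_measure \<nu>. subcritical h \<omega>) \<or> (AE \<omega> in gw_measure \<nu>. \<not> subcritical h \<omega>)"
proof (rule zero_one[OF measurable_subcritical])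
  have same: "AE \<omega> in gw_measure \<nu>. \<forall>i. cond_to_infinity \<omega> [] = 0 \<longleftrightarrow> cond_to_infinity (shift i \<omega>) [] = 0"
    unfolding AE_all_countable
  proof
    fix i
    from recurrence_zero_one show "AE \<omega> in gw_measure \<nu>. cond_to_infinity \<omega> [] = 0 \<longleftrightarrow> cond_to_infinity (shift i \<omega>) [] = 0"
    proof
      assume "AE \<omega> in gw_measure \<nu>. cond_to_infinity \<omega> [] = 0"
      with AE_shift[OF this, of i] show ?thesis by (auto elim!: AE_mp)
    next
      assume "AE \<omega> in gw_measure \<nu>. cond_to_infinity \<omega> [] \<noteq> 0"
      with AE_shift[OF this, of i] show ?thesis by (auto elim!: AE_mp)
    qed
  qed
  have "AE \<omega> in gw_measure \<nu>. \<forall>i. regular_weights (shift i \<omega>)"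
    unfolding AE_all_countable using AE_shift[OF AE_regular] by blast
  with same AE_regular show "AE \<omega> in gw_measure \<nu>. subcritical h \<omega> \<longrightarrow> (\<forall>i<num_positive (\<omega> []). subcritical h (shift i \<omega>))"
  proof eventually_elim
    case (elim \<omega>)
    then show ?case using subcritical_shift by blast
  qed
qed

text \<open>
  As subcriticality is monotone in the level, the infimum may be taken over rational levels, and
  the countably many zero-one laws for these hold simultaneously.
\<close>

lemma h_star_constant: "\<exists>c. AE \<omega> in gw_measure \<nu>. h_star (gw_tree \<omega>) = c"
proof -
  define Q where "Q = {q :: rat. AE \<omega> in gw_measure \<nu>. subcritical (of_rat q) \<omega>}"
  have "AE \<omega> in gw_measure \<nu>. \<forall>q. subcritical (of_rat q) \<omega> \<longleftrightarrow> q \<in> Q"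
    unfolding AE_all_countable
  proof
    fix q :: rat
    from subcritical_zero_one[of "of_rat q"] show "AE \<omega> in gw_measure \<nu>. subcritical (of_rat q) \<omega> \<longleftrightarrow> q \<in> Q"
    proof
      assume "AE \<omega> in gw_measure \<nu>. subcritical (of_rat q) \<omega>"
      moreover from this have "q \<in> Q" by (simp add: Q_def)
      ultimately show ?thesis by simp
    next
      assume n: "AE \<omega> in gw_measure \<nu>. \<not> subcritical (of_rat q) \<omega>"
      have "q \<notin> Q"
      proof
        assume "q \<in> Q"
        then have "AE \<omega> in gw_measure \<nu>. subcritical (of_rat q) \<omega>" by (simp add: Q_def)
        with n have "AE \<omega> in gw_measure \<nu>. False" by eventually_elim simp
        then show False by (simp only: gw.AE_False)
      qed
      with n show ?thesis by simp
    qed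
  qed
  with AE_regular have "AE \<omega> in gw_measure \<nu>. h_star (gw_tree \<omega>) = Inf ((\<lambda>q. ereal (of_rat q)) ` Q)"
  proof eventually_elim
    case (elim \<omega>)
    have "Inf (ereal ` {h. subcritical h \<omega>}) = Inf ((\<lambda>q. ereal (of_rat q)) ` Q)"
    proof (rule antisym)
      show "Inf (ereal ` {h. subcritical h \<omega>}) \<le> Inf ((\<lambda>q. ereal (of_rat q)) ` Q)"
        by (rule Inf_superset_mono) (use elim in auto)
      show "Inf ((\<lambda>q. ereal (of_rat q)) ` Q) \<le> Inf (ereal ` {h. subcritical h \<omega>})"
      proof (rule Inf_greatest)
        fix e assume "e \<in> ereal ` {h. subcritical h \<omega>}"
        then obtain h where h: "e = ereal h" "subcritical h \<omega>" by auto
        show "Inf ((\<lambda>q. ereal (of_rat q)) ` Q) \<le> e"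
          unfolding h(1)
        proof (rule ccontr)
          assume "\<not> Inf ((\<lambda>q. ereal (of_rat q)) ` Q) \<le> ereal h"
          then obtain r where r: "ereal h < ereal r" "ereal r < Inf ((\<lambda>q. ereal (of_rat q)) ` Q)"
            using ereal_dense2[of "ereal h"] by (auto simp: not_le)
          then obtain q where q: "h < of_rat q" "of_rat q < r"
            using of_rat_dense[of h r] by auto
          then have "q \<in> Q" using subcritical_mono[OF h(2), of "of_rat q"] elim by simp
          then have "Inf ((\<lambda>q. ereal (of_rat q)) ` Q) \<le> ereal (of_rat q)" by (intro Inf_lower) auto
          also have "\<dots> < ereal r" using q by simp
          finally show False using r by simp
        qed
      qed
    qed
    then show ?case using h_star_eq_Inf_subcritical elim by simp
  qed
  then show ?thesis by blast
qed

end

theorem theoremA1: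
  fixes \<nu> :: "(nat \<Rightarrow> real) measure"
  assumes "is_weight_law \<nu>"
    and "mean_offspring \<nu> > 1"
    and "(\<integral>\<^sup>+l. (\<Sum>i. ennreal (l i)) \<partial>\<nu>) < \<infinity>"
    and "AE l in \<nu>. num_positive l \<ge> 1"
  shows "\<exists>c. AE \<omega> in gw_measure \<nu>. h_star (gw_tree \<omega>) = c"
proof -
  interpret gw_setting \<nu> using assms by unfold_locales
  show ?thesis by (rule h_star_constant)
qed

end
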